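(* Let $F\in T_d$ be a (nonzero) binary form, where $T=\mathbb{C}[x_0,x_1]$. Then $\mathrm{crk}(F)=\mathrm{srk}(F)=\underline{\mathbf{rk}}(F)=:r$ and $\mathrm{VPS}(F,r)\cong\underline{\mathrm{VSP}}(F,r)$, where the isomorphism is induced by the isomorphism $\phi_{r,\mathbb{P}^1}$; moreover either $\mathrm{VPS}(F,r)\cong\mathbb{P}^1$ or $\mathrm{VPS}(F,r)$ is a point. If $\mathrm{VPS}(F,r)\cong\mathbb{P}^1$, then $d$ is even. Moreover, if $\mathrm{rk}(F)=r$, then $\mathrm{VSP}(F,r)\cong\mathrm{VPS}(F,r)$.
   Context: $S=\mathbb{C}[y_0,y_1]$ and $T=\mathbb{C}[x_0,x_1]$ are standard graded ($d\ge 1$), $S$ acting on $T$ by differentiation; $\mathrm{Ann}(F)=\{\psi\in S:\psi\circ F=0\}$. $\mathbb{P}^1$ is embedded in $\mathbb{P}(T_d)$ by the $d$-th Veronese map $\nu_d$. Rank $\mathrm{rk}(F)$ (resp. smoothable rank $\mathrm{srk}(F)$, cactus rank $\mathrm{crk}(F)$): the least length of a reduced finite (resp. finite smoothable, finite) subscheme $Z\subset\mathbb{P}^1$ whose saturated ideal satisfies $I_Z\subset\mathrm{Ann}(F)$. Border rank $\underline{\mathbf{rk}}(F)$: the least $r$ such that $[F]$ lies in the $r$-th secant variety of $\nu_d(\mathbb{P}^1)$. $\mathrm{VPS}(F,r)=\{Z\in\mathrm{Hilb}^r(\mathbb{P}^1):I_Z\subset\mathrm{Ann}(F)\}$; $\mathrm{VSP}(F,r)$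 is the Zariski closure in $\mathrm{Hilb}^r(\mathbb{P}^1)$ of the set of reduced $Z\in\mathrm{VPS}(F,r)$. $h_{r,\mathbb{P}^1}(k)=\min\{r,\dim_{\mathbb C}S_k\}$; $\mathrm{Hilb}_S^{h_{r,\mathbb{P}^1}}$ is the multigraded Hilbert scheme of homogeneous ideals whose quotient has Hilbert function $h_{r,\mathbb{P}^1}$; $\mathrm{Slip}_{r,\mathbb{P}^1}$ is its irreducible component that is the closure of the locus of saturated ideals of $r$ distinct points; $\underline{\mathrm{VSP}}(F,r)=\{J\in\mathrm{Slip}_{r,\mathbb{P}^1}:J\subset\mathrm{Ann}(F)\}$. The map $\phi_{r,\mathbb{P}^1}\colon\mathrm{Slip}_{r,\mathbb{P}^1}\to\mathrm{Hilb}^r(\mathbb{P}^1)$, $J\mapsto\mathrm{Proj}(S/J)$, is an isomorphism. *)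

theory Defs
  imports "HOL-Analysis.Analysis" "HOL-Computational_Algebra.Polynomial"
begin

section \<open>Binary forms and apolarity\<close>

text \<open>
  Both \<open>S = \<complex>[y\<^sub>0,y\<^sub>1]\<close> and \<open>T = \<complex>[x\<^sub>0,x\<^sub>1]\<close> are represented by the type \<open>complex poly poly\<close>, read as
  \<open>\<complex>[y\<^sub>0][y\<^sub>1]\<close>: the coefficient of \<open>y\<^sub>0^i y\<^sub>1^j\<close> in \<open>p\<close> is \<open>coeff (coeff p j) i\<close>.
\<close>

type_synonym bipoly = "complex poly poly"

definition bicoeff :: "bipoly \<Rightarrow> nat \<Rightarrow> nat \<Rightarrow> complex" where
  "bicoeff p i j = coeff (coeff p j) i"

definition cscale :: "complex \<Rightarrow> bipoly \<Rightarrow> bipoly" where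
  "cscale c p = smult [:c:] p"

interpretation CV: vector_space cscale
proof
  fix a b :: complex and p q :: bipoly
  show "cscale a (p + q) = cscale a p + cscale a q"
    unfolding cscale_def by (rule smult_add_right)
  show "cscale (a + b) p = cscale a p + cscale b p"
    unfolding cscale_def by (simp flip: smult_add_left)
  show "cscale a (cscale b p) = cscale (a * b) p"
    unfolding cscale_def by (simp add: mult.commute)
  show "cscale 1 p = p"
    unfolding cscale_def by (simp flip: one_pCons)
qed

definition forms :: "nat \<Rightarrow> bipoly set" where
  "forms k = {p. \<forall>i j. bicoeff p i j \<noteq> 0 \<longrightarrow> i + j = k}"

definition hom_part :: "nat \<Rightarrow> bipoly \<Rightarrow> bipoly" where
  "hom_part k p = (\<Sum>i\<le>k. monom (monom (bicoeff p i (k - i)) i) (k - i))"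

definition eval_at :: "bipoly \<Rightarrow> complex ^ 2 \<Rightarrow> complex" where
  "eval_at p a = poly (poly p [:a $ 2:]) (a $ 1)"

definition dx0 :: "bipoly \<Rightarrow> bipoly" where
  "dx0 = map_poly pderiv"

definition dx1 :: "bipoly \<Rightarrow> bipoly" where
  "dx1 = pderiv"

definition apolar_action :: "bipoly \<Rightarrow> bipoly \<Rightarrow> bipoly" where
  "apolar_action \<psi> F =
     (\<Sum>j\<le>degree \<psi>. \<Sum>i\<le>degree (coeff \<psi> j). cscale (bicoeff \<psi> i j) ((dx0 ^^ i) ((dx1 ^^ j) F)))"

definition Ann :: "bipoly \<Rightarrow> bipoly set" where
  "Ann F = {\<psi>. apolar_action \<psi> F = 0}"


section \<open>Homogeneous ideals\<close>

definition hom_ideal :: "bipoly set \<Rightarrow> bool" where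
  "hom_ideal I \<longleftrightarrow> module.subspace (*) I \<and> (\<forall>p\<in>I. \<forall>k. hom_part k p \<in> I)"

text \<open>Saturation with respect to \<open>\<mm> = (y\<^sub>0,y\<^sub>1)\<close>; the ideal \<open>\<mm>^n\<close> is generated by \<open>forms n\<close>.\<close>

definition saturation :: "bipoly set \<Rightarrow> bipoly set" where
  "saturation I = {p. \<exists>n. \<forall>q\<in>forms n. q * p \<in> I}"

definition saturated :: "bipoly set \<Rightarrow> bool" where
  "saturated I \<longleftrightarrow> saturation I = I"

definition radical_ideal :: "bipoly set \<Rightarrow> bool" where
  "radical_ideal I \<longleftrightarrow> (\<forall>p n. p ^ n \<in> I \<longrightarrow> p \<in> I)"

definition hilbert_fun :: "bipoly set \<Rightarrow> nat \<Rightarrow> nat" where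
  "hilbert_fun I k = CV.dim (forms k) - CV.dim (I \<inter> forms k)"


section \<open>Varieties as spaces with functions\<close>

text \<open>
  A variety is given by its closed points, and for every point \<open>x\<close> the set \<open>reps x\<close> of its
  representatives in an affine space with coordinate functions \<open>coords\<close>: the nonzero vectors on a
  line for a projective space, the bases of a subspace for a Grassmannian. The variety carries the
  quotient structure: a set of points is closed iff its preimage in the representatives is
  cut out by polynomials in the coordinates, and a function is regular iff its pull-back to the
  representatives is locally a quotient of polynomials. This is the usual structure
  on \<open>\<P>(V) = (V - 0)/GL\<^sub>1\<close> and on a Grassmannian (injective frames modulo \<open>GL\<^sub>m\<close>), on their
  products, and (with the induced reduced structure) on subvarieties of these.
\<close>

record ('x, 'b) variety =
  points :: "'x set"
  reps :: "'x \<Rightarrow> 'b set"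
  coords :: "('b \<Rightarrow> complex) set"

inductive_set poly_funs :: "('b \<Rightarrow> complex) set \<Rightarrow> ('b \<Rightarrow> complex) set"
  for C :: "('b \<Rightarrow> complex) set" where
  const: "(\<lambda>_. c) \<in> poly_funs C"
| coord: "f \<in> C \<Longrightarrow> f \<in> poly_funs C"
| add: "f \<in> poly_funs C \<Longrightarrow> g \<in> poly_funs C \<Longrightarrow> (\<lambda>b. f b + g b) \<in> poly_funs C"
| mult: "f \<in> poly_funs C \<Longrightarrow> g \<in> poly_funs C \<Longrightarrow> (\<lambda>b. f b * g b) \<in> poly_funs C"

definition zariski_open :: "('x, 'b) variety \<Rightarrow> 'x set \<Rightarrow> bool" where
  "zariski_open V U \<longleftrightarrow> U \<subseteq> points V \<and>
     (\<exists>E \<subseteq> poly_funs (coords V). \<forall>x\<in>points V. \<forall>b\<in>reps V x. x \<in> U \<longleftrightarrow> (\<exists>p\<in>E. p b \<noteq> 0))"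

definition zariski :: "('x, 'b) variety \<Rightarrow> 'x topology" where
  "zariski V = topology (zariski_open V)"

lemma zariski_openI:
  assumes "U \<subseteq> points V" "E \<subseteq> poly_funs (coords V)"
    and "\<And>x b. x \<in> points V \<Longrightarrow> b \<in> reps V x \<Longrightarrow> x \<in> U \<longleftrightarrow> (\<exists>p\<in>E. p b \<noteq> 0)"
  shows "zariski_open V U"
  unfolding zariski_open_def
  by (intro conjI exI[of _ E] ballI) (simp_all only: assms)

lemma zariski_openD:
  assumes "zariski_open V U"
  shows "U \<subseteq> points V"
    and "\<exists>E \<subseteq> poly_funs (coords V). \<forall>x\<in>points V. \<forall>b\<in>reps V x. x \<in> U \<longleftrightarrow> (\<exists>p\<in>E. p b \<noteq> 0)"
  using assms unfolding zariski_open_def by (rule conjunct1, rule conjunct2)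

lemma istopology_zariski_open: "istopology (zariski_open V)"
  unfolding istopology_def
proof (intro conjI allI impI)
  fix A B assume A: "zariski_open V A" and B: "zariski_open V B"
  from zariski_openD(2)[OF A] obtain E where E: "E \<subseteq> poly_funs (coords V)"
      "\<forall>x\<in>points V. \<forall>b\<in>reps V x. x \<in> A \<longleftrightarrow> (\<exists>p\<in>E. p b \<noteq> 0)"
    by (elim exE conjE)
  from zariski_openD(2)[OF B] obtain G where G: "G \<subseteq> poly_funs (coords V)"
      "\<forall>x\<in>points V. \<forall>b\<in>reps V x. x \<in> B \<longleftrightarrow> (\<exists>p\<in>G. p b \<noteq> 0)"
    by (elim exE conjE)
  let ?H = "(\<lambda>(p, q) b. p b * q b) ` (E \<times> G)"
  show "zariski_open V (A \<inter> B)"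
  proof (rule zariski_openI)
    show "A \<inter> B \<subseteq> points V"
      using zariski_openD(1)[OF A] by (rule le_infI1)
    show "?H \<subseteq> poly_funs (coords V)"
    proof (clarify)
      fix p q assume "p \<in> E" "q \<in> G"
      then show "(\<lambda>b. p b * q b) \<in> poly_funs (coords V)"
        using E(1) G(1) by (intro poly_funs.mult) (erule (1) subsetD)+
    qed
    fix x b assume xb: "x \<in> points V" "b \<in> reps V x"
    have "(\<exists>p\<in>?H. p b \<noteq> 0) \<longleftrightarrow> (\<exists>p\<in>E. p b \<noteq> 0) \<and> (\<exists>q\<in>G. q b \<noteq> 0)"
      by (simp add: bex_simps)
    then show "x \<in> A \<inter> B \<longleftrightarrow> (\<exists>p\<in>?H. p b \<noteq> 0)"
      by (simp only: Int_iff E(2)[rule_format, OF xb] G(2)[rule_format, OF xb])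
  qed
next
  fix K assume K: "\<forall>A\<in>K. zariski_open V A"
  let ?E = "{p \<in> poly_funs (coords V). \<forall>x\<in>points V. \<forall>b\<in>reps V x. p b \<noteq> 0 \<longrightarrow> x \<in> \<Union>K}"
  show "zariski_open V (\<Union>K)"
  proof (rule zariski_openI)
    show "\<Union>K \<subseteq> points V"
    proof (rule Union_least)
      fix A assume "A \<in> K"
      with K have "zariski_open V A" by (rule bspec)
      then show "A \<subseteq> points V" by (rule zariski_openD)
    qed
    show "?E \<subseteq> poly_funs (coords V)"
      by (rule Collect_subset)
    fix x b assume xb: "x \<in> points V" "b \<in> reps V x"
    show "x \<in> \<Union>K \<longleftrightarrow> (\<exists>p\<in>?E. p b \<noteq> 0)"
    proof
      assume "x \<in> \<Union>K"
      then obtain A where A: "A \<in> K" "x \<in> A" by (rule UnionE)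
      with K have "zariski_open V A" by (elim bspec)
      from zariski_openD(2)[OF this] obtain E where E: "E \<subseteq> poly_funs (coords V)"
          "\<forall>x\<in>points V. \<forall>b\<in>reps V x. x \<in> A \<longleftrightarrow> (\<exists>p\<in>E. p b \<noteq> 0)"
        by (elim exE conjE)
      from E(2)[rule_format, OF xb] A(2) obtain p where p: "p \<in> E" "p b \<noteq> 0" by (simp only: simp_thms) (erule bexE)
      have "y \<in> \<Union>K" if "y \<in> points V" "c \<in> reps V y" "p c \<noteq> 0" for y c
      proof (rule UnionI[OF A(1)])
        show "y \<in> A"
          by (rule iffD2[OF E(2)[rule_format, OF that(1,2)]]) (rule bexI[of _ p], fact that, fact p)
      qed
      with p E(1) show "\<exists>p\<in>?E. p b \<noteq> 0"
        by (intro bexI[of _ p] CollectI conjI ballI impI) (simp_all add: subset_iff)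
    next
      assume "\<exists>p\<in>?E. p b \<noteq> 0"
      then show "x \<in> \<Union>K"
        by (elim bexE CollectE conjE) (drule bspec[OF _ xb(1)], drule bspec[OF _ xb(2)], erule (1) mp)
    qed
  qed
qed

lemma openin_zariski [simp]: "openin (zariski V) = zariski_open V"
  by (simp add: zariski_def istopology_zariski_open)

lemma topspace_zariski [simp]:
  fixes V :: "('x, 'b) variety"
  shows "topspace (zariski V) = points V"
proof -
  let ?E = "{\<lambda>_. 1} :: ('b \<Rightarrow> complex) set"
  have "?E \<subseteq> poly_funs (coords V)"
    by (simp add: poly_funs.const)
  moreover have "\<forall>x\<in>points V. \<forall>b\<in>reps V x. x \<in> points V \<longleftrightarrow> (\<exists>p\<in>?E. p b \<noteq> 0)"
    by simp
  ultimately have "zariski_open V (points V)"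
    unfolding zariski_open_def by blast
  moreover have "\<And>U. zariski_open V U \<Longrightarrow> U \<subseteq> points V"
    unfolding zariski_open_def by (rule conjunct1)
  ultimately show ?thesis
    unfolding topspace_def openin_zariski by blast
qed

definition regular_on :: "('x, 'b) variety \<Rightarrow> 'x set \<Rightarrow> ('x \<Rightarrow> complex) \<Rightarrow> bool" where
  "regular_on V U f \<longleftrightarrow>
     (\<forall>x\<in>U. \<forall>b\<in>reps V x. \<exists>p\<in>poly_funs (coords V). \<exists>q\<in>poly_funs (coords V).
        q b \<noteq> 0 \<and> (\<forall>x'\<in>U. \<forall>b'\<in>reps V x'. q b' \<noteq> 0 \<longrightarrow> f x' = p b' / q b'))"

definition morphism :: "('x, 'b) variety \<Rightarrow> ('y, 'c) variety \<Rightarrow> ('x \<Rightarrow> 'y) \<Rightarrow> bool" where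
  "morphism V W \<phi> \<longleftrightarrow> continuous_map (zariski V) (zariski W) \<phi> \<and>
     (\<forall>U f. openin (zariski W) U \<and> regular_on W U f \<longrightarrow>
        regular_on V {x \<in> points V. \<phi> x \<in> U} (f \<circ> \<phi>))"

definition isomorphism :: "('x, 'b) variety \<Rightarrow> ('y, 'c) variety \<Rightarrow> ('x \<Rightarrow> 'y) \<Rightarrow> bool" where
  "isomorphism V W \<phi> \<longleftrightarrow> bij_betw \<phi> (points V) (points W) \<and>
     morphism V W \<phi> \<and> morphism W V (inv_into (points V) \<phi>)"

definition isomorphic :: "('x, 'b) variety \<Rightarrow> ('y, 'c) variety \<Rightarrow> bool" where
  "isomorphic V W \<longleftrightarrow> (\<exists>\<phi>. isomorphism V W \<phi>)"

definition subvariety :: "('x, 'b) variety \<Rightarrow> 'x set \<Rightarrow> ('x, 'b) variety" where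
  "subvariety V A = V\<lparr>points := points V \<inter> A\<rparr>"


section \<open>Projective spaces, the Veronese map and secant varieties\<close>

definition P1 :: "((complex ^ 2) set, complex ^ 2) variety" where
  "P1 = \<lparr>points = {L. vec.subspace L \<and> vec.dim L = 1},
         reps = (\<lambda>L. L - {0}),
         coords = {\<lambda>a. a $ i | i. True}\<rparr>"

definition proj_forms :: "nat \<Rightarrow> (bipoly set, bipoly) variety" where
  "proj_forms d = \<lparr>points = {L. CV.subspace L \<and> L \<subseteq> forms d \<and> CV.dim L = 1},
                   reps = (\<lambda>L. L - {0}),
                   coords = {\<lambda>G. bicoeff G i j | i j. True}\<rparr>"

definition linear_form :: "complex ^ 2 \<Rightarrow> bipoly" where
  "linear_form a = [:[:0, a $ 1:], [:a $ 2:]:]"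

definition veronese :: "nat \<Rightarrow> (complex ^ 2) set \<Rightarrow> bipoly set" where
  "veronese d L = CV.span ((\<lambda>a. linear_form a ^ d) ` L)"

definition secant_variety :: "nat \<Rightarrow> nat \<Rightarrow> bipoly set set" where
  "secant_variety d r = zariski (proj_forms d) closure_of
     {L \<in> points (proj_forms d).
        \<exists>\<Gamma> \<subseteq> points P1. finite \<Gamma> \<and> card \<Gamma> = r \<and> L \<subseteq> CV.span (\<Union>(veronese d ` \<Gamma>))}"


section \<open>Hilbert schemes\<close>

text \<open>
  Bases of the graded pieces \<open>I\<^sub>k\<close>, \<open>k \<in> D\<close>; \<open>b k\<close> lists a basis of \<open>I\<^sub>k\<close> as
  \<open>b k 0, \<dots>, b k (dim I\<^sub>k - 1)\<close> and is padded with zeros. (A spanning family with \<open>dim I\<^sub>k\<close> members is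
  a basis.) These are the representatives of the point \<open>(I\<^sub>k)\<^sub>k\<close> of a product of Grassmannians.
\<close>

definition graded_frames :: "nat set \<Rightarrow> bipoly set \<Rightarrow> (nat \<Rightarrow> nat \<Rightarrow> bipoly) set" where
  "graded_frames D I = {b. \<forall>k.
     (k \<in> D \<longrightarrow> CV.span (b k ` {..<CV.dim (I \<inter> forms k)}) = I \<inter> forms k) \<and>
     (\<forall>i. k \<notin> D \<or> i \<ge> CV.dim (I \<inter> forms k) \<longrightarrow> b k i = 0)}"

definition frame_coords :: "((nat \<Rightarrow> nat \<Rightarrow> bipoly) \<Rightarrow> complex) set" where
  "frame_coords = {\<lambda>b. bicoeff (b k m) i j | k m i j. True}"

text \<open>
  A finite subscheme of \<open>\<P>\<^sup>1\<close> is represented by its saturated homogeneous ideal \<open>I\<close>. It has length \<open>r\<close> iff the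
  Hilbert polynomial of \<open>S/I\<close> is \<open>r\<close>, and it is reduced iff \<open>I\<close> is radical. As \<open>r\<close> is the Gotzmann
  number of the constant Hilbert polynomial \<open>r\<close>, the maps \<open>I \<mapsto> I\<^sub>k\<close> for \<open>k \<ge> r\<close> are defined on
  the Hilbert scheme and embed it into Grassmannians.
\<close>

definition Hilb :: "nat \<Rightarrow> (bipoly set, nat \<Rightarrow> nat \<Rightarrow> bipoly) variety" where
  "Hilb r = \<lparr>points = {I. hom_ideal I \<and> saturated I \<and> (\<forall>\<^sub>F k in sequentially. hilbert_fun I k = r)},
             reps = graded_frames {r..},
             coords = frame_coords\<rparr>"

definition reduced_locus :: "nat \<Rightarrow> bipoly set set" where
  "reduced_locus r = {I \<in> points (Hilb r). radical_ideal I}"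

definition smoothable_locus :: "nat \<Rightarrow> bipoly set set" where
  "smoothable_locus r = zariski (Hilb r) closure_of reduced_locus r"

definition MHilb :: "(nat \<Rightarrow> nat) \<Rightarrow> (bipoly set, nat \<Rightarrow> nat \<Rightarrow> bipoly) variety" where
  "MHilb h = \<lparr>points = {J. hom_ideal J \<and> hilbert_fun J = h},
              reps = graded_frames UNIV,
              coords = frame_coords\<rparr>"

definition h_generic :: "nat \<Rightarrow> nat \<Rightarrow> nat" where
  "h_generic r k = min r (CV.dim (forms k))"

text \<open>The lines in \<open>\<Gamma>\<close> are viewed as subsets of the affine cone \<open>\<complex>\<^sup>2\<close>.\<close>

definition vanishing_ideal :: "(complex ^ 2) set set \<Rightarrow> bipoly set" where
  "vanishing_ideal \<Gamma> = {\<psi>. \<forall>L\<in>\<Gamma>. \<forall>a\<in>L. eval_at \<psi> a = 0}"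

definition Slip :: "nat \<Rightarrow> (bipoly set, nat \<Rightarrow> nat \<Rightarrow> bipoly) variety" where
  "Slip r = subvariety (MHilb (h_generic r))
     (zariski (MHilb (h_generic r)) closure_of
        {J \<in> points (MHilb (h_generic r)).
           \<exists>\<Gamma> \<subseteq> points P1. finite \<Gamma> \<and> card \<Gamma> = r \<and> J = vanishing_ideal \<Gamma>})"

text \<open>\<open>Proj (S/J)\<close>, as a subscheme of \<open>\<P>\<^sup>1\<close>, is represented by the saturation of \<open>J\<close>.\<close>

definition slip_to_hilb :: "bipoly set \<Rightarrow> bipoly set" where
  "slip_to_hilb J = saturation J"


section \<open>Ranks and varieties of sums of powers\<close>

definition rk :: "bipoly \<Rightarrow> nat" where
  "rk F = (LEAST r. \<exists>Z \<in> reduced_locus r. Z \<subseteq> Ann F)"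

definition srk :: "bipoly \<Rightarrow> nat" where
  "srk F = (LEAST r. \<exists>Z \<in> smoothable_locus r. Z \<subseteq> Ann F)"

definition crk :: "bipoly \<Rightarrow> nat" where
  "crk F = (LEAST r. \<exists>Z \<in> points (Hilb r). Z \<subseteq> Ann F)"

text \<open>The degree \<open>d\<close> of \<open>F\<close> is passed explicitly.\<close>

definition border_rk :: "nat \<Rightarrow> bipoly \<Rightarrow> nat" where
  "border_rk d F = (LEAST r. CV.span {F} \<in> secant_variety d r)"

definition VPS :: "bipoly \<Rightarrow> nat \<Rightarrow> (bipoly set, nat \<Rightarrow> nat \<Rightarrow> bipoly) variety" where
  "VPS F r = subvariety (Hilb r) {Z. Z \<subseteq> Ann F}"

definition VSP :: "bipoly \<Rightarrow> nat \<Rightarrow> (bipoly set, nat \<Rightarrow> nat \<Rightarrow> bipoly) variety" where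
  "VSP F r = subvariety (Hilb r) (zariski (Hilb r) closure_of (points (VPS F r) \<inter> reduced_locus r))"

definition border_VSP :: "bipoly \<Rightarrow> nat \<Rightarrow> (bipoly set, nat \<Rightarrow> nat \<Rightarrow> bipoly) variety" where
  "border_VSP F r = subvariety (Slip r) {J. J \<subseteq> Ann F}"

end

theory Submission
  imports Defs "HOL-Computational_Algebra.Fundamental_Theorem_Algebra"
begin

text \<open>
  A saturated homogeneous ideal of \<open>S\<close> with constant Hilbert polynomial \<open>r\<close> is generated by a single
  form of degree \<open>r\<close>, and so is every homogeneous ideal with Hilbert function \<open>h\<^sub>r\<close>. Hence saturation
  is the identity on \<open>Slip r\<close>, and \<open>VPS F r\<close> is the projectivization of the degree \<open>r\<close> part of
  \<open>Ann F\<close>, whose least nonzero degree is \<open>crk F\<close>. Counting equations in the catalecticant (Hankel)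
  system gives \<open>2 r \<le> d + 2\<close>; the degree \<open>r\<close> part is a line if \<open>2 r \<le> d + 1\<close> and a plane if
  \<open>2 r = d + 2\<close>, which forces \<open>d\<close> to be even.

  A form is a product of linear forms, and moving these along lines makes them pairwise independent
  for all but finitely many values of the parameter \<open>t\<close>. A polynomial that does not vanish at \<open>t = 0\<close>
  does not vanish for almost all \<open>t\<close>, so reduced subschemes are dense. If \<open>F\<close> is moved along, by
  solving the catalecticant system over \<open>\<complex>[t]\<close>, then apolarity puts \<open>F\<close> into the \<open>r\<close>-th secant variety.
  Conversely, the existence of a nonzero apolar form of degree \<open>s\<close> is a closed condition on \<open>F\<close>.
\<close>


section \<open>Binary forms as homogenized polynomials\<close>

text \<open>Forms of degree \<open>k\<close> are handled as polynomials \<open>p\<close> in one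
  variable with \<open>degree p \<le> k\<close>, which makes division with remainder, derivatives
  and complex roots available. The price is the point (0,1): the order of vanishing there shows only
  as the drop \<open>k - degree p\<close>, so most arguments about roots have a second half about
  degrees. Isomorphisms are built from polynomial maps between representatives, and membership in a
  Zariski closure from a polynomial curve of representatives. For the Hilbert schemes both rest on a
  frame, \<open>pframe\<close>, that depends polynomially on a generator. With \<open>F\<close>
  replaced by its functional \<open>\<Phi>\<close> on polynomials of degree at most
  \<open>d\<close>, apolarity in degree \<open>k \<le> d\<close> means
  \<open>\<Phi> (q * p) = 0\<close> for all \<open>q\<close> of degree at most \<open>d - k\<close>.
  The absence of solutions in degree \<open>r - 1\<close> is what bounds the solutions in degree
  \<open>r\<close>. Density of reduced schemes in the whole Hilbert scheme says nothing inside
  \<open>VPS F r\<close>. The last claim therefore joins any apolar \<open>h\<close> to one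
  squarefree apolar \<open>f\<close> by the pencil h + t f, where a Wronskian leaves only finitely
  many t with a double zero.\<close>

lemma bipoly_eqI: "(\<And>i j. bicoeff p i j = bicoeff q i j) \<Longrightarrow> p = q"
  unfolding bicoeff_def by (intro poly_eqI)

lemma bicoeff_0 [simp]: "bicoeff 0 i j = 0"
  and bicoeff_add [simp]: "bicoeff (p + q) i j = bicoeff p i j + bicoeff q i j"
  and bicoeff_diff [simp]: "bicoeff (p - q) i j = bicoeff p i j - bicoeff q i j"
  and bicoeff_cscale [simp]: "bicoeff (cscale c p) i j = c * bicoeff p i j"
  and bicoeff_sum [simp]: "bicoeff (sum f A) i j = (\<Sum>a\<in>A. bicoeff (f a) i j)"
  by (simp_all add: bicoeff_def cscale_def coeff_sum)

lemma bicoeff_mult: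
  "bicoeff (p * q) i j = (\<Sum>b\<le>j. \<Sum>a\<le>i. bicoeff p a b * bicoeff q (i - a) (j - b))"
  by (simp add: bicoeff_def coeff_mult coeff_sum)

lemma bicoeff_monom: "bicoeff (monom (monom c a) b) i j = (if i = a \<and> j = b then c else 0)"
  by (auto simp: bicoeff_def)

text \<open>This is y_0^k p(y_1/y_0). For a nonzero \<open>p\<close> of degree at most
  \<open>k\<close> the factor y_0 occurs with multiplicity \<open>k - degree p\<close>, the order of
  vanishing at (0,1).\<close>

definition homog :: "nat \<Rightarrow> complex poly \<Rightarrow> bipoly" where
  "homog k p = (\<Sum>j\<le>k. monom (monom (coeff p j) (k - j)) j)"

lemma bicoeff_homog: "bicoeff (homog k p) i j = (if i + j = k then coeff p j else 0)"
proof -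
  have "bicoeff (homog k p) i j = (\<Sum>b\<le>k. if b = j then (if i = k - b then coeff p b else 0) else 0)"
    unfolding homog_def bicoeff_sum bicoeff_monom by (intro sum.cong) auto
  then show ?thesis by auto
qed

lemma homog_in_forms [simp]: "homog k p \<in> forms k"
  by (simp add: forms_def bicoeff_homog)

lemma homog_0 [simp]: "homog k 0 = 0"
  and homog_add: "homog k (p + q) = homog k p + homog k q"
  and homog_diff: "homog k (p - q) = homog k p - homog k q"
  and homog_smult: "homog k (smult c p) = cscale c (homog k p)"
  and homog_sum: "homog k (\<Sum>a\<in>A. f a) = (\<Sum>a\<in>A. homog k (f a))"
  by (rule bipoly_eqI; simp add: bicoeff_homog coeff_sum)+

lemma homog_inject:
  assumes "degree p \<le> k" "degree q \<le> k"
  shows "homog k p = homog k q \<longleftrightarrow> p = q"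
proof
  assume eq: "homog k p = homog k q"
  show "p = q"
  proof (rule poly_eqI)
    fix j show "coeff p j = coeff q j"
    proof (cases "j \<le> k")
      case True
      then show ?thesis using arg_cong[OF eq, of "\<lambda>x. bicoeff x (k - j) j"] by (simp add: bicoeff_homog)
    next
      case False
      then show ?thesis using assms by (simp add: coeff_eq_0)
    qed
  qed
qed simp

lemma homog_eq_0_iff: "degree p \<le> k \<Longrightarrow> homog k p = 0 \<longleftrightarrow> p = 0"
  using homog_inject[of p k 0] by simp

lemma forms_homogE:
  assumes "f \<in> forms k"
  obtains p where "degree p \<le> k" "f = homog k p"
proof
  define p where "p = (\<Sum>j\<le>k. monom (bicoeff f (k - j) j) j)"
  have c: "coeff p j = (if j \<le> k then bicoeff f (k - j) j else 0)" for j
    by (simp add: p_def coeff_sum)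
  show "degree p \<le> k"
    by (rule degree_le) (simp add: c)
  show "f = homog k p"
    by (rule bipoly_eqI) (use assms in \<open>auto simp: bicoeff_homog c forms_def\<close>)
qed

text \<open>The degree bounds matter because \<open>homog\<close> discards coefficients beyond its
  degree, which would still enter \<open>p * q\<close>.\<close>

lemma homog_mult:
  assumes "degree p \<le> k" "degree q \<le> l"
  shows "homog k p * homog l q = homog (k + l) (p * q)"
proof (rule bipoly_eqI)
  fix i j
  have *: "(\<Sum>a\<le>i. bicoeff (homog k p) a b * bicoeff (homog l q) (i - a) (j - b)) =
        (if i + j = k + l then coeff p b * coeff q (j - b) else 0)" if "b \<le> j" for b
  proof (cases "b \<le> k")
    case False
    then have b: "coeff p b = 0" using assms by (simp add: coeff_eq_0)
    then have "bicoeff (homog k p) a b = 0" for a by (simp add: bicoeff_homog)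
    then show ?thesis by (simp add: b)
  next
    case b: True
    have "(\<Sum>a\<le>i. bicoeff (homog k p) a b * bicoeff (homog l q) (i - a) (j - b)) =
      (\<Sum>a\<le>i. if a = k - b then coeff p b * bicoeff (homog l q) (i - (k - b)) (j - b) else 0)"
    proof (rule sum.cong)
      fix a assume "a \<in> {..i}"
      have "bicoeff (homog k p) a b = (if a = k - b then coeff p b else 0)"
        using b by (auto simp: bicoeff_homog)
      then show "bicoeff (homog k p) a b * bicoeff (homog l q) (i - a) (j - b) =
        (if a = k - b then coeff p b * bicoeff (homog l q) (i - (k - b)) (j - b) else 0)" by simp
    qed simp
    also have "\<dots> = (if k - b \<le> i then coeff p b * bicoeff (homog l q) (i - (k - b)) (j - b) else 0)"
      by simp
    also have "\<dots> = (if i + j = k + l then coeff p b * coeff q (j - b) else 0)"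
    proof (cases "k - b \<le> i")
      case True
      then have "i - (k - b) + (j - b) = l \<longleftrightarrow> i + j = k + l"
        using b that by auto
      then show ?thesis using True by (simp add: bicoeff_homog)
    next
      case False
      then have "i + j = k + l \<Longrightarrow> coeff q (j - b) = 0"
        using assms b that by (intro coeff_eq_0) auto
      then show ?thesis using False by simp
    qed
    finally show ?thesis .
  qed
  show "bicoeff (homog k p * homog l q) i j = bicoeff (homog (k + l) (p * q)) i j"
    unfolding bicoeff_mult bicoeff_homog[of "k + l"] coeff_mult by (simp add: *)
qed

lemma forms_mult: "f \<in> forms k \<Longrightarrow> g \<in> forms l \<Longrightarrow> f * g \<in> forms (k + l)"
  by (elim forms_homogE) (simp add: homog_mult)

lemma forms_0 [simp]: "0 \<in> forms k"
  by (simp add: forms_def)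

lemma forms_0_const:
  assumes "f \<in> forms 0"
  shows "\<exists>c. f = cscale c 1"
proof -
  from assms obtain p where "f = homog 0 p" by (rule forms_homogE)
  then have "f = cscale (coeff p 0) 1"
    by (intro bipoly_eqI) (auto simp: bicoeff_homog, auto simp: bicoeff_def coeff_pCons one_pCons split: nat.splits)
  then show ?thesis ..
qed

lemma forms_add: "f \<in> forms k \<Longrightarrow> g \<in> forms k \<Longrightarrow> f + g \<in> forms k"
  and forms_cscale: "f \<in> forms k \<Longrightarrow> cscale c f \<in> forms k"
  by (elim forms_homogE; simp flip: homog_add homog_smult)+

lemma subspace_forms: "CV.subspace (forms k)"
  by (intro CV.subspaceI) (simp_all add: forms_add forms_cscale)

lemma cscale_mult: "cscale c p * q = cscale c (p * q)"
  "p * cscale c q = cscale c (p * q)"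
  by (simp_all add: cscale_def)

lemma cscale_eq_mult: "cscale c p = [:[:c:]:] * p"
  by (simp add: cscale_def)

lemma bicoeff_hom_part: "bicoeff (hom_part k p) i j = (if i + j = k then bicoeff p i j else 0)"
proof -
  have "bicoeff (hom_part k p) i j = (\<Sum>a\<le>k. if a = i then (if j = k - a then bicoeff p a j else 0) else 0)"
    unfolding hom_part_def bicoeff_sum bicoeff_monom by (intro sum.cong) auto
  then show ?thesis by auto
qed

lemma hom_part_in_forms [simp]: "hom_part k p \<in> forms k"
  by (simp add: forms_def bicoeff_hom_part)

lemma hom_part_0 [simp]: "hom_part k 0 = 0"
  and hom_part_sum: "hom_part k (\<Sum>a\<in>A. f a) = (\<Sum>a\<in>A. hom_part k (f a))"
  by (rule bipoly_eqI; simp add: bicoeff_hom_part)+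

lemma hom_part_forms: "p \<in> forms l \<Longrightarrow> hom_part k p = (if k = l then p else 0)"
  by (rule bipoly_eqI) (auto simp: bicoeff_hom_part forms_def)

lemma finite_bicoeff_support: "\<exists>N. \<forall>i j. bicoeff p i j \<noteq> 0 \<longrightarrow> i + j \<le> N"
proof -
  define N where "N = Max ((\<lambda>j. degree (coeff p j)) ` {..degree p}) + degree p"
  have "i + j \<le> N" if "bicoeff p i j \<noteq> 0" for i j
  proof -
    have "j \<le> degree p" using that by (auto simp: bicoeff_def intro: le_degree)
    moreover from this have "i \<le> Max ((\<lambda>j. degree (coeff p j)) ` {..degree p})"
      using that by (intro order.trans[OF le_degree Max_ge]) (auto simp: bicoeff_def)
    ultimately show ?thesis by (simp add: N_def)
  qed
  then show ?thesis by blast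
qed

lemma sum_hom_parts: "\<exists>N. p = (\<Sum>k\<le>N. hom_part k p)"
proof -
  obtain N where N: "\<And>i j. bicoeff p i j \<noteq> 0 \<Longrightarrow> i + j \<le> N" using finite_bicoeff_support by blast
  have "p = (\<Sum>k\<le>N. hom_part k p)"
    by (rule bipoly_eqI) (use N in \<open>auto simp: bicoeff_hom_part\<close>)
  then show ?thesis ..
qed

lemma hom_part_mult_form:
  assumes "f \<in> forms r"
  shows "hom_part k (f * q) = (if r \<le> k then f * hom_part (k - r) q else 0)"
proof -
  obtain N where N: "q = (\<Sum>k\<le>N. hom_part k q)" using sum_hom_parts by blast
  have eq: "hom_part k (f * hom_part l q) = (if r \<le> k then f * hom_part (k - r) (hom_part l q) else 0)" for l
  proof -
    have "f * hom_part l q \<in> forms (r + l)" using assms by (simp add: forms_mult)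
    then show ?thesis by (auto simp add: hom_part_forms[of _ "r + l"] hom_part_forms[of "hom_part l q" l])
  qed
  have "hom_part k (f * (\<Sum>l\<le>N. hom_part l q)) =
      (if r \<le> k then f * hom_part (k - r) (\<Sum>l\<le>N. hom_part l q) else 0)"
    by (simp add: sum_distrib_left hom_part_sum eq)
  with N show ?thesis by metis
qed

lemma hom_part_mem_imp_mem:
  assumes "\<And>k. hom_part k p \<in> J" "0 \<in> J" "\<And>x y. x \<in> J \<Longrightarrow> y \<in> J \<Longrightarrow> x + y \<in> J"
  shows "p \<in> J"
proof -
  obtain N where N: "p = (\<Sum>k\<le>N. hom_part k p)" using sum_hom_parts by blast
  have "(\<Sum>k\<in>A. hom_part k p) \<in> J" if "finite A" for A
    using that by (induction A) (simp_all add: assms)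
  then show ?thesis using N by (metis finite_atMost)
qed


section \<open>Evaluation and linear factors\<close>

lemma eval_at_diff: "eval_at (p - q) a = eval_at p a - eval_at q a"
  and eval_at_mult: "eval_at (p * q) a = eval_at p a * eval_at q a"
  and eval_at_0 [simp]: "eval_at 0 a = 0"
  and eval_at_1 [simp]: "eval_at 1 a = 1"
  and eval_at_power: "eval_at (p ^ n) a = eval_at p a ^ n"
  and eval_at_cscale: "eval_at (cscale c p) a = c * eval_at p a"
  by (simp_all add: eval_at_def cscale_def poly_power)

lemma eval_at_sum: "eval_at (\<Sum>x\<in>A. f x) a = (\<Sum>x\<in>A. eval_at (f x) a)"
  by (simp add: eval_at_def poly_sum)

lemma eval_at_prod: "eval_at (\<Prod>x\<in>A. f x) a = (\<Prod>x\<in>A. eval_at (f x) a)"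
  by (simp add: eval_at_def poly_prod)

lemma eval_at_homog: "eval_at (homog k p) a = (\<Sum>j\<le>k. coeff p j * (a $ 1) ^ (k - j) * (a $ 2) ^ j)"
  by (simp add: eval_at_def homog_def poly_sum poly_monom poly_power)

lemma eval_at_form_scale:
  assumes "f \<in> forms k"
  shows "eval_at f (s *s a) = s ^ k * eval_at f a"
proof -
  from assms obtain p where p: "f = homog k p" by (rule forms_homogE)
  have "coeff p j * (s * a $ 1) ^ (k - j) * (s * a $ 2) ^ j =
        s ^ k * (coeff p j * (a $ 1) ^ (k - j) * (a $ 2) ^ j)" if "j \<le> k" for j
  proof -
    have "s ^ k = s ^ (k - j) * s ^ j" using that by (simp flip: power_add)
    then show ?thesis by (simp add: power_mult_distrib)
  qed
  then have "(\<Sum>j\<le>k. coeff p j * (s * a $ 1) ^ (k - j) * (s * a $ 2) ^ j) =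
      (\<Sum>j\<le>k. s ^ k * (coeff p j * (a $ 1) ^ (k - j) * (a $ 2) ^ j))"
    by (intro sum.cong) auto
  then show ?thesis by (simp add: p eval_at_homog sum_distrib_left)
qed

text \<open>Annihilates \<open>linear_form a\<close> under the apolar action.\<close>

definition perp :: "complex ^ 2 \<Rightarrow> bipoly" where
  "perp a = [:[:0, - (a $ 2):], [:a $ 1:]:]"

lemma eval_at_perp: "eval_at (perp a) b = a $ 1 * b $ 2 - a $ 2 * b $ 1"
  by (simp add: perp_def eval_at_def algebra_simps)

lemma perp_homog: "perp a = homog 1 [:- (a $ 2), a $ 1:]"
  by (rule bipoly_eqI) (auto simp: bicoeff_homog, auto simp: perp_def bicoeff_def coeff_pCons split: nat.splits)

lemma perp_in_forms [simp]: "perp a \<in> forms 1"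
  by (simp add: perp_homog)

lemma perp_eq_0_iff: "perp a = 0 \<longleftrightarrow> a = 0"
  by (auto simp: perp_def vec_eq_iff forall_2)

lemma perp_add_scale: "perp (a + t *s b) = perp a + cscale t (perp b)"
  by (simp add: perp_def cscale_def)

lemma form_vanishing_dvd:
  assumes f: "f \<in> forms k" and a: "a \<noteq> 0" and ev: "eval_at f a = 0" and "f \<noteq> 0"
  shows "\<exists>g\<in>forms (k - 1). k \<ge> 1 \<and> f = perp a * g"
proof -
  obtain p where p: "degree p \<le> k" "f = homog k p" using f by (rule forms_homogE)
  have p0: "p \<noteq> 0" using p \<open>f \<noteq> 0\<close> by auto
  have k: "k \<ge> 1"
  proof (rule ccontr)
    assume "\<not> k \<ge> 1"
    then have "k = 0" by simp
    with p obtain c where "p = [:c:]" by (auto elim: degree_eq_zeroE)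
    with ev p p0 \<open>k = 0\<close> show False by (simp add: eval_at_homog)
  qed
  obtain q where q: "degree q \<le> k - 1" "p = [:- (a $ 2), a $ 1:] * q"
  proof (cases "a $ 1 = 0")
    \<comment> \<open>Here \<open>perp a\<close> is a multiple of y_0 and dehomogenizes to a
      constant. Vanishing at \<open>a\<close> kills the top coefficient, so division by y_0 keeps
      \<open>p\<close> up to a scalar and only lowers the degree bound.\<close>
    case True
    with a have a2: "a $ 2 \<noteq> 0" by (auto simp: vec_eq_iff forall_2)
    have "(\<Sum>j\<le>k. coeff p j * (a $ 1) ^ (k - j) * (a $ 2) ^ j) = (\<Sum>j\<le>k. if j = k then coeff p j * (a $ 2) ^ j else 0)"
      using True by (intro sum.cong) auto
    with ev p a2 have "coeff p k = 0" by (simp add: eval_at_homog)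
    then have "degree p \<noteq> k" using p0 by auto
    with p have "degree p \<le> k - 1" by auto
    then show ?thesis using True a2 by (intro that[of "smult (- 1 / a $ 2) p"]) auto
  next
    case False
    have "eval_at f a = (a $ 1) ^ k * poly p (a $ 2 / a $ 1)"
    proof -
      have "coeff p j * (a $ 1) ^ (k - j) * (a $ 2) ^ j = (a $ 1) ^ k * (coeff p j * (a $ 2 / a $ 1) ^ j)" if "j \<le> k" for j
      proof -
        have "(a $ 1) ^ k = (a $ 1) ^ (k - j) * (a $ 1) ^ j" using that by (simp flip: power_add)
        then show ?thesis using False by (simp add: power_divide)
      qed
      then have "eval_at f a = (\<Sum>j\<le>k. (a $ 1) ^ k * (coeff p j * (a $ 2 / a $ 1) ^ j))"
        unfolding p eval_at_homog by (intro sum.cong) auto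
      moreover have "poly p x = (\<Sum>j\<le>k. coeff p j * x ^ j)" for x
        unfolding poly_altdef using p(1) by (intro sum.mono_neutral_left) (auto simp: coeff_eq_0)
      ultimately show ?thesis by (simp add: sum_distrib_left)
    qed
    with ev False have "poly p (a $ 2 / a $ 1) = 0" by simp
    then obtain q where q: "p = [:- (a $ 2 / a $ 1), 1:] * q"
      unfolding poly_eq_0_iff_dvd by (auto elim: dvdE)
    with p0 have "degree p = 1 + degree q" by (subst q, subst degree_mult_eq) auto
    with p show ?thesis using q False by (intro that[of "smult (1 / a $ 1) q"]) (auto simp: smult_diff_right)
  qed
  have "f = perp a * homog (k - 1) q"
    using homog_mult[of "[:- (a $ 2), a $ 1:]" 1 q "k - 1"] q k
    by (simp add: perp_homog p(2))
  then show ?thesis using k by auto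
qed

section \<open>Principal ideals and the Hilbert schemes\<close>

lemma module_mult: "module ((*) :: bipoly \<Rightarrow> bipoly \<Rightarrow> bipoly)"
  by unfold_locales (simp_all add: algebra_simps)

lemma hom_ideal_iff:
  "hom_ideal I \<longleftrightarrow> 0 \<in> I \<and> (\<forall>x\<in>I. \<forall>y\<in>I. x + y \<in> I) \<and> (\<forall>q. \<forall>x\<in>I. q * x \<in> I) \<and>
     (\<forall>p\<in>I. \<forall>k. hom_part k p \<in> I)"
  by (simp add: hom_ideal_def module.subspace_def[OF module_mult])

lemma hom_idealD:
  assumes "hom_ideal I"
  shows "0 \<in> I" "x \<in> I \<Longrightarrow> y \<in> I \<Longrightarrow> x + y \<in> I" "x \<in> I \<Longrightarrow> q * x \<in> I"
    "x \<in> I \<Longrightarrow> x * q \<in> I" "x \<in> I \<Longrightarrow> y \<in> I \<Longrightarrow> x - y \<in> I" "p \<in> I \<Longrightarrow> hom_part k p \<in> I"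
    "x \<in> I \<Longrightarrow> cscale c x \<in> I"
proof -
  show 0: "0 \<in> I" "x \<in> I \<Longrightarrow> y \<in> I \<Longrightarrow> x + y \<in> I" and *: "x \<in> I \<Longrightarrow> q * x \<in> I" for x y q
    using assms by (auto simp: hom_ideal_iff)
  show "x \<in> I \<Longrightarrow> x * q \<in> I" using *[of x q] by (simp add: mult.commute)
  show "x \<in> I \<Longrightarrow> cscale c x \<in> I" using *[of x "[:[:c:]:]"] unfolding cscale_eq_mult .
  show "x \<in> I \<Longrightarrow> y \<in> I \<Longrightarrow> x - y \<in> I"
    using 0(2)[of x "- y"] *[of y "- 1"] by simp
  show "p \<in> I \<Longrightarrow> hom_part k p \<in> I" using assms by (auto simp: hom_ideal_iff)
qed

lemma hom_ideal_eqI: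
  assumes "hom_ideal I" "hom_ideal J" "\<And>k. I \<inter> forms k = J \<inter> forms k"
  shows "I = J"
proof -
  have "I \<subseteq> J" if "hom_ideal I" "hom_ideal J" "\<And>k. I \<inter> forms k \<subseteq> J \<inter> forms k" for I J
  proof
    fix p assume "p \<in> I"
    then have "hom_part k p \<in> J" for k
      using that hom_idealD(6)[OF that(1)] hom_part_in_forms by blast
    then show "p \<in> J" using hom_idealD(1,2)[OF that(2)] by (intro hom_part_mem_imp_mem[of p J])
  qed
  from this[of I J] this[of J I] show ?thesis using assms by blast
qed

definition pideal :: "bipoly \<Rightarrow> bipoly set" where
  "pideal f = range ((*) f)"

lemma pideal_self: "f \<in> pideal f"
  unfolding pideal_def by (rule range_eqI[of _ _ 1]) simp

lemma pideal_cscale: "c \<noteq> 0 \<Longrightarrow> pideal (cscale c f) = pideal f"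
proof -
  have "pideal (cscale c f) \<subseteq> pideal f" for c f
    unfolding pideal_def by (auto simp: cscale_mult) (metis cscale_mult(2) rangeI)
  from this[of c f] this[of "1 / c" "cscale c f"] show "c \<noteq> 0 \<Longrightarrow> ?thesis" by simp
qed

lemma hom_ideal_pideal:
  assumes "f \<in> forms r"
  shows "hom_ideal (pideal f)"
  unfolding hom_ideal_iff
proof (intro conjI ballI allI)
  show "0 \<in> pideal f" unfolding pideal_def by (rule range_eqI[of _ _ 0]) simp
  fix x y q assume x: "x \<in> pideal f"
  then obtain u where u: "x = f * u" by (auto simp: pideal_def)
  show "q * x \<in> pideal f" unfolding pideal_def u by (rule range_eqI[of _ _ "q * u"]) simp
  show "hom_part k x \<in> pideal f" for k
    unfolding u hom_part_mult_form[OF assms] using \<open>0 \<in> pideal f\<close> by (auto simp: pideal_def)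
  assume "y \<in> pideal f"
  then obtain v where v: "y = f * v" by (auto simp: pideal_def)
  show "x + y \<in> pideal f"
    unfolding pideal_def u v by (rule range_eqI[of _ _ "u + v"]) (simp add: algebra_simps)
qed

lemma pideal_subset_iff:
  assumes "hom_ideal I"
  shows "pideal f \<subseteq> I \<longleftrightarrow> f \<in> I"
  using assms pideal_self[of f] by (auto simp: pideal_def hom_idealD(4))

lemma pideal_inter_forms:
  assumes "f \<in> forms r"
  shows "pideal f \<inter> forms k = (if r \<le> k then (*) f ` forms (k - r) else {0})"
proof (intro equalityI subsetI)
  fix x assume "x \<in> pideal f \<inter> forms k"
  then obtain q where q: "x = f * q" and x: "x \<in> forms k" by (auto simp: pideal_def)
  have "x = hom_part k x" using x by (simp add: hom_part_forms)
  also have "\<dots> = (if r \<le> k then f * hom_part (k - r) q else 0)" unfolding q by (rule hom_part_mult_form[OF assms])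
  finally show "x \<in> (if r \<le> k then (*) f ` forms (k - r) else {0})" by auto
next
  fix x assume "x \<in> (if r \<le> k then (*) f ` forms (k - r) else {0})"
  then show "x \<in> pideal f \<inter> forms k"
    using forms_mult[OF assms, of _ "k - r"] hom_idealD(1)[OF hom_ideal_pideal[OF assms]]
    by (auto simp: pideal_def split: if_splits)
qed

section \<open>Monomial bases and dimensions of graded pieces\<close>

lemma sum_frame:
  "(\<Sum>m\<in>A. cscale (c m) (f * homog n (monom 1 m))) = f * homog n (\<Sum>m\<in>A. monom (c m) m)"
  by (simp add: homog_sum sum_distrib_left smult_monom flip: cscale_mult(2) homog_smult)

lemma poly_as_sum_le: "degree p \<le> n \<Longrightarrow> (\<Sum>m\<le>n. monom (coeff p m) m) = p"
  by (rule poly_eqI) (auto simp: coeff_sum coeff_eq_0)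

lemma frame_inj:
  assumes "f \<noteq> 0"
  shows "inj_on (\<lambda>m. f * homog n (monom 1 m)) {..n}"
proof (rule inj_onI)
  fix i j assume "i \<in> {..n}" "j \<in> {..n}" "f * homog n (monom 1 i) = f * homog n (monom 1 j)"
  with assms have "homog n (monom 1 i) = homog n (monom 1 j)" by simp
  with \<open>i \<in> _\<close> \<open>j \<in> _\<close> have "monom 1 i = (monom 1 j :: complex poly)"
    by (subst (asm) homog_inject) (auto intro: order.trans[OF degree_monom_le])
  then show "i = j" by (metis degree_monom_eq one_neq_zero)
qed

text \<open>Taking \<open>f = 1\<close> turns this into the monomial basis of
  \<open>forms n\<close>, so one computation serves both the ideals and the ambient space.\<close>

lemma frame_span:
  "CV.span ((\<lambda>m. f * homog n (monom 1 m)) ` {..n}) = (*) f ` forms n" (is "CV.span (?g ` _) = _")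
proof
  have "CV.subspace ((*) f ` forms n)"
  proof (rule CV.subspaceI)
    show "0 \<in> (*) f ` forms n" by (rule image_eqI[of _ _ 0]) auto
    show "x + y \<in> (*) f ` forms n" if "x \<in> (*) f ` forms n" "y \<in> (*) f ` forms n" for x y
      using that forms_add by (auto simp flip: distrib_left)
    show "cscale c x \<in> (*) f ` forms n" if "x \<in> (*) f ` forms n" for x c
      using that forms_cscale by (auto simp: cscale_mult(2)[symmetric])
  qed
  then show "CV.span (?g ` {..n}) \<subseteq> (*) f ` forms n"
    by (intro CV.span_minimal) auto
  show "(*) f ` forms n \<subseteq> CV.span (?g ` {..n})"
  proof safe
    fix q assume "q \<in> forms n"
    then obtain p where p: "degree p \<le> n" "q = homog n p" by (rule forms_homogE)
    have "f * q = (\<Sum>m\<le>n. cscale (coeff p m) (?g m))"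
      by (simp add: sum_frame p poly_as_sum_le)
    also have "\<dots> \<in> CV.span (?g ` {..n})"
      by (intro CV.span_sum CV.span_scale CV.span_base) auto
    finally show "f * q \<in> CV.span (?g ` {..n})" .
  qed
qed

lemma frame_independent:
  assumes "f \<noteq> 0"
  shows "CV.independent ((\<lambda>m. f * homog n (monom 1 m)) ` {..n})" (is "CV.independent (?g ` _)")
proof -
  have False if v: "v \<in> ?g ` {..n}" "u v \<noteq> 0" and sum: "(\<Sum>v\<in>?g ` {..n}. cscale (u v) v) = 0" for u v
  proof -
    from v obtain m where m: "m \<le> n" "u (?g m) \<noteq> 0" by auto
    have "0 = (\<Sum>m\<le>n. cscale (u (?g m)) (?g m))"
      using sum by (simp add: sum.reindex[OF frame_inj[OF assms]])
    also have "\<dots> = f * homog n (\<Sum>m\<le>n. monom (u (?g m)) m)" by (rule sum_frame)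
    finally have "homog n (\<Sum>m\<le>n. monom (u (?g m)) m) = 0" using assms by simp
    then have "(\<Sum>m\<le>n. monom (u (?g m)) m) = 0"
      by (subst (asm) homog_eq_0_iff) (auto intro!: degree_sum_le order.trans[OF degree_monom_le])
    then have "coeff (\<Sum>m\<le>n. monom (u (?g m)) m) m = 0" by simp
    with m show False by (simp add: coeff_sum)
  qed
  then show ?thesis
    by (auto simp: CV.dependent_finite)
qed

lemma dim_frame: "f \<noteq> 0 \<Longrightarrow> CV.dim ((*) f ` forms n) = n + 1"
  using CV.dim_span_eq_card_independent[OF frame_independent[of f n]]
  by (simp add: frame_span card_image frame_inj)

lemma dim_forms: "CV.dim (forms k) = k + 1"
  using dim_frame[of 1 k] by simp

lemma dim_zero: "CV.dim {0} = 0"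
  using CV.dim_span[of "{}"] CV.dim_eq_card_independent[OF CV.independent_empty] by simp

lemma dim_pideal:
  assumes "f \<in> forms r" "f \<noteq> 0"
  shows "CV.dim (pideal f \<inter> forms k) = k + 1 - r"
  using assms by (auto simp: pideal_inter_forms dim_frame dim_zero Suc_diff_le)

text \<open>The ambient space is infinite dimensional; containment in \<open>forms k\<close> makes a
  basis of \<open>Y\<close> finite, so that a basis of \<open>X\<close> of the same cardinality
  cannot be properly extended.\<close>

lemma subspace_eq_of_dim_eq:
  assumes "CV.subspace X" "X \<subseteq> Y" "Y \<subseteq> forms k" "CV.dim X = CV.dim Y"
  shows "X = Y"
proof -
  obtain B where B: "B \<subseteq> X" "CV.independent B" "X \<subseteq> CV.span B" "card B = CV.dim X"
    by (rule CV.basis_exists)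
  have "B \<subseteq> Y" using B assms by auto
  then obtain C where C: "B \<subseteq> C" "C \<subseteq> Y" "CV.independent C" "Y \<subseteq> CV.span C"
    using CV.maximal_independent_subset_extend B(2) by metis
  have "card C = CV.dim Y"
    using CV.dim_unique[OF C(2,4,3)] by simp
  moreover have "finite C"
  proof (rule CV.independent_span_bound[THEN conjunct1])
    show "finite ((\<lambda>m. 1 * homog k (monom 1 m)) ` {..k})" by simp
    show "C \<subseteq> CV.span ((\<lambda>m. 1 * homog k (monom 1 m)) ` {..k})"
      unfolding frame_span using C assms by auto
  qed (fact C)
  ultimately have "B = C" using C(1) B(4) assms(4) card_subset_eq by metis
  then have "Y \<subseteq> CV.span B" using C by simp
  also have "\<dots> \<subseteq> X" using B assms(1) CV.span_minimal by metis
  finally show ?thesis using assms by auto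
qed

lemma mem_pideal_iff:
  assumes "f \<in> forms r" "g \<in> forms r"
  shows "f \<in> pideal g \<longleftrightarrow> (\<exists>c. f = cscale c g)"
proof
  assume "f \<in> pideal g"
  then have "f \<in> pideal g \<inter> forms r" using assms by auto
  then obtain q where q: "q \<in> forms 0" "f = g * q"
    using assms by (auto simp: pideal_inter_forms)
  then obtain c where "q = cscale c 1" using forms_0_const by blast
  then have "f = cscale c g" using q by (simp add: cscale_mult)
  then show "\<exists>c. f = cscale c g" ..
next
  assume "\<exists>c. f = cscale c g"
  then show "f \<in> pideal g"
    using hom_idealD(7)[OF hom_ideal_pideal[OF assms(2)] pideal_self] by auto
qed

lemma pideal_eq_iff:
  assumes "f \<in> forms r" "g \<in> forms r" "g \<noteq> 0" "f \<noteq> 0"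
  shows "pideal f = pideal g \<longleftrightarrow> (\<exists>c. f = cscale c g)"
proof
  assume "pideal f = pideal g"
  then show "\<exists>c. f = cscale c g" using mem_pideal_iff[OF assms(1,2)] pideal_self by auto
next
  assume "\<exists>c. f = cscale c g"
  then obtain c where c: "f = cscale c g" by blast
  with assms have "c \<noteq> 0" by auto
  then show "pideal f = pideal g" by (simp add: c pideal_cscale)
qed

lemma hilbert_fun_pideal:
  assumes "f \<in> forms r" "f \<noteq> 0"
  shows "hilbert_fun (pideal f) = h_generic r"
  by (rule ext) (auto simp: hilbert_fun_def h_generic_def dim_pideal[OF assms] dim_forms)

text \<open>A canonical representative of the ideal of \<open>f\<close>, linear in the coefficients
  of \<open>f\<close>: polynomial families of forms lift to polynomial families of frames. In
  degrees below \<open>r\<close> truncated subtraction makes the frame empty.\<close>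

definition pframe :: "nat set \<Rightarrow> nat \<Rightarrow> bipoly \<Rightarrow> nat \<Rightarrow> nat \<Rightarrow> bipoly" where
  "pframe D r f = (\<lambda>k m. if k \<in> D \<and> m < k + 1 - r then f * homog (k - r) (monom 1 m) else 0)"

lemma pframe_in_graded_frames:
  assumes "f \<in> forms r" "f \<noteq> 0"
  shows "pframe D r f \<in> graded_frames D (pideal f)"
proof -
  have "CV.span (pframe D r f k ` {..<k + 1 - r}) = pideal f \<inter> forms k" if "k \<in> D" for k
  proof (cases "r \<le> k")
    case True
    have "{..<k + 1 - r} = {..k - r}" using True by auto
    then have "pframe D r f k ` {..<k + 1 - r} = (\<lambda>m. f * homog (k - r) (monom 1 m)) ` {..k - r}"
      using that True by (intro image_cong) (auto simp: pframe_def)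
    then show ?thesis using True by (simp add: frame_span pideal_inter_forms[OF assms(1)])
  qed (simp add: pideal_inter_forms[OF assms(1)])
  then show ?thesis by (auto simp: graded_frames_def dim_pideal[OF assms]) (auto simp: pframe_def)
qed

section \<open>Saturation of principal ideals\<close>

lemma homog_mult_y0: "degree p \<le> k \<Longrightarrow> homog n 1 * homog k p = homog (k + n) p"
  by (subst homog_mult) (auto simp: add.commute)

lemma homog_mult_y1: "degree p \<le> k \<Longrightarrow> homog n (monom 1 n) * homog k p = homog (k + n) (monom 1 n * p)"
  by (subst homog_mult) (auto simp: add.commute intro: degree_monom_le)

text \<open>Multiplying by y_0^n leaves the dehomogenized polynomial \<open>P\<close> unchanged and
  shows that \<open>g\<close> divides it, which settles everything away from (0,1). Multiplying by
  y_1^n raises the degree, and the bound on that quotient controls the multiplicity at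
  (0,1).\<close>

lemma saturated_pideal:
  assumes "f \<in> forms r" "f \<noteq> 0"
  shows "saturated (pideal f)"
  unfolding saturated_def
proof
  show "pideal f \<subseteq> saturation (pideal f)"
    using hom_idealD(3)[OF hom_ideal_pideal[OF assms(1)]] by (auto simp: saturation_def)
  show "saturation (pideal f) \<subseteq> pideal f"
  proof
    fix p assume "p \<in> saturation (pideal f)"
    then obtain n where n: "\<And>q. q \<in> forms n \<Longrightarrow> q * p \<in> pideal f" by (auto simp: saturation_def)
    note I = hom_idealD[OF hom_ideal_pideal[OF assms(1)]]
    show "p \<in> pideal f"
    proof (rule hom_part_mem_imp_mem)
      fix k
      have mem: "q * hom_part k p \<in> pideal f \<inter> forms (k + n)" if q: "q \<in> forms n" for q
      proof -
        have "hom_part (k + n) (q * p) \<in> pideal f" by (intro I n q)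
        then show ?thesis using hom_part_mult_form[OF q, of "k + n" p] forms_mult[OF q hom_part_in_forms[of k p]]
          by (simp add: add.commute)
      qed
      obtain P where P: "degree P \<le> k" "hom_part k p = homog k P" using hom_part_in_forms by (rule forms_homogE)
      obtain g where g: "degree g \<le> r" "f = homog r g" using assms(1) by (rule forms_homogE)
      have g0: "g \<noteq> 0" using assms g by auto
      show "hom_part k p \<in> pideal f"
      proof (cases "P = 0")
        case True
        then show ?thesis using P I(1) by simp
      next
        case False
        have e1: "homog (k + n) P \<in> pideal f \<inter> forms (k + n)"
          using mem[of "homog n 1"] P by (simp add: homog_mult_y0)
        have "homog (k + n) P \<noteq> 0" using P False by (subst homog_eq_0_iff) auto
        with e1 have r: "r \<le> k + n" by (auto simp: pideal_inter_forms[OF assms(1)] split: if_splits)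
        have ex: "\<exists>V. degree V \<le> k + n - r \<and> Q = g * V"
          if "homog (k + n) Q \<in> pideal f \<inter> forms (k + n)" "degree Q \<le> k + n" for Q
        proof -
          from that(1) r obtain v where v: "v \<in> forms (k + n - r)" "homog (k + n) Q = f * v"
            by (auto simp: pideal_inter_forms[OF assms(1)])
          from v(1) obtain V where V: "degree V \<le> k + n - r" "v = homog (k + n - r) V" by (rule forms_homogE)
          have "homog (k + n) Q = homog (k + n) (g * V)"
            using v V g r homog_mult[of g r V "k + n - r"] by simp
          moreover have "degree (g * V) \<le> k + n" using degree_mult_le[of g V] g V r by linarith
          ultimately show ?thesis using that V by (auto simp: homog_inject)
        qed
        have "degree P \<le> k + n" using P by simp
        from ex[OF e1 this] obtain U where U: "P = g * U" by blast
        have "homog (k + n) (monom 1 n * P) \<in> pideal f \<inter> forms (k + n)"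
          using mem[of "homog n (monom 1 n)"] P by (simp add: homog_mult_y1)
        moreover have dm: "degree (monom 1 n * P) = n + degree P"
          using False by (simp add: degree_mult_eq degree_monom_eq)
        ultimately obtain V where V: "degree V \<le> k + n - r" "monom 1 n * P = g * V"
          using ex P by force
        then have "n + degree P = degree g + degree V"
          using dm g0 False by (metis degree_mult_eq mult_eq_0_iff monom_eq_0_iff one_neq_zero)
        moreover have "degree P = degree g + degree U"
          using U False by (metis degree_mult_eq mult_eq_0_iff)
        ultimately have "n + degree U \<le> k + n - r" using V by linarith
        \<comment> \<open>The subtraction is truncated: a positive \<open>n\<close> forces
          \<open>r \<le> k\<close>, while for \<open>n = 0\<close> this is the earlier bound by
          \<open>k + n\<close>.\<close>
        then have dU: "degree U \<le> k - r" "r \<le> k \<or> n = 0" by linarith+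
        with r have rk: "r \<le> k" by auto
        have "hom_part k p = f * homog (k - r) U"
          using homog_mult[of g r U "k - r"] g dU rk by (simp add: P U)
        then show ?thesis by (auto simp: pideal_def)
      qed
    qed (fact I)+
  qed
qed

lemma pideal_in_Hilb:
  assumes "f \<in> forms r" "f \<noteq> 0"
  shows "pideal f \<in> points (Hilb r)"
proof -
  have "\<forall>\<^sub>F k in sequentially. hilbert_fun (pideal f) k = r"
    unfolding hilbert_fun_pideal[OF assms]
    by (rule eventually_sequentiallyI[of r]) (simp add: h_generic_def dim_forms)
  then show ?thesis
    using assms by (simp add: Hilb_def hom_ideal_pideal saturated_pideal)
qed

lemma pideal_in_MHilb: "f \<in> forms r \<Longrightarrow> f \<noteq> 0 \<Longrightarrow> pideal f \<in> points (MHilb (h_generic r))"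
  by (simp add: MHilb_def hom_ideal_pideal hilbert_fun_pideal)

section \<open>Classification of the points of the Hilbert schemes\<close>

lemma dim_forms_inter_le: "CV.dim (I \<inter> forms k) \<le> k + 1"
proof -
  have "CV.dim (I \<inter> forms k) \<le> card ((\<lambda>m. 1 * homog k (monom 1 m)) ` {..k})"
    by (intro CV.dim_le_card, unfold frame_span) auto
  also have "\<dots> \<le> k + 1" using card_image_le[of "{..k}"] by simp
  finally show ?thesis .
qed

lemma dim_pos_imp_nonzero: "CV.dim X > 0 \<Longrightarrow> \<exists>x\<in>X. x \<noteq> 0"
proof (rule ccontr)
  assume "CV.dim X > 0" "\<not> (\<exists>x\<in>X. x \<noteq> 0)"
  then have "X \<subseteq> {0}" by auto
  then have "X \<subseteq> CV.span {}" by simp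
  then have "CV.dim X \<le> card ({} :: bipoly set)" by (rule CV.dim_le_card) auto
  with \<open>CV.dim X > 0\<close> show False by simp
qed

text \<open>The Hilbert function leaves a nonzero \<open>f\<close> in degree \<open>r\<close>, and
  the ideal of \<open>f\<close> already has the full dimension \<open>k + 1 - r\<close> in every
  degree \<open>k\<close>.\<close>

lemma MHilb_eq_pideal:
  assumes "J \<in> points (MHilb (h_generic r))"
  shows "\<exists>f\<in>forms r. f \<noteq> 0 \<and> J = pideal f"
proof -
  from assms have J: "hom_ideal J" and h: "\<And>k. hilbert_fun J k = h_generic r k" by (auto simp: MHilb_def)
  have dim: "CV.dim (J \<inter> forms k) = k + 1 - r" for k
    using h[of k] dim_forms_inter_le[of J k] by (auto simp: hilbert_fun_def h_generic_def dim_forms min_def split: if_splits)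
  then obtain f where f: "f \<in> J" "f \<in> forms r" "f \<noteq> 0" using dim_pos_imp_nonzero[of "J \<inter> forms r"] by auto
  have "pideal f = J"
  proof (rule hom_ideal_eqI)
    fix k show "pideal f \<inter> forms k = J \<inter> forms k"
    proof (rule subspace_eq_of_dim_eq[where k = k])
      show "CV.subspace (pideal f \<inter> forms k)"
        using hom_idealD[OF hom_ideal_pideal[OF f(2)]]
        by (intro CV.subspaceI) (auto simp: forms_add forms_cscale)
      show "pideal f \<inter> forms k \<subseteq> J \<inter> forms k" using pideal_subset_iff[OF J] f by auto
    qed (simp_all add: dim dim_pideal[OF f(2,3)])
  qed (use J f hom_ideal_pideal in auto)
  with f show ?thesis by auto
qed

text \<open>The generator is a greatest common divisor, assembled from its affine part
  \<open>g\<close> and its multiplicity \<open>a\<close> at (0,1). Saturatedness brings it into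
  \<open>I\<close>, and the Hilbert polynomial then identifies its degree with
  \<open>r\<close>.\<close>

lemma Hilb_eq_pideal:
  assumes "I \<in> points (Hilb r)"
  shows "\<exists>f\<in>forms r. f \<noteq> 0 \<and> I = pideal f"
proof -
  from assms have hI: "hom_ideal I" and sat: "saturation I = I"
    and "\<forall>\<^sub>F k in sequentially. hilbert_fun I k = r" by (auto simp: Hilb_def saturated_def)
  then obtain k0 where k0: "\<And>k. k \<ge> k0 \<Longrightarrow> hilbert_fun I k = r" by (auto simp: eventually_sequentially)
  note I = hom_idealD[OF hI]
  define V where "V = (\<lambda>k. {P. degree P \<le> k \<and> homog k P \<in> I})"
  have V_mult: "P * Q \<in> V (k + n)" if "P \<in> V k" "degree Q \<le> n" for P Q k n
    using that I(4)[of "homog k P" "homog n Q"] degree_mult_le[of P Q]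
    by (auto simp: V_def homog_mult)
  have V_mono: "P \<in> V l" if "P \<in> V k" "k \<le> l" for P k l
    using V_mult[OF that(1), of 1 "l - k"] that(2) by simp
  have V_diff: "P - Q \<in> V k" if "P \<in> V k" "Q \<in> V k" for P Q k
    using that I(5) by (auto simp: V_def homog_diff intro: degree_diff_le)
  have V_smult: "smult c P \<in> V k" if "P \<in> V k" for P k c
    using that I(7) by (auto simp: V_def homog_smult intro: order.trans[OF degree_smult_le])
  have V_0: "0 \<in> V k" for k using I(1) by (simp add: V_def)
  have V_add: "P + Q \<in> V k" if "P \<in> V k" "Q \<in> V k" for P Q k
    using that I(2) by (auto simp: V_def homog_add intro: degree_add_le)
  have mem_I: "\<exists>P\<in>V k. hom_part k p = homog k P" if "p \<in> I" for p k
  proof -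
    obtain P where "degree P \<le> k" "hom_part k p = homog k P" using hom_part_in_forms by (rule forms_homogE)
    then show ?thesis using I(6)[OF that, of k] by (auto simp: V_def)
  qed
  have "\<exists>k. \<exists>P\<in>V k. P \<noteq> 0"
  proof -
    let ?k = "max k0 r"
    have "hilbert_fun I ?k = r" by (rule k0) simp
    then have "CV.dim (I \<inter> forms ?k) > 0" by (auto simp: hilbert_fun_def dim_forms)
    then obtain x where x: "x \<in> I" "x \<in> forms ?k" "x \<noteq> 0" using dim_pos_imp_nonzero by blast
    obtain P where P: "P \<in> V ?k" "hom_part ?k x = homog ?k P" using mem_I x by blast
    then have "P \<noteq> 0" using x by (auto simp: hom_part_forms)
    with P show ?thesis by auto
  qed
  then have ex: "\<exists>e k P. P \<in> V k \<and> P \<noteq> 0 \<and> degree P = e" by blast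
  \<comment> \<open>The minimum runs over all graded pieces at once: raising \<open>k\<close> is
    multiplication by a power of y_0 and does not change the polynomial, so remainders modulo
    \<open>g\<close> stay in some piece.\<close>
  define e where "e = (LEAST e. \<exists>k P. P \<in> V k \<and> P \<noteq> 0 \<and> degree P = e)"
  have "\<exists>k P. P \<in> V k \<and> P \<noteq> 0 \<and> degree P = e" unfolding e_def using ex by (rule LeastI_ex)
  then obtain k1 g where g: "g \<in> V k1" "g \<noteq> 0" "degree g = e" by blast
  have e_le: "e \<le> degree P" if "P \<in> V k" "P \<noteq> 0" for P k
    unfolding e_def using that by (intro Least_le) auto
  \<comment> \<open>The least order of vanishing at (0,1) among the nonzero members of all
    pieces.\<close>
  define a where "a = (LEAST a. \<exists>k P. P \<in> V k \<and> P \<noteq> 0 \<and> k - degree P = a)"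
  have "\<exists>k P. P \<in> V k \<and> P \<noteq> 0 \<and> k - degree P = a" unfolding a_def by (rule LeastI_ex) (use g in blast)
  then obtain k2 w where w: "w \<in> V k2" "w \<noteq> 0" "k2 - degree w = a" by blast
  have a_le: "a \<le> k - degree P" if "P \<in> V k" "P \<noteq> 0" for P k
    unfolding a_def using that by (intro Least_le) auto
  have dw: "degree w + a = k2" using w by (auto simp: V_def)
  have dvd: "g dvd P" if P: "P \<in> V k" for P k
  proof -
    let ?K = "k1 + degree (P div g) + k"
    have "P - g * (P div g) \<in> V ?K"
      by (intro V_diff V_mono[OF P] V_mono[OF V_mult[OF g(1) order.refl]]) simp_all
    then have "P mod g \<in> V ?K" by (simp add: minus_mult_div_eq_mod)
    then have "P mod g = 0" using e_le[of "P mod g" ?K] degree_mod_less[of g P] g by fastforce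
    then show ?thesis by auto
  qed
  \<comment> \<open>From \<open>k1 + k2\<close> on, everything permitted by \<open>g\<close> and
    \<open>a\<close> is present: for each degree from \<open>e\<close> to \<open>k - a\<close> there
    is a member \<open>u\<close> of exactly this degree, and leading terms are cancelled one after
    the other.\<close>
  have cover: "h \<in> V k" if k: "k \<ge> k1 + k2" and "g dvd h" "h \<noteq> 0 \<Longrightarrow> degree h + a \<le> k" for h k
    using that(2,3)
  proof (induction "degree h" arbitrary: h rule: less_induct)
    case less
    show ?case
    proof (cases "h = 0")
      case False
      let ?m = "degree h"
      have me: "e \<le> ?m" using less.prems(1) False g dvd_imp_degree_le[of g h] by simp
      have mk: "?m + a \<le> k" using less.prems False by auto
      obtain u where u: "u \<in> V k" "degree u = ?m" "u \<noteq> 0"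
      \<comment> \<open>Multiples of \<open>g\<close> reach degree \<open>e + (k - k1)\<close>; the
        higher degrees up to \<open>k - a\<close> are reached from \<open>w\<close>, whose drop is
        exactly \<open>a\<close>.\<close>
      proof (cases "?m + k1 \<le> k + e")
        case True
        have "g * monom 1 (?m - e) \<in> V (k1 + (k - k1))"
          by (rule V_mult[OF g(1)]) (use True me in \<open>simp add: degree_monom_eq\<close>)
        then show ?thesis using k g me
          by (intro that[of "g * monom 1 (?m - e)"]) (auto simp: degree_mult_eq degree_monom_eq)
      next
        case False
        have "w * monom 1 (?m - degree w) \<in> V (k2 + (k - k2))"
          by (rule V_mult[OF w(1)]) (use dw mk k in \<open>simp add: degree_monom_eq\<close>)
        then show ?thesis using k w(2) False dw
          by (intro that[of "w * monom 1 (?m - degree w)"]) (auto simp: degree_mult_eq degree_monom_eq)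
      qed
      define c where "c = lead_coeff h / lead_coeff u"
      define h' where "h' = h - smult c u"
      have "g dvd h'" unfolding h'_def using less.prems(1) dvd[OF u(1)]
        by (intro dvd_diff dvd_smult)
      have dh: "degree h' < ?m" if "h' \<noteq> 0"
      proof -
 have "coeff u ?m \<noteq> 0" using u by (metis leading_coeff_0_iff)
        then have "coeff h' ?m = 0" using u by (auto simp: h'_def c_def)
        moreover have "degree h' \<le> ?m" unfolding h'_def
          using u by (intro degree_diff_le) (auto intro: order.trans[OF degree_smult_le])
        ultimately show ?thesis using that by (metis leading_coeff_0_iff le_neq_implies_less)
      qed
      have "h' \<in> V k"
      proof (cases "h' = 0")
        case False
        then show ?thesis using dh mk \<open>g dvd h'\<close> by (intro less.hyps) auto
      qed (simp add: V_0)
      then have "h' + smult c u \<in> V k" by (intro V_add V_smult u)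
      then show ?thesis by (simp add: h'_def)
    qed (simp add: V_0)
  qed
  define f where "f = homog (e + a) g"
  have f: "f \<in> forms (e + a)" "f \<noteq> 0" using g by (auto simp: f_def homog_eq_0_iff)
  have "f \<in> saturation I"
    unfolding saturation_def
  proof (intro CollectI exI ballI)
    fix q assume "q \<in> forms (k1 + k2)"
    then obtain Q where Q: "degree Q \<le> k1 + k2" "q = homog (k1 + k2) Q" by (rule forms_homogE)
    have "Q * g \<in> V (k1 + k2 + (e + a))"
      by (rule cover) (use degree_mult_le[of Q g] Q g in auto)
    then show "q * f \<in> I" using Q g homog_mult[of Q "k1 + k2" g "e + a"] by (simp add: V_def f_def)
  qed
  then have fI: "f \<in> I" using sat by simp
  have "I \<subseteq> pideal f"
  proof
    fix p assume "p \<in> I"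
    note J = hom_idealD[OF hom_ideal_pideal[OF f(1)]]
    show "p \<in> pideal f"
    proof (rule hom_part_mem_imp_mem)
      fix k
      obtain P where P: "P \<in> V k" "hom_part k p = homog k P" using mem_I[OF \<open>p \<in> I\<close>] by blast
      show "hom_part k p \<in> pideal f"
      proof (cases "P = 0")
        case True
        then show ?thesis using P J by simp
      next
        case False
        obtain Q where Q: "P = g * Q" using dvd[OF P(1)] by (auto elim: dvdE)
        with False have "degree P = e + degree Q" using g by (auto simp: degree_mult_eq)
        moreover have "a \<le> k - degree P" "degree P \<le> k" using a_le P False by (auto simp: V_def)
        ultimately have *: "degree Q \<le> k - (e + a)" "e + a \<le> k" by auto
        have "hom_part k p = f * homog (k - (e + a)) Q"
          using homog_mult[of g "e + a" Q "k - (e + a)"] * g by (simp add: P Q f_def)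
        then show ?thesis by (auto simp: pideal_def)
      qed
    qed (fact J)+
  qed
  then have eq: "I = pideal f" using pideal_subset_iff[OF hI] fI by blast
  \<comment> \<open>From \<open>k0\<close> on the Hilbert function is \<open>r\<close>, and from
    \<open>e + a\<close> on that of the ideal of \<open>f\<close> has stabilized at
    \<open>e + a\<close>.\<close>
  let ?k = "max k0 (r + e + a)"
  have "hilbert_fun I ?k = r" by (rule k0) simp
  then have "e + a = r"
    unfolding eq hilbert_fun_pideal[OF f] by (auto simp: h_generic_def dim_forms min_def split: if_splits)
  with f eq show ?thesis by auto
qed

lemma points_Hilb: "points (Hilb r) = {pideal f | f. f \<in> forms r \<and> f \<noteq> 0}"
proof (intro equalityI subsetI)
  fix I assume "I \<in> points (Hilb r)"
  then show "I \<in> {pideal f | f. f \<in> forms r \<and> f \<noteq> 0}" using Hilb_eq_pideal[of I r] by auto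
qed (auto intro: pideal_in_Hilb)

lemma points_MHilb: "points (MHilb (h_generic r)) = points (Hilb r)"
  unfolding points_Hilb
proof (intro equalityI subsetI)
  fix I assume "I \<in> points (MHilb (h_generic r))"
  then show "I \<in> {pideal f | f. f \<in> forms r \<and> f \<noteq> 0}" using MHilb_eq_pideal[of I r] by auto
qed (auto intro: pideal_in_MHilb)

text \<open>In degree \<open>r\<close> the ideal is a line, so the single basis vector
  \<open>b r 0\<close> of any frame is a generator. Polynomial conditions on a generator thus become
  polynomials in frame coordinates.\<close>

lemma pideal_frame_generator:
  assumes f: "f \<in> forms r" "f \<noteq> 0" and b: "b \<in> graded_frames D (pideal f)" and D: "r \<in> D"
  shows "b r 0 \<in> forms r" "b r 0 \<noteq> 0" "pideal (b r 0) = pideal f"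
proof -
  have dim: "CV.dim (pideal f \<inter> forms r) = 1" using dim_pideal[OF f, of r] by simp
  have "CV.span (b r ` {..<CV.dim (pideal f \<inter> forms r)}) = pideal f \<inter> forms r"
    using b D by (simp add: graded_frames_def)
  then have span: "CV.span (b r ` {..<1}) = pideal f \<inter> forms r" by (simp only: dim)
  have "b r ` {..<1::nat} = {b r 0}" by auto
  with span have span: "CV.span {b r 0} = pideal f \<inter> forms r" by simp
  then have mem: "b r 0 \<in> pideal f \<inter> forms r" using CV.span_base by blast
  then show br: "b r 0 \<in> forms r" by simp
  show "b r 0 \<noteq> 0"
  proof
    assume "b r 0 = 0"
    with span have "pideal f \<inter> forms r = {0}" by simp
    then show False using f pideal_self by blast
  qed
  have "f \<in> CV.span {b r 0}" using span f pideal_self by blast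
  then obtain k where k: "f = cscale k (b r 0)" by (auto simp: CV.span_singleton)
  with f have "k \<noteq> 0" by auto
  with k show "pideal (b r 0) = pideal f" by (simp add: pideal_cscale)
qed

section \<open>Morphisms and closures through polynomial lifts\<close>

lemma poly_funs_compose:
  assumes "f \<in> poly_funs C'" "\<And>c. c \<in> C' \<Longrightarrow> (\<lambda>b. c (\<Lambda> b)) \<in> poly_funs C"
  shows "(\<lambda>b. f (\<Lambda> b)) \<in> poly_funs C"
  using assms(1) by induction (auto intro: poly_funs.intros assms(2))

lemma poly_funs_sum:
  assumes "\<And>a. a \<in> A \<Longrightarrow> f a \<in> poly_funs C"
  shows "(\<lambda>b. \<Sum>a\<in>A. f a b) \<in> poly_funs C"
  using assms by (induction A rule: infinite_finite_induct) (auto intro: poly_funs.intros)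

text \<open>Open sets and regular functions are tested on representatives by polynomials in the
  coordinates, and composition with \<open>\<Lambda>\<close> preserves such polynomials.\<close>

lemma morphism_lift:
  assumes pts: "\<And>x. x \<in> points V \<Longrightarrow> \<phi> x \<in> points W"
    and reps: "\<And>x b. x \<in> points V \<Longrightarrow> b \<in> reps V x \<Longrightarrow> \<Lambda> b \<in> reps W (\<phi> x)"
    and co: "\<And>c. c \<in> coords W \<Longrightarrow> (\<lambda>b. c (\<Lambda> b)) \<in> poly_funs (coords V)"
  shows "morphism V W \<phi>"
  unfolding morphism_def
proof (intro conjI allI impI)
  show "continuous_map (zariski V) (zariski W) \<phi>"
    unfolding continuous_map_def
  proof (intro conjI allI impI)
    show "\<phi> \<in> topspace (zariski V) \<rightarrow> topspace (zariski W)" using pts by auto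
    fix U assume "openin (zariski W) U"
    then have "zariski_open W U" by simp
    from zariski_openD(2)[OF this] obtain E where E: "E \<subseteq> poly_funs (coords W)"
      "\<And>x b. x \<in> points W \<Longrightarrow> b \<in> reps W x \<Longrightarrow> x \<in> U \<longleftrightarrow> (\<exists>p\<in>E. p b \<noteq> 0)" by auto
    have "zariski_open V {x \<in> points V. \<phi> x \<in> U}"
    proof (rule zariski_openI)
      show "(\<lambda>p b. p (\<Lambda> b)) ` E \<subseteq> poly_funs (coords V)"
        using E(1) co by (auto intro: poly_funs_compose)
      fix x b assume "x \<in> points V" "b \<in> reps V x"
      then show "x \<in> {x \<in> points V. \<phi> x \<in> U} \<longleftrightarrow> (\<exists>p\<in>(\<lambda>p b. p (\<Lambda> b)) ` E. p b \<noteq> 0)"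
        using E(2)[OF pts reps] by simp
    qed auto
    then show "openin (zariski V) {x \<in> topspace (zariski V). \<phi> x \<in> U}" by simp
  qed
next
  fix U f assume Uf: "openin (zariski W) U \<and> regular_on W U f"
  show "regular_on V {x \<in> points V. \<phi> x \<in> U} (f \<circ> \<phi>)"
    unfolding regular_on_def
  proof (intro ballI)
    fix x b assume "x \<in> {x \<in> points V. \<phi> x \<in> U}" "b \<in> reps V x"
    then have "\<phi> x \<in> U" "\<Lambda> b \<in> reps W (\<phi> x)" using reps by auto
    then obtain p q where pq: "p \<in> poly_funs (coords W)" "q \<in> poly_funs (coords W)" "q (\<Lambda> b) \<noteq> 0"
      "\<And>x' b'. x' \<in> U \<Longrightarrow> b' \<in> reps W x' \<Longrightarrow> q b' \<noteq> 0 \<Longrightarrow> f x' = p b' / q b'"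
      using Uf unfolding regular_on_def by metis
    show "\<exists>p\<in>poly_funs (coords V). \<exists>q\<in>poly_funs (coords V). q b \<noteq> 0 \<and>
      (\<forall>x'\<in>{x \<in> points V. \<phi> x \<in> U}. \<forall>b'\<in>reps V x'. q b' \<noteq> 0 \<longrightarrow> (f \<circ> \<phi>) x' = p b' / q b')"
    proof (rule bexI[of _ "\<lambda>b. p (\<Lambda> b)"], rule bexI[of _ "\<lambda>b. q (\<Lambda> b)"], intro conjI)
      show "(\<lambda>b. p (\<Lambda> b)) \<in> poly_funs (coords V)" "(\<lambda>b. q (\<Lambda> b)) \<in> poly_funs (coords V)"
        using pq(1,2) co by (auto intro: poly_funs_compose)
      show "q (\<Lambda> b) \<noteq> 0" by fact
      show "\<forall>x'\<in>{x \<in> points V. \<phi> x \<in> U}. \<forall>b'\<in>reps V x'. q (\<Lambda> b') \<noteq> 0 \<longrightarrow>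
          (f \<circ> \<phi>) x' = p (\<Lambda> b') / q (\<Lambda> b')"
        using pq(4) reps by auto
    qed
  qed
qed

text \<open>\<open>\<Lambda>\<close> and \<open>M\<close> need not be mutually inverse: a point has
  many representatives, and only the maps \<open>\<phi>\<close> and \<open>\<psi>\<close> on points
  are inverted.\<close>

lemma isomorphism_lift:
  assumes \<phi>: "\<And>x. x \<in> points V \<Longrightarrow> \<phi> x \<in> points W" and \<psi>: "\<And>y. y \<in> points W \<Longrightarrow> \<psi> y \<in> points V"
    and inv: "\<And>x. x \<in> points V \<Longrightarrow> \<psi> (\<phi> x) = x" "\<And>y. y \<in> points W \<Longrightarrow> \<phi> (\<psi> y) = y"
    and reps: "\<And>x b. x \<in> points V \<Longrightarrow> b \<in> reps V x \<Longrightarrow> \<Lambda> b \<in> reps W (\<phi> x)"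
      "\<And>y c. y \<in> points W \<Longrightarrow> c \<in> reps W y \<Longrightarrow> M c \<in> reps V (\<psi> y)"
    and co: "\<And>c. c \<in> coords W \<Longrightarrow> (\<lambda>b. c (\<Lambda> b)) \<in> poly_funs (coords V)"
      "\<And>c. c \<in> coords V \<Longrightarrow> (\<lambda>b. c (M b)) \<in> poly_funs (coords W)"
  shows "isomorphism V W \<phi>"
  unfolding isomorphism_def
proof (intro conjI)
  show bij: "bij_betw \<phi> (points V) (points W)"
    by (rule bij_betw_byWitness[where f' = \<psi>]) (use \<phi> \<psi> inv in auto)
  show "morphism V W \<phi>" using \<phi> reps(1) co(1) by (rule morphism_lift)
  have eq: "inv_into (points V) \<phi> y = \<psi> y" if "y \<in> points W" for y
    using that bij \<psi> inv by (metis bij_betw_imp_inj_on inv_into_f_f)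
  show "morphism W V (inv_into (points V) \<phi>)"
  proof (rule morphism_lift)
    show "inv_into (points V) \<phi> y \<in> points V" if "y \<in> points W" for y using that eq \<psi> by simp
    show "M c \<in> reps V (inv_into (points V) \<phi> y)" if "y \<in> points W" "c \<in> reps W y" for y c
      using that eq reps(2) by simp
  qed (rule co(2))
qed

lemma isomorphic_refl: "isomorphic V V"
  unfolding isomorphic_def
  by (rule exI, rule isomorphism_lift[where \<phi> = "\<lambda>x. x" and \<psi> = "\<lambda>x. x" and \<Lambda> = "\<lambda>x. x" and M = "\<lambda>x. x"])
    (auto intro: poly_funs.coord)

section \<open>Polynomial curves and Zariski closures\<close>

definition is_poly :: "(complex \<Rightarrow> complex) \<Rightarrow> bool" where
  "is_poly g \<longleftrightarrow> (\<exists>P. g = poly P)"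

lemma is_poly_const: "is_poly (\<lambda>_. c)"
  unfolding is_poly_def by (rule exI[of _ "[:c:]"]) (auto simp: fun_eq_iff)

lemma is_poly_id: "is_poly (\<lambda>t. t)"
  unfolding is_poly_def by (rule exI[of _ "[:0, 1:]"]) (auto simp: fun_eq_iff)

lemma is_poly_add: "is_poly f \<Longrightarrow> is_poly g \<Longrightarrow> is_poly (\<lambda>t. f t + g t)"
  unfolding is_poly_def by (elim exE) (rule_tac x = "P + Pa" in exI, auto simp: fun_eq_iff)

lemma is_poly_mult: "is_poly f \<Longrightarrow> is_poly g \<Longrightarrow> is_poly (\<lambda>t. f t * g t)"
  unfolding is_poly_def by (elim exE) (rule_tac x = "P * Pa" in exI, auto simp: fun_eq_iff)

lemma is_poly_sum: "(\<And>a. a \<in> A \<Longrightarrow> is_poly (f a)) \<Longrightarrow> is_poly (\<lambda>t. \<Sum>a\<in>A. f a t)"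
  by (induction A rule: infinite_finite_induct) (auto intro: is_poly_const is_poly_add)

lemma is_poly_compose:
  assumes "p \<in> poly_funs C" "\<And>c. c \<in> C \<Longrightarrow> is_poly (\<lambda>t. c (\<Lambda> t))"
  shows "is_poly (\<lambda>t. p (\<Lambda> t))"
  using assms(1) by induction (auto intro: is_poly_const is_poly_add is_poly_mult assms(2))

lemma is_poly_zeros: "is_poly f \<Longrightarrow> f c \<noteq> 0 \<Longrightarrow> finite {t. f t = 0}"
  unfolding is_poly_def using poly_roots_finite by (metis poly_0)

text \<open>A test polynomial that is nonzero at \<open>\<Lambda> 0\<close> has finitely many zeros
  along the curve. The exceptional set \<open>B\<close> may contain 0: there only the representative
  \<open>\<Lambda> 0\<close> has to lie over \<open>x\<close>, and for \<open>t\<close> in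
  \<open>B\<close> nothing is asked of \<open>X t\<close>.\<close>

lemma in_closure_of_curve:
  assumes "x \<in> points V" "\<Lambda> 0 \<in> reps V x" "\<And>c. c \<in> coords V \<Longrightarrow> is_poly (\<lambda>t. c (\<Lambda> t))"
    and "finite B" "\<And>t. t \<notin> B \<Longrightarrow> X t \<in> S \<and> X t \<in> points V \<and> \<Lambda> t \<in> reps V (X t)"
  shows "x \<in> zariski V closure_of S"
  unfolding in_closure_of
proof (intro conjI allI impI)
  show "x \<in> topspace (zariski V)" using assms by simp
  fix U assume "x \<in> U \<and> openin (zariski V) U"
  then have xU: "x \<in> U" and "zariski_open V U" by auto
  from zariski_openD(2)[OF this(2)] obtain E where E: "E \<subseteq> poly_funs (coords V)"
    "\<And>x b. x \<in> points V \<Longrightarrow> b \<in> reps V x \<Longrightarrow> x \<in> U \<longleftrightarrow> (\<exists>p\<in>E. p b \<noteq> 0)" by auto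
  from E(2)[OF assms(1,2)] xU obtain p where p: "p \<in> E" "p (\<Lambda> 0) \<noteq> 0" by auto
  have "is_poly (\<lambda>t. p (\<Lambda> t))" using p E assms(3) by (blast intro: is_poly_compose)
  then have "finite {t. p (\<Lambda> t) = 0}" using p(2) by (rule is_poly_zeros)
  with assms(4) have "finite ({t. p (\<Lambda> t) = 0} \<union> B)" by blast
  then obtain t where "t \<notin> {t. p (\<Lambda> t) = 0} \<union> B"
    using ex_new_if_finite infinite_UNIV_char_0 by blast
  with assms(5)[of t] E(2)[of "X t" "\<Lambda> t"] p(1) show "\<exists>y. y \<in> S \<and> y \<in> U" by auto
qed

definition poly_curve :: "(complex \<Rightarrow> bipoly) \<Rightarrow> bool" where
  "poly_curve h \<longleftrightarrow> (\<forall>i j. is_poly (\<lambda>t. bicoeff (h t) i j))"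

lemma poly_curve_const: "poly_curve (\<lambda>_. f)"
  by (simp add: poly_curve_def is_poly_const)

lemma poly_curve_line: "poly_curve (\<lambda>t. f + cscale t g)"
  by (simp add: poly_curve_def is_poly_add is_poly_mult is_poly_const is_poly_id)

lemma poly_curve_mult: "poly_curve f \<Longrightarrow> poly_curve g \<Longrightarrow> poly_curve (\<lambda>t. f t * g t)"
  unfolding poly_curve_def bicoeff_mult by (intro allI is_poly_sum is_poly_mult) auto

lemma poly_curve_prod: "(\<And>a. a \<in> A \<Longrightarrow> poly_curve (f a)) \<Longrightarrow> poly_curve (\<lambda>t. \<Prod>a\<in>A. f a t)"
  by (induction A rule: infinite_finite_induct) (auto intro: poly_curve_const poly_curve_mult)

lemma is_poly_pframe:
  assumes "poly_curve h" "c \<in> frame_coords"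
  shows "is_poly (\<lambda>t. c (pframe D r (h t)))"
proof -
  obtain k m i j where c: "c = (\<lambda>b. bicoeff (b k m) i j)" using assms(2) by (auto simp: frame_coords_def)
  have "poly_curve (\<lambda>t. pframe D r (h t) k m)"
    using poly_curve_mult[OF assms(1) poly_curve_const] poly_curve_const[of 0]
    by (cases "k \<in> D"; cases "m < k + 1 - r"; simp add: pframe_def)
  then show ?thesis by (simp add: c poly_curve_def)
qed

lemma points_P1: "points P1 = {range (\<lambda>s. s *s a) | a. a \<noteq> 0}"
proof (intro equalityI subsetI)
  fix L assume "L \<in> points P1"
  then have L: "vec.subspace L" "vec.dim L = 1" by (auto simp: P1_def)
  obtain B where B: "B \<subseteq> L" "vec.independent B" "L \<subseteq> vec.span B" "card B = vec.dim L"
    by (rule vec.basis_exists)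
  then obtain a where a: "B = {a}" using L by (auto simp: card_Suc_eq)
  then have "a \<noteq> 0" using B(2) by auto
  moreover have "L = vec.span B" using B L vec.span_minimal by blast
  ultimately show "L \<in> {range (\<lambda>s. s *s a) | a. a \<noteq> 0}" using a by (auto simp: vec.span_singleton)
next
  fix L assume "L \<in> {range (\<lambda>s. s *s a) | a :: complex ^ 2. a \<noteq> 0}"
  then obtain a where a: "a \<noteq> 0" "L = vec.span {a}" by (auto simp: vec.span_singleton)
  then show "L \<in> points P1" by (simp add: P1_def vec.dim_span vec.subspace_span)
qed

section \<open>Reduced subschemes and their closure\<close>

lemma form_has_zero:
  assumes "f \<in> forms k" "k \<ge> 1"
  shows "\<exists>a. a \<noteq> 0 \<and> eval_at f a = 0"
proof -
  obtain p where p: "degree p \<le> k" "f = homog k p" using assms(1) by (rule forms_homogE)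
  show ?thesis
  proof (cases "degree p = k")
    case True
    then obtain x where x: "poly p x = 0"
      using fundamental_theorem_of_algebra[of p] assms(2) by (auto simp: constant_degree)
    have "eval_at f (vector [1, x]) = poly p x"
      by (simp add: p eval_at_homog poly_altdef True)
    then show ?thesis using x by (intro exI[of _ "vector [1, x]"]) (auto simp: vec_eq_iff forall_2)
  next
    \<comment> \<open>A degree drop is a zero at (0,1).\<close>
    case False
    then have "coeff p k = 0" using p by (simp add: coeff_eq_0)
    then have "coeff p j * 0 ^ (k - j) = 0" if "j \<le> k" for j using that by (cases "j = k") auto
    then have "(\<Sum>j\<le>k. coeff p j * 0 ^ (k - j)) = 0" by (intro sum.neutral) blast
    then have "eval_at f (vector [0, 1]) = 0" by (simp add: p eval_at_homog)
    then show ?thesis by (intro exI[of _ "vector [0, 1]"]) (auto simp: vec_eq_iff forall_2)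
  qed
qed

lemma form_splits:
  assumes "f \<in> forms r" "f \<noteq> 0"
  shows "\<exists>a c. (\<forall>i<r. a i \<noteq> 0) \<and> c \<noteq> 0 \<and> f = cscale c (\<Prod>i<r. perp (a i))"
  using assms
proof (induction r arbitrary: f)
  case 0
  then obtain c where "f = cscale c 1" using forms_0_const by blast
  moreover from this 0 have "c \<noteq> 0" by auto
  ultimately show ?case by auto
next
  case (Suc r)
  obtain b where b: "b \<noteq> 0" "eval_at f b = 0" using form_has_zero[OF Suc.prems(1)] by auto
  obtain g where g: "g \<in> forms r" "f = perp b * g"
    using form_vanishing_dvd[OF Suc.prems(1) b Suc.prems(2)] by auto
  with Suc.prems have "g \<noteq> 0" by auto
  from Suc.IH[OF g(1) this] obtain a c where a: "\<forall>i<r. a i \<noteq> 0" "c \<noteq> 0" "g = cscale c (\<Prod>i<r. perp (a i))" by blast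
  have "(\<Prod>i<r. perp ((a(r := b)) i)) = (\<Prod>i<r. perp (a i))" by (intro prod.cong) auto
  then have "f = cscale c (\<Prod>i<Suc r. perp ((a(r := b)) i))"
    using g a by (simp add: cscale_mult mult.commute)
  moreover have "\<forall>i<Suc r. (a(r := b)) i \<noteq> 0" using a b by (auto simp: less_Suc_eq)
  ultimately show ?case using a by blast
qed

text \<open>\<open>eval_at (perp (a i)) (a j)\<close> is the determinant of the two vectors, so the
  second clause makes them span different lines.\<close>

definition distinct_points :: "nat \<Rightarrow> (nat \<Rightarrow> complex ^ 2) \<Rightarrow> bool" where
  "distinct_points n a \<longleftrightarrow> (\<forall>i<n. a i \<noteq> 0) \<and> (\<forall>i<n. \<forall>j<n. i \<noteq> j \<longrightarrow> eval_at (perp (a i)) (a j) \<noteq> 0)"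

definition points_form :: "nat \<Rightarrow> (nat \<Rightarrow> complex ^ 2) \<Rightarrow> bipoly" where
  "points_form n a = (\<Prod>i<n. perp (a i))"

lemma points_form_in_forms: "points_form n a \<in> forms n"
proof (induction n)
  case 0
  have "(1 :: bipoly) = homog 0 1"
    by (rule bipoly_eqI) (auto simp: bicoeff_homog, auto simp: bicoeff_def coeff_pCons one_pCons split: nat.splits)
  then show ?case by (metis homog_in_forms lessThan_0 points_form_def prod.empty)
next
  case (Suc n)
  then show ?case using forms_mult[OF Suc perp_in_forms[of "a n"]] by (simp add: points_form_def)
qed

lemma points_form_nonzero: "distinct_points n a \<Longrightarrow> points_form n a \<noteq> 0"
  by (auto simp: points_form_def distinct_points_def perp_eq_0_iff)

lemma eval_at_perp_self [simp]: "eval_at (perp a) a = 0"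
  by (simp add: eval_at_perp)

lemma eval_at_points_form: "i < n \<Longrightarrow> eval_at (points_form n a) (a i) = 0"
  by (auto simp: points_form_def eval_at_prod intro: bexI[of _ i])

lemma points_form_dvd:
  assumes "distinct_points n a" "p \<in> forms k" "\<And>i. i < n \<Longrightarrow> eval_at p (a i) = 0"
  shows "\<exists>q\<in>forms (k - n). p = points_form n a * q"
  using assms
proof (induction n)
  case 0
  then show ?case by (auto simp: points_form_def)
next
  case (Suc n)
  show ?case
  proof (cases "p = 0")
    case True
    then show ?thesis by (intro bexI[of _ 0]) auto
  next
    case False
    have "distinct_points n a" using Suc.prems(1) by (auto simp: distinct_points_def)
    from Suc.IH[OF this Suc.prems(2)] Suc.prems(3) obtain q where q: "q \<in> forms (k - n)" "p = points_form n a * q" by auto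
    have "eval_at (points_form n a) (a n) \<noteq> 0"
      using Suc.prems(1) by (auto simp: points_form_def eval_at_prod distinct_points_def)
    with Suc.prems(3)[of n] q have "eval_at q (a n) = 0" by (simp add: eval_at_mult)
    moreover have "a n \<noteq> 0" using Suc.prems(1) by (simp add: distinct_points_def)
    moreover have "q \<noteq> 0" using False q by auto
    ultimately obtain q' where "q' \<in> forms (k - n - 1)" "q = perp (a n) * q'"
      using form_vanishing_dvd[OF q(1)] by blast
    then show ?thesis using q by (intro bexI[of _ q']) (auto simp: points_form_def mult.assoc)
  qed
qed

section \<open>Ideals of distinct points\<close>

definition line_of :: "complex ^ 2 \<Rightarrow> (complex ^ 2) set" where
  "line_of a = range (\<lambda>s. s *s a)"

lemma self_in_line_of: "a \<in> line_of a"
  unfolding line_of_def by (rule range_eqI[of _ _ 1]) simp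

lemma points_P1_line_of: "points P1 = {line_of a | a. a \<noteq> 0}"
  by (simp add: points_P1 line_of_def)

lemma line_of_image:
  assumes "distinct_points n a"
  shows "line_of ` a ` {..<n} \<subseteq> points P1" "finite (line_of ` a ` {..<n})" "card (line_of ` a ` {..<n}) = n"
proof -
  show "line_of ` a ` {..<n} \<subseteq> points P1"
    using assms by (auto simp: points_P1_line_of distinct_points_def)
  have "inj_on (line_of \<circ> a) {..<n}"
  proof (rule inj_onI)
    fix i j assume ij: "i \<in> {..<n}" "j \<in> {..<n}" "(line_of \<circ> a) i = (line_of \<circ> a) j"
    then have "a j \<in> line_of (a i)" using self_in_line_of[of "a j"] by simp
    then have "eval_at (perp (a i)) (a j) = 0" by (auto simp: line_of_def eval_at_perp)
    with ij assms show "i = j" by (auto simp: distinct_points_def)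
  qed
  then show "card (line_of ` a ` {..<n}) = n" unfolding image_comp by (simp only: card_image card_lessThan)
qed simp

text \<open>Along the line the value is a polynomial in \<open>s\<close> whose coefficients are the
  values of the graded parts; it vanishes everywhere, so its coefficients do.\<close>

lemma eval_at_hom_parts:
  assumes "\<And>s. eval_at p (s *s a) = 0"
  shows "eval_at (hom_part k p) a = 0"
proof -
  obtain N where N: "p = (\<Sum>k\<le>N. hom_part k p)" using sum_hom_parts by blast
  define P where "P = (\<Sum>k\<le>N. monom (eval_at (hom_part k p) a) k)"
  have "poly P s = 0" for s
  proof -
    have "0 = eval_at (\<Sum>k\<le>N. hom_part k p) (s *s a)" using assms N by metis
    then show ?thesis
      by (simp add: P_def poly_sum poly_monom eval_at_sum eval_at_form_scale[OF hom_part_in_forms] mult.commute)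
  qed
  then have "P = 0" using poly_all_0_iff_0 by blast
  then have "coeff P k = 0" by simp
  then have "eval_at (hom_part k p) a = 0" if "k \<le> N" using that by (simp add: P_def coeff_sum)
  moreover have "hom_part k p = 0" if "\<not> k \<le> N"
  proof -
    have "hom_part k (\<Sum>k\<le>N. hom_part k p) = 0"
      using that by (simp add: hom_part_sum hom_part_forms[OF hom_part_in_forms])
    then show ?thesis using N by simp
  qed
  ultimately show ?thesis by (cases "k \<le> N") auto
qed

lemma vanishing_ideal_distinct:
  assumes "distinct_points n a"
  shows "vanishing_ideal (line_of ` a ` {..<n}) = pideal (points_form n a)"
proof (intro equalityI subsetI)
  fix p assume "p \<in> vanishing_ideal (line_of ` a ` {..<n})"
  then have ev: "eval_at p (s *s a i) = 0" if "i < n" for s i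
    using that by (auto simp: vanishing_ideal_def line_of_def)
  note J = hom_idealD[OF hom_ideal_pideal[OF points_form_in_forms[of n a]]]
  show "p \<in> pideal (points_form n a)"
  proof (rule hom_part_mem_imp_mem)
    fix k
    have "\<exists>q\<in>forms (k - n). hom_part k p = points_form n a * q"
      using ev by (intro points_form_dvd assms hom_part_in_forms eval_at_hom_parts) auto
    then show "hom_part k p \<in> pideal (points_form n a)" by (auto simp: pideal_def)
  qed (fact J)+
next
  fix p assume "p \<in> pideal (points_form n a)"
  then obtain q where "p = points_form n a * q" by (auto simp: pideal_def)
  then show "p \<in> vanishing_ideal (line_of ` a ` {..<n})"
    by (auto simp: vanishing_ideal_def line_of_def eval_at_mult eval_at_form_scale[OF points_form_in_forms]
      eval_at_points_form)
qed

lemma radical_vanishing_ideal: "radical_ideal (vanishing_ideal \<Gamma>)"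
  unfolding radical_ideal_def vanishing_ideal_def by (auto simp: eval_at_power)

lemma pideal_in_reduced_locus:
  assumes "distinct_points n a"
  shows "pideal (points_form n a) \<in> reduced_locus n"
  using radical_vanishing_ideal[of "line_of ` a ` {..<n}"]
  by (simp add: reduced_locus_def vanishing_ideal_distinct[OF assms] pideal_in_Hilb points_form_in_forms points_form_nonzero[OF assms])

section \<open>Deformation to distinct points\<close>

definition perturb :: "(nat \<Rightarrow> complex ^ 2) \<Rightarrow> complex \<Rightarrow> nat \<Rightarrow> complex ^ 2" where
  "perturb a t i = a i + t *s vector [1, of_nat i]"

lemma finite_poly_zeros_2:
  fixes x y z :: complex
  assumes "z \<noteq> 0"
  shows "finite {t. x + y * t + z * t ^ 2 = 0}"
proof -
  have "finite {t. poly [:x, y, z:] t = 0}" using assms by (intro poly_roots_finite) auto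
  then show ?thesis by (simp add: algebra_simps power2_eq_square)
qed

text \<open>The directions (1,i) are pairwise independent: the determinant of the i-th and j-th
  moved vectors is quadratic in \<open>t\<close> with leading coefficient j - i, whatever
  \<open>a\<close> is.\<close>

lemma perturb_distinct:
  "\<exists>B. finite B \<and> (\<forall>t. t \<notin> B \<longrightarrow> distinct_points n (perturb a t))"
proof -
  define B where "B = (\<Union>i<n. {t. perturb a t i = 0}) \<union>
    (\<Union>i<n. \<Union>j\<in>{..<n} - {i}. {t. eval_at (perp (perturb a t i)) (perturb a t j) = 0})"
  have "finite {t. perturb a t i = 0}" for i
    by (rule finite_subset[of _ "{- (a i $ 1)}"]) (auto simp: perturb_def vec_eq_iff forall_2 eq_neg_iff_add_eq_0 add.commute)
  moreover have "finite {t. eval_at (perp (perturb a t i)) (perturb a t j) = 0}" if "i \<noteq> j" for i j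
  proof -
    have "eval_at (perp (perturb a t i)) (perturb a t j) = eval_at (perp (a i)) (a j) +
      (a i $ 1 * of_nat j - a i $ 2 + a j $ 2 - of_nat i * a j $ 1) * t + (of_nat j - of_nat i) * t ^ 2" for t
      by (simp add: eval_at_perp perturb_def algebra_simps power2_eq_square)
    moreover have "(of_nat j - of_nat i :: complex) \<noteq> 0" using that by simp
    ultimately show ?thesis using finite_poly_zeros_2 by simp
  qed
  ultimately have "finite B" unfolding B_def by auto
  moreover have "distinct_points n (perturb a t)" if "t \<notin> B" for t
    using that by (auto simp: B_def distinct_points_def)
  ultimately show ?thesis by blast
qed

lemma perturb_0: "perturb a 0 = a"
  by (rule ext) (simp add: perturb_def)

lemma poly_curve_perturb: "poly_curve (\<lambda>t. points_form n (perturb a t))"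
  unfolding points_form_def perturb_def perp_add_scale
  by (intro poly_curve_prod poly_curve_line)

lemma pideal_points_formE:
  assumes "f \<in> forms r" "f \<noteq> 0"
  obtains a where "pideal f = pideal (points_form r a)" "\<And>i. i < r \<Longrightarrow> a i \<noteq> 0"
    "points_form r a \<noteq> 0"
proof -
  obtain a c where a: "\<forall>i<r. a i \<noteq> 0" "c \<noteq> 0" "f = cscale c (\<Prod>i<r. perp (a i))"
    using form_splits[OF assms] by blast
  with assms that show ?thesis by (auto simp: points_form_def[symmetric] pideal_cscale)
qed

text \<open>Stated for an arbitrary \<open>V\<close> represented by frames, because it is applied
  both to \<open>Hilb r\<close> with \<open>D = {r..}\<close> and to the multigraded Hilbert scheme
  with \<open>D = UNIV\<close>.\<close>

lemma pideal_in_closure: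
  assumes f: "f \<in> forms r" "f \<noteq> 0"
    and V: "reps V = graded_frames D" "coords V = frame_coords"
      "\<And>g. g \<in> forms r \<Longrightarrow> g \<noteq> 0 \<Longrightarrow> pideal g \<in> points V"
    and S: "\<And>a. distinct_points r a \<Longrightarrow> pideal (points_form r a) \<in> S"
  shows "pideal f \<in> zariski V closure_of S"
proof -
  from f obtain a where a: "pideal f = pideal (points_form r a)" "points_form r a \<noteq> 0"
    by (rule pideal_points_formE)
  obtain B where B: "finite B" "\<And>t. t \<notin> B \<Longrightarrow> distinct_points r (perturb a t)"
    using perturb_distinct by blast
  show ?thesis
  proof (rule in_closure_of_curve[where X = "\<lambda>t. pideal (points_form r (perturb a t))" and B = B
        and \<Lambda> = "\<lambda>t. pframe D r (points_form r (perturb a t))"])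
    show "pideal f \<in> points V" using V(3) f .
    show "pframe D r (points_form r (perturb a 0)) \<in> reps V (pideal f)"
      unfolding perturb_0 a V(1) by (intro pframe_in_graded_frames points_form_in_forms a)
    show "is_poly (\<lambda>t. c (pframe D r (points_form r (perturb a t))))" if "c \<in> coords V" for c
      using that V(2) by (intro is_poly_pframe poly_curve_perturb) auto
    fix t assume "t \<notin> B"
    then have t: "distinct_points r (perturb a t)" by (rule B)
    note nz = points_form_in_forms points_form_nonzero[OF t]
    show "pideal (points_form r (perturb a t)) \<in> S \<and> pideal (points_form r (perturb a t)) \<in> points V \<and>
        pframe D r (points_form r (perturb a t)) \<in> reps V (pideal (points_form r (perturb a t)))"
      using S[OF t] V(3)[OF nz] pframe_in_graded_frames[OF nz] V(1) by simp
  qed (fact B)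
qed

text \<open>A product of linear factors moves to one with distinct zeros. Consequently
  \<open>srk\<close> and \<open>crk\<close> minimize over the same schemes.\<close>

lemma smoothable_locus_eq: "smoothable_locus r = points (Hilb r)"
proof
  show "smoothable_locus r \<subseteq> points (Hilb r)"
    unfolding smoothable_locus_def using closure_of_subset_topspace[of "zariski (Hilb r)"] by simp
  show "points (Hilb r) \<subseteq> smoothable_locus r"
    unfolding smoothable_locus_def
  proof
    fix I assume "I \<in> points (Hilb r)"
    then obtain f where "f \<in> forms r" "f \<noteq> 0" "I = pideal f" using Hilb_eq_pideal by blast
    then show "I \<in> zariski (Hilb r) closure_of reduced_locus r"
      using pideal_in_closure[of f r "Hilb r" "{r..}"] pideal_in_Hilb pideal_in_reduced_locus
      by (simp add: Hilb_def)
  qed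
qed

lemma points_Slip: "points (Slip r) = points (Hilb r)"
proof -
  let ?S = "{J \<in> points (MHilb (h_generic r)). \<exists>\<Gamma>\<subseteq>points P1. finite \<Gamma> \<and> card \<Gamma> = r \<and> J = vanishing_ideal \<Gamma>}"
  have "pideal f \<in> zariski (MHilb (h_generic r)) closure_of ?S" if "f \<in> forms r" "f \<noteq> 0" for f
  proof (rule pideal_in_closure[OF that])
    show "reps (MHilb (h_generic r)) = graded_frames UNIV" "coords (MHilb (h_generic r)) = frame_coords"
      by (simp_all add: MHilb_def)
    show "pideal g \<in> points (MHilb (h_generic r))" if "g \<in> forms r" "g \<noteq> 0" for g
      using that by (rule pideal_in_MHilb)
    fix a assume a: "distinct_points r a"
    have "pideal (points_form r a) \<in> points (MHilb (h_generic r))"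
      by (intro pideal_in_MHilb points_form_in_forms points_form_nonzero a)
    then show "pideal (points_form r a) \<in> ?S"
      using line_of_image[OF a] vanishing_ideal_distinct[OF a] by blast
  qed
  then have "points (Hilb r) \<subseteq> zariski (MHilb (h_generic r)) closure_of ?S"
    unfolding points_Hilb by blast
  then show ?thesis
    by (auto simp: Slip_def subvariety_def points_MHilb)
qed

section \<open>Apolarity\<close>

lemma bicoeff_dx0: "bicoeff (dx0 F) i j = of_nat (i + 1) * bicoeff F (i + 1) j"
  by (simp add: bicoeff_def dx0_def coeff_map_poly coeff_pderiv)

lemma bicoeff_dx1: "bicoeff (dx1 F) i j = of_nat (j + 1) * bicoeff F i (j + 1)"
  by (simp add: bicoeff_def dx1_def coeff_pderiv of_nat_poly flip: of_nat_Suc)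

text \<open>The coefficients with respect to divided powers: the factorials absorb the factors
  produced by differentiation, which becomes a shift of indices.\<close>

definition dweight :: "bipoly \<Rightarrow> nat \<Rightarrow> nat \<Rightarrow> complex" where
  "dweight F i j = fact i * fact j * bicoeff F i j"

lemma dweight_dx: "dweight ((dx0 ^^ a) ((dx1 ^^ b) F)) i j = dweight F (i + a) (j + b)"
proof -
  have 0: "dweight (dx0 F) i j = dweight F (i + 1) j" for F i j
    by (simp add: dweight_def bicoeff_dx0 algebra_simps)
  have 1: "dweight (dx1 F) i j = dweight F i (j + 1)" for F i j
    by (simp add: dweight_def bicoeff_dx1 algebra_simps)
  have "dweight ((dx0 ^^ a) F) i j = dweight F (i + a) j" for F i
    by (induction a arbitrary: i) (simp_all add: 0)
  moreover have "dweight ((dx1 ^^ b) F) i j = dweight F i (j + b)" for i j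
    by (induction b arbitrary: j) (simp_all add: 1)
  ultimately show ?thesis by simp
qed

text \<open>Only the part of \<open>\<psi>\<close> in degree \<open>d - (i + j)\<close> contributes,
  since the weights of \<open>F\<close> vanish off degree \<open>d\<close>. The sums, bounded by
  degrees of \<open>\<psi>\<close>, are padded with zero terms and cut to the common range up to
  \<open>d\<close>.\<close>

lemma dweight_apolar_action:
  assumes F: "F \<in> forms d"
  shows "dweight (apolar_action \<psi> F) i j = (if i + j \<le> d then
    (\<Sum>b\<le>d - (i + j). bicoeff \<psi> (d - (i + j) - b) b * dweight F (d - (j + b)) (j + b)) else 0)"
proof -
  have w: "dweight F a b = 0" if "a + b \<noteq> d" for a b
    using F that by (auto simp: forms_def dweight_def)
  have eq: "dweight (\<Sum>b\<in>A. \<Sum>a\<in>B b. cscale (c a b) (G a b)) i j = (\<Sum>b\<in>A. \<Sum>a\<in>B b. c a b * dweight (G a b) i j)"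
    for A :: "nat set" and B :: "nat \<Rightarrow> nat set" and c and G
    by (simp add: dweight_def sum_distrib_left algebra_simps)
  let ?t = "\<lambda>b a. bicoeff \<psi> a b * dweight F (i + a) (j + b)"
  have "dweight (apolar_action \<psi> F) i j = (\<Sum>b\<le>degree \<psi>. \<Sum>a\<le>degree (coeff \<psi> b). ?t b a)"
    unfolding apolar_action_def eq dweight_dx ..
  also have "\<dots> = (\<Sum>b\<le>degree \<psi>. \<Sum>a\<le>d. ?t b a)"
  proof (rule sum.cong)
    fix b assume "b \<in> {..degree \<psi>}"
    have "(\<Sum>a\<le>degree (coeff \<psi> b). ?t b a) = (\<Sum>a\<le>max d (degree (coeff \<psi> b)). ?t b a)"
      by (rule sum.mono_neutral_left) (auto simp: bicoeff_def coeff_eq_0)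
    also have "\<dots> = (\<Sum>a\<le>d. ?t b a)"
      by (rule sum.mono_neutral_right) (auto simp: w)
    finally show "(\<Sum>a\<le>degree (coeff \<psi> b). ?t b a) = (\<Sum>a\<le>d. ?t b a)" .
  qed simp
  also have "\<dots> = (\<Sum>b\<le>max d (degree \<psi>). \<Sum>a\<le>d. ?t b a)"
    by (rule sum.mono_neutral_left) (auto simp: bicoeff_def coeff_eq_0)
  also have "\<dots> = (\<Sum>b\<le>d. \<Sum>a\<le>d. ?t b a)"
    by (rule sum.mono_neutral_right) (auto simp: w)
  also have "\<dots> = (\<Sum>b\<le>d. if i + j + b \<le> d then ?t b (d - (i + j) - b) else 0)"
  proof (rule sum.cong)
    fix b
    have "(\<Sum>a\<le>d. ?t b a) = (\<Sum>a\<le>d. if a = d - (i + j) - b \<and> i + j + b \<le> d then ?t b (d - (i + j) - b) else 0)"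
      by (rule sum.cong) (auto simp: w)
    then show "(\<Sum>a\<le>d. ?t b a) = (if i + j + b \<le> d then ?t b (d - (i + j) - b) else 0)"
      by (cases "i + j + b \<le> d") simp_all
  qed simp
  also have "\<dots> = (if i + j \<le> d then (\<Sum>b\<le>d - (i + j). ?t b (d - (i + j) - b)) else 0)"
  proof (cases "i + j \<le> d")
    case True
    have "(\<Sum>b\<le>d - (i + j). ?t b (d - (i + j) - b)) =
        (\<Sum>b\<le>d - (i + j). if i + j + b \<le> d then ?t b (d - (i + j) - b) else 0)"
      using True by (intro sum.cong) auto
    also have "\<dots> = (\<Sum>b\<le>d. if i + j + b \<le> d then ?t b (d - (i + j) - b) else 0)"
      by (rule sum.mono_neutral_left) auto
    finally show ?thesis using True by simp
  next
    case False
    then have "i + j + b \<le> d \<longleftrightarrow> False" for b by auto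
    then show ?thesis using False by simp
  qed
  also have "\<dots> = (if i + j \<le> d then
    (\<Sum>b\<le>d - (i + j). bicoeff \<psi> (d - (i + j) - b) b * dweight F (d - (j + b)) (j + b)) else 0)"
    by (intro if_cong refl sum.cong) (auto intro!: arg_cong[of _ _ "\<lambda>a. dweight F a _"])
  finally show ?thesis .
qed

text \<open>The linear functional \<open>\<psi> \<mapsto> \<psi> \<circ> F\<close> on \<open>S\<^sub>d\<close>, in the dehomogenized coordinates.\<close>

definition dual_fun :: "nat \<Rightarrow> bipoly \<Rightarrow> complex poly \<Rightarrow> complex" where
  "dual_fun d F p = (\<Sum>n\<le>d. coeff p n * dweight F (d - n) n)"

lemma dual_fun_add: "dual_fun d F (p + q) = dual_fun d F p + dual_fun d F q"
  and dual_fun_smult: "dual_fun d F (smult c p) = c * dual_fun d F p"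
  by (simp_all add: dual_fun_def sum.distrib distrib_right sum_distrib_left mult.assoc)

lemma dual_fun_monom: "n \<le> d \<Longrightarrow> dual_fun d F (monom 1 n) = dweight F (d - n) n"
proof -
  assume "n \<le> d"
  have "dual_fun d F (monom 1 n) = (\<Sum>m\<le>d. if m = n then dweight F (d - m) m else 0)"
    unfolding dual_fun_def by (intro sum.cong) auto
  with \<open>n \<le> d\<close> show ?thesis by simp
qed

text \<open>The dehomogenized degree \<open>k\<close> part of the annihilator. The guard answers
  truncated subtraction: beyond \<open>d\<close> every form is apolar, whereas
  \<open>d - k = 0\<close> would still impose a condition.\<close>

definition apolar_polys :: "(complex poly \<Rightarrow> complex) \<Rightarrow> nat \<Rightarrow> nat \<Rightarrow> complex poly set" where
  "apolar_polys \<Phi> d k =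
     {p. degree p \<le> k \<and> (k \<le> d \<longrightarrow> (\<forall>q. degree q \<le> d - k \<longrightarrow> \<Phi> (q * p) = 0))}"

section \<open>Apolar polynomials of a linear functional\<close>

locale linear_functional =
  fixes \<Phi> :: "complex poly \<Rightarrow> complex"
  assumes add: "\<Phi> (p + q) = \<Phi> p + \<Phi> q" and smult: "\<Phi> (smult c p) = c * \<Phi> p"
begin

lemma zero: "\<Phi> 0 = 0"
  using smult[of 0 0] by simp

lemma sum: "\<Phi> (\<Sum>a\<in>A. f a) = (\<Sum>a\<in>A. \<Phi> (f a))"
  by (induction A rule: infinite_finite_induct) (simp_all add: zero add)

lemma apolar_polys_monom:
  "p \<in> apolar_polys \<Phi> d k \<longleftrightarrow> degree p \<le> k \<and> (k \<le> d \<longrightarrow> (\<forall>j\<le>d - k. \<Phi> (monom 1 j * p) = 0))"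
proof
  assume "p \<in> apolar_polys \<Phi> d k"
  then show "degree p \<le> k \<and> (k \<le> d \<longrightarrow> (\<forall>j\<le>d - k. \<Phi> (monom 1 j * p) = 0))"
    by (auto simp: apolar_polys_def degree_monom_eq)
next
  assume *: "degree p \<le> k \<and> (k \<le> d \<longrightarrow> (\<forall>j\<le>d - k. \<Phi> (monom 1 j * p) = 0))"
  have "\<Phi> (q * p) = 0" if "degree q \<le> d - k" "k \<le> d" for q
  proof -
    have "q * p = (\<Sum>j\<le>d - k. smult (coeff q j) (monom 1 j * p))"
      by (subst poly_as_sum_le[OF that(1), symmetric])
        (simp add: sum_distrib_right smult_monom flip: mult_smult_left)
    then show ?thesis using * that by (simp add: sum smult)
  qed
  with * show "p \<in> apolar_polys \<Phi> d k" by (auto simp: apolar_polys_def)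
qed

lemma apolar_polys_add: "p \<in> apolar_polys \<Phi> d k \<Longrightarrow> q \<in> apolar_polys \<Phi> d k \<Longrightarrow> p + q \<in> apolar_polys \<Phi> d k"
  by (auto simp: apolar_polys_monom distrib_left add intro: degree_add_le)

lemma apolar_polys_smult: "p \<in> apolar_polys \<Phi> d k \<Longrightarrow> smult c p \<in> apolar_polys \<Phi> d k"
  by (auto simp: apolar_polys_monom smult intro: order.trans[OF degree_smult_le])

text \<open>
  Two independent elements would, for every point \<open>x\<close> with \<open>f(x) \<noteq> 0\<close>, have a combination
  \<open>(X - x) g\<close>. The functional \<open>w \<mapsto> \<Phi>(w g)\<close> is then a multiple of the evaluation at \<open>x\<close>,
  a nonzero one by minimality of \<open>r\<close>, but it vanishes at \<open>f\<close>.
\<close>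

lemma apolar_polys_unique:
  assumes min: "apolar_polys \<Phi> d (r - 1) \<subseteq> {0}" and r: "1 \<le> r" "2 * r \<le> d + 1"
    and f: "f \<in> apolar_polys \<Phi> d r" "f \<noteq> 0" and f': "f' \<in> apolar_polys \<Phi> d r"
  shows "\<exists>c. f' = smult c f"
proof (rule ccontr)
  assume indep: "\<nexists>c. f' = smult c f"
  have "poly f x = 0" for x
  proof (rule ccontr)
    assume fx: "poly f x \<noteq> 0"
    define h where "h = f' + smult (- poly f' x / poly f x) f"
    have h: "h \<in> apolar_polys \<Phi> d r" unfolding h_def by (intro apolar_polys_add apolar_polys_smult f f')
    have "poly h x = 0" using fx by (simp add: h_def)
    then obtain g where g: "h = [:- x, 1:] * g" unfolding poly_eq_0_iff_dvd by (auto elim: dvdE)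
    have "h \<noteq> 0"
    proof
      assume "h = 0"
      then have "f' = smult (poly f' x / poly f x) f" by (simp add: h_def add_eq_0_iff2)
      then show False using indep by blast
    qed
    then have "g \<noteq> 0" using g by auto
    have "degree h \<le> r" using h by (simp add: apolar_polys_def)
    moreover have "degree h = 1 + degree g" using \<open>g \<noteq> 0\<close> by (subst g, subst degree_mult_eq) auto
    ultimately have dg: "degree g \<le> r - 1" by simp
    have \<Phi>g: "\<Phi> (w * g) = poly w x * \<Phi> g" if "degree w \<le> d - r + 1" for w
    proof -
      obtain w1 where w1: "w - [:poly w x:] = [:- x, 1:] * w1"
        using poly_eq_0_iff_dvd[of "w - [:poly w x:]" x] by (auto elim: dvdE)
      have "degree w1 \<le> d - r"
      proof (cases "w1 = 0")
        case False
        have "1 + degree w1 = degree (w - [:poly w x:])"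
          unfolding w1 using False by (subst degree_mult_eq) auto
        also have "\<dots> \<le> d - r + 1" using that by (intro degree_diff_le) auto
        finally show ?thesis by simp
      qed simp
      then have "\<Phi> (w1 * h) = 0" using h r by (auto simp: apolar_polys_def)
      have "w = [:poly w x:] + [:- x, 1:] * w1" using w1 by (simp only: diff_eq_eq add.commute)
      then have "w * g = ([:poly w x:] + [:- x, 1:] * w1) * g" by (rule arg_cong)
      also have "([:poly w x:] + l * w1) * g = smult (poly w x) g + w1 * (l * g)" for l
        by (simp add: algebra_simps)
      finally have "w * g = smult (poly w x) g + w1 * h" unfolding g .
      with \<open>\<Phi> (w1 * h) = 0\<close> show ?thesis by (simp add: add smult)
    qed
    have "\<Phi> (f * g) = poly f x * \<Phi> g" using f r by (intro \<Phi>g) (auto simp: apolar_polys_def)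
    moreover have "\<Phi> (g * f) = 0" using f dg r by (auto simp: apolar_polys_def)
    ultimately have "\<Phi> g = 0" using fx by (simp add: mult.commute)
    then have "g \<in> apolar_polys \<Phi> d (r - 1)"
      using dg \<Phi>g r by (auto simp: apolar_polys_def)
    with min \<open>g \<noteq> 0\<close> show False by auto
  qed
  then show False using f poly_all_0_iff_0 by blast
qed

end

lemma underdetermined_system:
  fixes M :: "'a \<Rightarrow> 'b \<Rightarrow> complex"
  assumes "finite J" "finite I" "card J < card I"
  shows "\<exists>v. (\<exists>i\<in>I. v i \<noteq> 0) \<and> (\<forall>j\<in>J. (\<Sum>i\<in>I. v i * M i j) = 0)"
  using assms
proof (induction J arbitrary: I M rule: finite_induct)
  case empty
  then obtain i where "i \<in> I" by fastforce
  then show ?case by (intro exI[of _ "\<lambda>_. 1"]) auto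
next
  case (insert j J)
  show ?case
  proof (cases "\<forall>i\<in>I. M i j = 0")
    case True
    have "card J < card I" using insert by simp
    from insert.IH[OF insert.prems(1) this, of M] True show ?thesis by auto
  next
    case False
    then obtain i0 where i0: "i0 \<in> I" "M i0 j \<noteq> 0" by blast
    let ?I = "I - {i0}"
    have "finite ?I" "card J < card ?I" using insert i0 by auto
    from insert.IH[OF this, of "\<lambda>i j'. M i j' - M i j / M i0 j * M i0 j'"]
    obtain v where v: "\<exists>i\<in>?I. v i \<noteq> 0"
      "\<And>j'. j' \<in> J \<Longrightarrow> (\<Sum>i\<in>?I. v i * (M i j' - M i j / M i0 j * M i0 j')) = 0" by blast
    \<comment> \<open>Minus \<open>s\<close> is the value of the pivot unknown that satisfies
      equation \<open>j\<close>.\<close>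
    define s where "s = (\<Sum>i\<in>?I. v i * M i j) / M i0 j"
    define u where "u = v(i0 := - s)"
    have sum: "(\<Sum>i\<in>I. u i * M i j') = (\<Sum>i\<in>?I. v i * M i j') - s * M i0 j'" for j'
      using i0 insert.prems(1) by (simp add: sum.remove u_def)
    have "(\<Sum>i\<in>I. u i * M i j) = 0" unfolding sum using i0 by (simp add: s_def)
    moreover have "(\<Sum>i\<in>I. u i * M i j') = 0" if "j' \<in> J" for j'
      unfolding sum using v(2)[OF that]
      by (simp add: s_def right_diff_distrib sum_subtractf sum_distrib_right sum_divide_distrib mult.assoc)
    moreover have "\<exists>i\<in>I. u i \<noteq> 0" using v(1) by (auto simp: u_def)
    ultimately show ?thesis by (intro exI[of _ u]) auto
  qed
qed

context linear_functional
begin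

lemma apolar_polys_solution:
  fixes M :: "nat \<Rightarrow> 'a \<Rightarrow> complex"
  assumes "finite J" "card J < k + 1"
  shows "\<exists>p. p \<noteq> 0 \<and> degree p \<le> k \<and> (\<forall>j\<in>J. (\<Sum>i\<le>k. coeff p i * M i j) = 0)"
proof -
  obtain v where v: "\<exists>i\<in>{..k}. v i \<noteq> 0" "\<forall>j\<in>J. (\<Sum>i\<le>k. v i * M i j) = 0"
    using underdetermined_system[of J "{..k}" M] assms by auto
  define p where "p = (\<Sum>i\<le>k. monom (v i) i)"
  have c: "coeff p i = (if i \<le> k then v i else 0)" for i by (simp add: p_def coeff_sum)
  have "p \<noteq> 0" using v(1) by (metis atMost_iff c coeff_0)
  moreover have "degree p \<le> k" by (rule degree_le) (simp add: c)
  ultimately show ?thesis using v(2) by (intro exI[of _ p]) (simp add: c)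
qed

lemma functional_expand: "degree p \<le> k \<Longrightarrow> \<Phi> (q * p) = (\<Sum>i\<le>k. coeff p i * \<Phi> (q * monom 1 i))"
  by (subst poly_as_sum_le[of p k, symmetric]) (auto simp add: sum_distrib_left sum smult_monom simp flip: smult mult_smult_right)

lemma apolar_polys_exists:
  assumes "d < 2 * k"
  shows "\<exists>p\<in>apolar_polys \<Phi> d k. p \<noteq> 0"
proof (cases "k \<le> d")
  case True
  with assms have "card {..d - k} < k + 1" by simp
  from apolar_polys_solution[OF _ this, of "\<lambda>i j. \<Phi> (monom 1 j * monom 1 i)"]
  obtain p where "p \<noteq> 0" "degree p \<le> k" "\<forall>j\<le>d - k. (\<Sum>i\<le>k. coeff p i * \<Phi> (monom 1 j * monom 1 i)) = 0"
    by auto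
  then show ?thesis by (auto simp: apolar_polys_monom functional_expand[of p k])
next
  case False
  then have "1 \<in> apolar_polys \<Phi> d k" by (simp add: apolar_polys_def)
  then show ?thesis by (intro bexI[of _ 1]) auto
qed

text \<open>In this case \<open>d - r = r - 2\<close>, and \<open>r - 1\<close> equations in
  \<open>r + 1\<close> unknowns leave at least a plane. It is no larger because two further linear
  conditions lead into degree \<open>r - 1\<close>, where only zero is left.\<close>

lemma apolar_polys_pencil:
  assumes min: "apolar_polys \<Phi> d (r - 1) \<subseteq> {0}" and r: "2 \<le> r" "2 * r = d + 2"
  obtains f g where "f \<in> apolar_polys \<Phi> d r" "g \<in> apolar_polys \<Phi> d r"
    "\<And>a b. smult a f + smult b g = 0 \<Longrightarrow> a = 0 \<and> b = 0"
    "\<And>h. h \<in> apolar_polys \<Phi> d r \<Longrightarrow> \<exists>a b. h = smult a f + smult b g"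
proof -
  let ?M = "\<lambda>i j. \<Phi> (monom 1 j * monom 1 i)"
  have dr: "d - r = r - 2" "r \<le> d" "d - (r - 1) = r - 1" using r by auto
  have "card {..d - r} < r + 1" using dr r by simp
  from apolar_polys_solution[OF _ this, of ?M]
  obtain f where f: "f \<noteq> 0" "degree f \<le> r" "\<forall>j\<le>d - r. (\<Sum>i\<le>r. coeff f i * ?M i j) = 0" by auto
  define i0 where "i0 = degree f"
  \<comment> \<open>The index \<open>r - 1\<close> is free, as the true equations stop at
    \<open>r - 2\<close>. Its row makes \<open>g\<close> vanish at the leading position of
    \<open>f\<close>, so that \<open>f\<close> and \<open>g\<close> are independent.\<close>
  have "card (insert (r - 1) {..d - r}) < r + 1" using dr r by simp
  from apolar_polys_solution[OF _ this, of "\<lambda>i j. if j = r - 1 then if i = i0 then 1 else 0 else ?M i j"]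
  obtain g where g: "g \<noteq> 0" "degree g \<le> r"
    "\<forall>j\<in>insert (r - 1) {..d - r}. (\<Sum>i\<le>r. coeff g i * (if j = r - 1 then if i = i0 then 1 else 0 else ?M i j)) = 0"
    by blast
  have i0: "i0 \<le> r" "coeff f i0 \<noteq> 0" using f by (auto simp: i0_def)
  have "0 = (\<Sum>i\<le>r. coeff g i * (if i = i0 then 1 else 0))" using g(3) by simp
  also have "(\<Sum>i\<le>r. coeff g i * (if i = i0 then 1 else 0)) = (\<Sum>i\<le>r. if i = i0 then coeff g i else 0)"
    by (intro sum.cong) auto
  finally have gi0: "coeff g i0 = 0" using i0 by simp
  have g3: "(\<Sum>i\<le>r. coeff g i * ?M i j) = 0" if "j \<le> d - r" for j
  proof -
    have "j \<noteq> r - 1" using that dr r by auto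
    then show ?thesis using g(3) that by (auto dest!: bspec[of _ _ j])
  qed
  have fA: "f \<in> apolar_polys \<Phi> d r" and gA: "g \<in> apolar_polys \<Phi> d r"
    using f g g3 by (auto simp: apolar_polys_monom functional_expand[of _ r])
  have indep: "a = 0 \<and> b = 0" if "smult a f + smult b g = 0" for a b
  proof -
    have "coeff (smult a f + smult b g) i0 = 0" using that by simp
    then have "a = 0" using i0 gi0 by simp
    then show ?thesis using that g by simp
  qed
  have span: "\<exists>a b. h = smult a f + smult b g" if h: "h \<in> apolar_polys \<Phi> d r" for h
  proof -
    \<comment> \<open>Two conditions on three unknowns: some combination of \<open>h\<close>,
      \<open>f\<close> and \<open>g\<close> has no coefficient in degree \<open>r\<close> and also
      passes the test by the monomial of degree \<open>r - 1\<close>. It is then apolar in degree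
      \<open>r - 1\<close>, hence zero.\<close>
    define P where "P = (\<lambda>i :: nat. if i = 0 then h else if i = 1 then f else g)"
    define M where "M = (\<lambda>i (j :: nat). if j = 0 then coeff (P i) r else \<Phi> (monom 1 (r - 1) * P i))"
    have "card {0, 1 :: nat} < card {0, 1, 2 :: nat}" by simp
    from underdetermined_system[OF _ _ this, of M]
    obtain v where v: "\<exists>i\<in>{0, 1, 2}. v i \<noteq> 0" "\<forall>j\<in>{0, 1}. (\<Sum>i\<in>{0, 1, 2}. v i * M i j) = 0" by blast
    define k where "k = smult (v 0) h + (smult (v 1) f + smult (v 2) g)"
    have kA: "k \<in> apolar_polys \<Phi> d r"
      unfolding k_def by (intro apolar_polys_add apolar_polys_smult h fA gA)
    have "coeff k r = 0" using v(2)[rule_format, of 0] by (simp add: k_def M_def P_def)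
    have k1: "\<Phi> (monom 1 (r - 1) * k) = 0" using v(2)[rule_format, of 1]
      by (simp add: k_def M_def P_def distrib_left add smult)
    have "degree k \<le> r" using kA by (simp add: apolar_polys_def)
    moreover have "degree k \<noteq> r"
    proof
      assume "degree k = r"
      with \<open>coeff k r = 0\<close> have "k = 0" by auto
      with \<open>degree k = r\<close> r show False by simp
    qed
    ultimately have "degree k \<le> r - 1" by simp
    moreover have "\<Phi> (monom 1 j * k) = 0" if "j \<le> r - 1" for j
    proof (cases "j = r - 1")
      case False
      then have "j \<le> d - r" using that dr by simp
      then show ?thesis using kA dr by (auto simp: apolar_polys_monom)
    qed (use k1 in simp)
    ultimately have "k \<in> apolar_polys \<Phi> d (r - 1)" using dr by (simp add: apolar_polys_monom)
    then have k0: "k = 0" using min by auto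
    have "v 0 \<noteq> 0"
    proof
      assume "v 0 = 0"
      with k0 have "v 1 = 0 \<and> v 2 = 0" by (intro indep) (simp add: k_def)
      with \<open>v 0 = 0\<close> v(1) show False by auto
    qed
    have "smult (v 0) h = smult (- v 1) f + smult (- v 2) g" using k0 by (simp add: k_def algebra_simps add_eq_0_iff2)
    then have "smult (1 / v 0) (smult (v 0) h) = smult (1 / v 0) (smult (- v 1) f + smult (- v 2) g)" by (rule arg_cong)
    then have "h = smult (- v 1 / v 0) f + smult (- v 2 / v 0) g" using \<open>v 0 \<noteq> 0\<close> by (simp add: smult_add_right smult_diff_right)
    then show ?thesis by blast
  qed
  show ?thesis using fA gA indep span by (rule that)
qed

end

interpretation dual: linear_functional "dual_fun d F" for d F
  by unfold_locales (rule dual_fun_add dual_fun_smult)+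

section \<open>The annihilator in dehomogenized coordinates\<close>

lemma dual_fun_shift:
  assumes "degree p \<le> k" "j + k \<le> d"
  shows "dual_fun d F (monom 1 j * p) = (\<Sum>b\<le>k. coeff p b * dweight F (d - (j + b)) (j + b))"
  unfolding dual.functional_expand[OF assms(1)]
  using assms(2) by (intro sum.cong) (auto simp: mult_monom dual_fun_monom)

lemma Ann_iff:
  assumes F: "F \<in> forms d"
  shows "\<psi> \<in> Ann F \<longleftrightarrow> (\<forall>k j. k + j \<le> d \<longrightarrow>
    (\<Sum>b\<le>k. bicoeff \<psi> (k - b) b * dweight F (d - (j + b)) (j + b)) = 0)"
proof -
  have "\<psi> \<in> Ann F \<longleftrightarrow> (\<forall>i j. dweight (apolar_action \<psi> F) i j = 0)"
    unfolding Ann_def dweight_def by (auto intro: bipoly_eqI)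
  also have "\<dots> \<longleftrightarrow> (\<forall>i j. i + j \<le> d \<longrightarrow>
      (\<Sum>b\<le>d - (i + j). bicoeff \<psi> (d - (i + j) - b) b * dweight F (d - (j + b)) (j + b)) = 0)"
    unfolding dweight_apolar_action[OF F] by auto
  also have "\<dots> \<longleftrightarrow> (\<forall>k j. k + j \<le> d \<longrightarrow>
    (\<Sum>b\<le>k. bicoeff \<psi> (k - b) b * dweight F (d - (j + b)) (j + b)) = 0)" (is "?L \<longleftrightarrow> ?R")
  proof
    assume L: ?L
    show ?R
    proof (intro allI impI)
      fix k j assume "k + j \<le> d"
      \<comment> \<open>The equation for \<open>k\<close> and \<open>j\<close> is the coefficient of
        the action with first exponent \<open>d - (k + j)\<close>.\<close>
      then have "d - (d - (k + j) + j) = k" "d - (k + j) + j \<le> d" by auto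
      then show "(\<Sum>b\<le>k. bicoeff \<psi> (k - b) b * dweight F (d - (j + b)) (j + b)) = 0"
        using L[rule_format, of "d - (k + j)" j] by simp
    qed
  next
    assume R: ?R
    show ?L
    proof (intro allI impI)
      fix i j assume "i + j \<le> d"
      then have "d - (i + j) + j \<le> d" by simp
      then show "(\<Sum>b\<le>d - (i + j). bicoeff \<psi> (d - (i + j) - b) b * dweight F (d - (j + b)) (j + b)) = 0"
        by (rule R[rule_format])
    qed
  qed
  finally show ?thesis .
qed

lemma homog_in_Ann_iff:
  assumes F: "F \<in> forms d" and p: "degree p \<le> k"
  shows "homog k p \<in> Ann F \<longleftrightarrow> p \<in> apolar_polys (dual_fun d F) d k"
proof -
  have sum: "(\<Sum>b\<le>l. bicoeff (homog k p) (l - b) b * dweight F (d - (j + b)) (j + b)) =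
      (if l = k then dual_fun d F (monom 1 j * p) else 0)" if "l + j \<le> d" for l j
  proof (cases "l = k")
    case True
    then show ?thesis using p that by (simp add: bicoeff_homog dual_fun_shift[of p k] add.commute)
  next
    case False
    then show ?thesis by (auto simp: bicoeff_homog intro!: sum.neutral)
  qed
  have "homog k p \<in> Ann F \<longleftrightarrow> (\<forall>l j. l + j \<le> d \<longrightarrow> l = k \<longrightarrow> dual_fun d F (monom 1 j * p) = 0)"
    unfolding Ann_iff[OF F] using sum by auto
  also have "\<dots> \<longleftrightarrow> p \<in> apolar_polys (dual_fun d F) d k"
    unfolding dual.apolar_polys_monom using p by auto
  finally show ?thesis .
qed

text \<open>A multiplier \<open>Q\<close> is absorbed into the test polynomial:
  \<open>q' * Q\<close> has degree at most \<open>d - r\<close>, so the apolarity of the generator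
  applies.\<close>

lemma pideal_subset_Ann_iff:
  assumes F: "F \<in> forms d" and f: "f \<in> forms r"
  shows "pideal f \<subseteq> Ann F \<longleftrightarrow> f \<in> Ann F"
proof
  assume "pideal f \<subseteq> Ann F"
  then show "f \<in> Ann F" using pideal_self by blast
next
  assume fA: "f \<in> Ann F"
  obtain g where g: "degree g \<le> r" "f = homog r g" using f by (rule forms_homogE)
  have gA: "g \<in> apolar_polys (dual_fun d F) d r" using fA homog_in_Ann_iff[OF F] g by auto
  show "pideal f \<subseteq> Ann F"
  proof
    fix p assume "p \<in> pideal f"
    then obtain q where q: "p = f * q" by (auto simp: pideal_def)
    have "hom_part k p \<in> Ann F" for k
    proof (cases "r \<le> k")
      case True
      obtain Q where Q: "degree Q \<le> k - r" "hom_part (k - r) q = homog (k - r) Q"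
        using hom_part_in_forms by (rule forms_homogE)
      have eq: "hom_part k p = homog k (g * Q)"
        using homog_mult[OF g(1) Q(1)] True hom_part_mult_form[OF f, of k q] by (simp add: q Q g(2))
      have "degree (g * Q) \<le> k" using degree_mult_le[of g Q] g Q True by linarith
      moreover have "g * Q \<in> apolar_polys (dual_fun d F) d k"
        unfolding apolar_polys_def
      proof (intro CollectI conjI impI allI)
        fix q' :: "complex poly" assume "k \<le> d" "degree q' \<le> d - k"
        then have "degree (q' * Q) \<le> d - r" using degree_mult_le[of q' Q] Q True by linarith
        then have "dual_fun d F (q' * Q * g) = 0"
          using gA \<open>k \<le> d\<close> True by (auto simp: apolar_polys_def)
        then show "dual_fun d F (q' * (g * Q)) = 0" by (simp add: mult_ac)
      qed fact
      ultimately show ?thesis unfolding eq by (simp add: homog_in_Ann_iff[OF F])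
    next
      case False
      then show ?thesis by (simp add: q hom_part_mult_form[OF f] Ann_iff[OF F])
    qed
    then have "(\<Sum>b\<le>k. bicoeff (hom_part k p) (k - b) b * dweight F (d - (j + b)) (j + b)) = 0"
      if "k + j \<le> d" for k j using that unfolding Ann_iff[OF F] by blast
    then show "p \<in> Ann F"
      by (auto simp: Ann_iff[OF F] bicoeff_hom_part)
  qed
qed

section \<open>Linear systems with polynomial coefficients\<close>

text \<open>One step of Gaussian elimination per row, kept free of denominators.\<close>

lemma eliminate_row:
  fixes m :: "nat \<Rightarrow> 'j \<Rightarrow> complex"
  assumes "(\<exists>i<n. w i \<noteq> 0) \<and> (\<forall>j\<in>J. (\<Sum>i<n. w i * (m n k * m i j - m i k * m n j)) = 0)"
    and "m n k \<noteq> 0"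
  shows "\<exists>v. (\<exists>i<Suc n. v i \<noteq> 0) \<and> (\<forall>j\<in>J. (\<Sum>i<Suc n. v i * m i j) = 0)"
proof -
  define v where "v = (\<lambda>i. if i < n then m n k * w i else - (\<Sum>i<n. w i * m i k))"
  have "(\<Sum>i<Suc n. v i * m i j) = (\<Sum>i<n. w i * (m n k * m i j - m i k * m n j))" for j
    by (simp add: v_def right_diff_distrib sum_subtractf sum_distrib_right sum_distrib_left algebra_simps)
  moreover have "\<exists>i<Suc n. v i \<noteq> 0" using assms by (auto simp: v_def)
  ultimately show ?thesis using assms(1) by (intro exI[of _ v]) simp
qed

text \<open>The product of the pivots found at \<open>x0\<close> takes the place of a nonzero
  maximal minor; elimination without division keeps it polynomial in the entries.\<close>

lemma rank_certificate:
  fixes m :: "nat \<Rightarrow> 'j \<Rightarrow> 'b \<Rightarrow> complex"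
  assumes "\<And>i j. m i j \<in> poly_funs C"
    and "\<not> (\<exists>v. (\<exists>i<n. v i \<noteq> 0) \<and> (\<forall>j\<in>J. (\<Sum>i<n. v i * m i j x0) = 0))"
  shows "\<exists>p\<in>poly_funs C. p x0 \<noteq> 0 \<and>
    (\<forall>x. (\<exists>v. (\<exists>i<n. v i \<noteq> 0) \<and> (\<forall>j\<in>J. (\<Sum>i<n. v i * m i j x) = 0)) \<longrightarrow> p x = 0)"
  using assms
proof (induction n arbitrary: m)
  case 0
  show ?case by (intro bexI[of _ "\<lambda>_. 1"]) (auto intro: poly_funs.const)
next
  case (Suc n)
  have "\<exists>k\<in>J. m n k x0 \<noteq> 0"
  proof (rule ccontr)
    assume row: "\<not> (\<exists>k\<in>J. m n k x0 \<noteq> 0)"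
    define e :: "nat \<Rightarrow> complex" where "e i = (if i = n then 1 else 0)" for i
    have "e n \<noteq> 0" by (simp add: e_def)
    then have "\<exists>i<Suc n. e i \<noteq> 0" using lessI by metis
    moreover have "\<forall>j\<in>J. (\<Sum>i<Suc n. e i * m i j x0) = 0"
    proof
      fix j assume "j \<in> J"
      with row have "m n j x0 = 0" by metis
      then show "(\<Sum>i<Suc n. e i * m i j x0) = 0" by (simp add: e_def)
    qed
    ultimately show False using Suc.prems(2) by metis
  qed
  then obtain k where k: "k \<in> J" "m n k x0 \<noteq> 0" by blast
  define m' where "m' = (\<lambda>i j x. m n k x * m i j x - m i k x * m n j x)"
  have "m' i j \<in> poly_funs C" for i j
  proof -
    have "(\<lambda>x. m n k x * m i j x + (- 1) * (m i k x * m n j x)) \<in> poly_funs C"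
      by (intro poly_funs.add poly_funs.mult poly_funs.const Suc.prems)
    then show ?thesis by (simp add: m'_def)
  qed
  moreover have "\<not> (\<exists>v. (\<exists>i<n. v i \<noteq> 0) \<and> (\<forall>j\<in>J. (\<Sum>i<n. v i * m' i j x0) = 0))"
  proof
    assume "\<exists>v. (\<exists>i<n. v i \<noteq> 0) \<and> (\<forall>j\<in>J. (\<Sum>i<n. v i * m' i j x0) = 0)"
    then obtain w where "(\<exists>i<n. w i \<noteq> 0) \<and> (\<forall>j\<in>J. (\<Sum>i<n. w i * (m n k x0 * m i j x0 - m i k x0 * m n j x0)) = 0)"
      unfolding m'_def by (elim exE)
    from Suc.prems(2) eliminate_row[of n w J "\<lambda>i j. m i j x0" k, OF this k(2)] show False by (rule notE)
  qed
  ultimately obtain p where p: "p \<in> poly_funs C" "p x0 \<noteq> 0"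
    "\<And>x v. \<exists>i<n. v i \<noteq> 0 \<Longrightarrow> \<forall>j\<in>J. (\<Sum>i<n. v i * m' i j x) = 0 \<Longrightarrow> p x = 0"
    using Suc.IH[of m'] by blast
  \<comment> \<open>Where the pivot vanishes the product does too. Elsewhere the relation survives
    elimination, since column \<open>k\<close> prevents it from involving row \<open>n\<close>
    alone.\<close>
  have "p x * m n k x = 0" if v: "\<exists>i<Suc n. v i \<noteq> 0" "\<forall>j\<in>J. (\<Sum>i<Suc n. v i * m i j x) = 0" for x v
  proof (cases "m n k x = 0")
    case False
    have eq: "(\<Sum>i<n. v i * m i j x) = - (v n * m n j x)" if "j \<in> J" for j
      using v(2) that by (auto simp: add_eq_0_iff2)
    have "(\<Sum>i<n. v i * m' i j x) = 0" if "j \<in> J" for j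
    proof -
      have "(\<Sum>i<n. v i * m' i j x) = m n k x * (\<Sum>i<n. v i * m i j x) - (\<Sum>i<n. v i * m i k x) * m n j x"
        by (simp add: m'_def right_diff_distrib sum_subtractf sum_distrib_right sum_distrib_left algebra_simps)
      then show ?thesis unfolding eq[OF that] eq[OF k(1)] by (simp add: algebra_simps)
    qed
    moreover have "\<exists>i<n. v i \<noteq> 0"
    proof (rule ccontr)
      assume *: "\<not> (\<exists>i<n. v i \<noteq> 0)"
      then have "(\<Sum>i<n. v i * m i k x) = 0" by (intro sum.neutral) auto
      with eq[OF k(1)] False have "v n = 0" by simp
      with * v(1) show False by (auto simp: less_Suc_eq)
    qed
    ultimately show ?thesis using p(3) by simp
  qed simp
  moreover have "(\<lambda>x. p x * m n k x) \<in> poly_funs C" by (intro poly_funs.mult p Suc.prems)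
  ultimately show ?case using p(2) k by (intro bexI[of _ "\<lambda>x. p x * m n k x"]) auto
qed

text \<open>Independent rows at \<open>t = 0\<close> keep the rank maximal for almost all
  \<open>t\<close>, so a kernel vector extends to a curve of kernel vectors. Avoiding denominators
  costs the factor \<open>c\<close>, the product of the pivots at 0.\<close>

lemma solution_curve:
  fixes m :: "nat \<Rightarrow> 'j \<Rightarrow> complex \<Rightarrow> complex"
  assumes "finite J" "\<And>i j. is_poly (m i j)"
    and "\<not> (\<exists>v. (\<exists>i<n. v i \<noteq> 0) \<and> (\<forall>j\<in>J. (\<Sum>i<n. v i * m i j 0) = 0))"
    and "\<And>i. i < n \<Longrightarrow> (\<Sum>j\<in>J. m i j 0 * x0 j) = 0"
  shows "\<exists>x c. c \<noteq> 0 \<and> (\<forall>j. is_poly (x j)) \<and> (\<forall>j. x j 0 = c * x0 j) \<and>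
    (\<forall>i<n. \<forall>t. (\<Sum>j\<in>J. m i j t * x j t) = 0)"
  using assms(2-)
proof (induction n arbitrary: m)
  case 0
  show ?case by (intro exI[of _ "\<lambda>j t. x0 j"] exI[of _ 1]) (auto intro: is_poly_const)
next
  case (Suc n)
  have "\<exists>k\<in>J. m n k 0 \<noteq> 0"
  proof (rule ccontr)
    assume row: "\<not> (\<exists>k\<in>J. m n k 0 \<noteq> 0)"
    define e :: "nat \<Rightarrow> complex" where "e i = (if i = n then 1 else 0)" for i
    have "e n \<noteq> 0" by (simp add: e_def)
    then have "\<exists>i<Suc n. e i \<noteq> 0" using lessI by metis
    moreover have "\<forall>j\<in>J. (\<Sum>i<Suc n. e i * m i j 0) = 0"
    proof
      fix j assume "j \<in> J"
      with row have "m n j 0 = 0" by metis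
      then show "(\<Sum>i<Suc n. e i * m i j 0) = 0" by (simp add: e_def)
    qed
    ultimately show False using Suc.prems(2) by metis
  qed
  then obtain k where k: "k \<in> J" "m n k 0 \<noteq> 0" by blast
  define m' where "m' = (\<lambda>i j t. m n k t * m i j t - m i k t * m n j t)"
  have "is_poly (m' i j)" for i j
  proof -
    have "is_poly (\<lambda>t. m n k t * m i j t + (- 1) * (m i k t * m n j t))"
      by (intro is_poly_add is_poly_mult is_poly_const Suc.prems)
    then show ?thesis by (simp add: m'_def)
  qed
  moreover have "\<not> (\<exists>v. (\<exists>i<n. v i \<noteq> 0) \<and> (\<forall>j\<in>J. (\<Sum>i<n. v i * m' i j 0) = 0))"
  proof
    assume "\<exists>v. (\<exists>i<n. v i \<noteq> 0) \<and> (\<forall>j\<in>J. (\<Sum>i<n. v i * m' i j 0) = 0)"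
    then obtain w where "(\<exists>i<n. w i \<noteq> 0) \<and> (\<forall>j\<in>J. (\<Sum>i<n. w i * (m n k 0 * m i j 0 - m i k 0 * m n j 0)) = 0)"
      unfolding m'_def by (elim exE)
    from Suc.prems(2) eliminate_row[of n w J "\<lambda>i j. m i j 0" k, OF this k(2)] show False by (rule notE)
  qed
  moreover have "(\<Sum>j\<in>J. m' i j 0 * x0 j) = 0" if "i < n" for i
  proof -
    have "(\<Sum>j\<in>J. m' i j 0 * x0 j) = m n k 0 * (\<Sum>j\<in>J. m i j 0 * x0 j) - m i k 0 * (\<Sum>j\<in>J. m n j 0 * x0 j)"
      by (simp add: m'_def left_diff_distrib sum_subtractf sum_distrib_left mult.assoc)
    then show ?thesis using Suc.prems(3)[of i] Suc.prems(3)[of n] that by simp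
  qed
  ultimately obtain x c where x: "c \<noteq> 0" "\<And>j. is_poly (x j)" "\<And>j. x j 0 = c * x0 j"
    "\<And>i t. i < n \<Longrightarrow> (\<Sum>j\<in>J. m' i j t * x j t) = 0"
    using Suc.IH[of m'] by blast
  define s where "s = (\<lambda>t. (\<Sum>j\<in>J - {k}. m n j t * x j t))"
  \<comment> \<open>Row \<open>n\<close> is solved for coordinate \<open>k\<close>, the others being
    scaled by the pivot. Discarding \<open>x k\<close> is harmless, because column \<open>k\<close>
    of \<open>m'\<close> is zero.\<close>
  define y where "y = (\<lambda>j t. if j = k then - s t else m n k t * x j t)"
  have split: "(\<Sum>j\<in>J. m i j t * y j t) = m n k t * (\<Sum>j\<in>J - {k}. m i j t * x j t) - m i k t * s t" for i t
  proof -
    have "(\<Sum>j\<in>J. m i j t * y j t) = m i k t * y k t + (\<Sum>j\<in>J - {k}. m i j t * y j t)"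
      using assms(1) k(1) by (rule sum.remove)
    also have "(\<Sum>j\<in>J - {k}. m i j t * y j t) = m n k t * (\<Sum>j\<in>J - {k}. m i j t * x j t)"
      unfolding sum_distrib_left by (intro sum.cong) (auto simp: y_def)
    finally show ?thesis by (simp add: y_def)
  qed
  have "(\<Sum>j\<in>J. m i j t * y j t) = 0" if i: "i < Suc n" for i t
  proof (cases "i = n")
    case True
    then show ?thesis unfolding split by (simp add: s_def)
  next
    case False
    have "0 = (\<Sum>j\<in>J. m' i j t * x j t)" using x(4) False i by simp
    also have "\<dots> = (\<Sum>j\<in>J - {k}. m' i j t * x j t)"
      using assms(1) k(1) by (simp add: sum.remove[of J k]) (simp add: m'_def)
    also have "\<dots> = m n k t * (\<Sum>j\<in>J - {k}. m i j t * x j t) - m i k t * s t"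
      by (simp add: m'_def s_def left_diff_distrib sum_subtractf sum_distrib_left mult.assoc)
    finally show ?thesis unfolding split by simp
  qed
  moreover have "is_poly (y j)" for j
  proof (cases "j = k")
    case True
    have "is_poly (\<lambda>t. (- 1) * s t)" unfolding s_def
      by (intro is_poly_mult is_poly_const is_poly_sum Suc.prems x)
    then show ?thesis using True by (simp add: y_def)
  next
    case False
    then show ?thesis using is_poly_mult[OF Suc.prems(1)[of n k] x(2)[of j]] by (simp add: y_def)
  qed
  moreover have "y j 0 = (m n k 0 * c) * x0 j" for j
  proof (cases "j = k")
    case True
    have "(\<Sum>j\<in>J. m n j 0 * x0 j) = 0" using Suc.prems(3) by simp
    then have "m n k 0 * x0 k + (\<Sum>j\<in>J - {k}. m n j 0 * x0 j) = 0"
      using assms(1) k(1) by (simp add: sum.remove[of J k])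
    moreover have "s 0 = c * (\<Sum>j\<in>J - {k}. m n j 0 * x0 j)"
      by (simp add: s_def x(3) sum_distrib_left mult.left_commute)
    ultimately have "y k 0 = c * (m n k 0 * x0 k)"
      by (simp add: y_def add_eq_0_iff2)
    then show ?thesis using True by simp
  qed (simp add: y_def x(3))
  ultimately show ?case using x(1) k(2)
    by (intro exI[of _ y] exI[of _ "m n k 0 * c"]) auto
qed


section \<open>Border rank\<close>

lemma dweight_cscale: "dweight (cscale c F) i j = c * dweight F i j"
  and dweight_add: "dweight (F + H) i j = dweight F i j + dweight H i j"
  and dweight_sum: "dweight (\<Sum>a\<in>A. f a) i j = (\<Sum>a\<in>A. dweight (f a) i j)"
  by (simp_all add: dweight_def algebra_simps sum_distrib_left)

lemma dual_fun_cscale: "dual_fun d (cscale c F) p = c * dual_fun d F p"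
  and dual_fun_plus: "dual_fun d (F + H) p = dual_fun d F p + dual_fun d H p"
  by (simp_all add: dual_fun_def dweight_cscale dweight_add sum_distrib_left sum.distrib algebra_simps)

lemma dual_fun_form_sum: "dual_fun d (\<Sum>a\<in>A. f a) p = (\<Sum>a\<in>A. dual_fun d (f a) p)"
  unfolding dual_fun_def dweight_sum sum_distrib_left by (rule sum.swap)

lemma dual_fun_0 [simp]: "dual_fun d 0 p = 0"
  by (simp add: dual_fun_def dweight_def)

lemma form_eq_dual_funI:
  assumes "F \<in> forms d" "H \<in> forms d" "\<And>p. degree p \<le> d \<Longrightarrow> dual_fun d F p = dual_fun d H p"
  shows "F = H"
proof (rule bipoly_eqI)
  fix i j
  show "bicoeff F i j = bicoeff H i j"
  proof (cases "i + j = d")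
    case True
    then have "dual_fun d F (monom 1 j) = dual_fun d H (monom 1 j)"
      by (intro assms(3)) (simp add: degree_monom_eq)
    then have "dweight F (d - j) j = dweight H (d - j) j" using True by (simp add: dual_fun_monom)
    moreover have "d - j = i" using True by simp
    ultimately show ?thesis by (simp add: dweight_def)
  next
    case False
    then have "bicoeff F i j = 0" "bicoeff H i j = 0" using assms(1,2) by (auto simp: forms_def)
    then show ?thesis by simp
  qed
qed

section \<open>Powers of linear forms and the apolarity lemma\<close>

lemma linear_form_power: "linear_form a ^ d = homog d ([:a $ 1, a $ 2:] ^ d)"
proof (induction d)
  case 0
  show ?case
    by (rule bipoly_eqI) (auto simp: bicoeff_homog, auto simp: bicoeff_def coeff_pCons one_pCons split: nat.splits)
next
  case (Suc d)
  have lf: "linear_form a = homog 1 [:a $ 1, a $ 2:]"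
    by (rule bipoly_eqI) (auto simp: bicoeff_homog, auto simp: linear_form_def bicoeff_def coeff_pCons split: nat.splits)
  have "degree ([:a $ 1, a $ 2:] ^ d) \<le> d"
    using degree_power_le[of "[:a $ 1, a $ 2:]" d] by (auto intro: order.trans)
  then have "homog 1 [:a $ 1, a $ 2:] * homog d ([:a $ 1, a $ 2:] ^ d) = homog (Suc d) ([:a $ 1, a $ 2:] ^ Suc d)"
    by (subst homog_mult) auto
  then show ?case unfolding power_Suc[of "linear_form a"] Suc by (simp only: lf)
qed

text \<open>The factorials in \<open>dweight\<close> turn the binomial coefficients of the power
  into the constant \<open>fact d\<close>. Pairing with a power thus amounts to evaluation, the link
  between points and sums of powers.\<close>

lemma dual_fun_linear_form_power:
  "dual_fun d (linear_form a ^ d) p = fact d * eval_at (homog d p) a"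
proof -
  have "dweight (linear_form a ^ d) (d - n) n = fact d * ((a $ 1) ^ (d - n) * (a $ 2) ^ n)" if "n \<le> d" for n
    using that by (simp add: dweight_def linear_form_power bicoeff_homog coeff_linear_poly_power binomial_fact)
  then show ?thesis unfolding dual_fun_def eval_at_homog sum_distrib_left
    by (intro sum.cong) auto
qed

lemma linear_form_power_in_forms [simp]: "linear_form a ^ d \<in> forms d"
  by (simp add: linear_form_power)

lemma forms_prod: "finite A \<Longrightarrow> (\<And>i. i \<in> A \<Longrightarrow> f i \<in> forms 1) \<Longrightarrow> (\<Prod>i\<in>A. f i) \<in> forms (card A)"
proof (induction A rule: finite_induct)
  case empty
  then show ?case using points_form_in_forms[of 0] by (simp add: points_form_def)
next
  case (insert x A)
  then show ?case using forms_mult[of "f x" 1 "\<Prod>i\<in>A. f i" "card A"] by simp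
qed

lemma exists_interpolation_form:
  assumes "distinct_points n a" "n \<le> d" "i < n"
  shows "\<exists>f\<in>forms d. \<forall>j<n. eval_at f (a j) = (if j = i then 1 else 0)"
proof -
  \<comment> \<open>An auxiliary linear form that does not vanish at \<open>a i\<close>; its powers
    fill up the \<open>n - 1\<close> factors vanishing at the other points to degree
    \<open>d\<close>.\<close>
  obtain b where b: "eval_at (perp b) (a i) \<noteq> 0"
  proof (cases "a i $ 1 = 0")
    case True
    then have "a i $ 2 \<noteq> 0" using assms by (auto simp: distinct_points_def vec_eq_iff forall_2)
    then show ?thesis by (intro that[of "vector [1, 0]"]) (simp add: eval_at_perp)
  next
    case False
    then show ?thesis by (intro that[of "vector [0, 1]"]) (simp add: eval_at_perp)
  qed
  define f where "f = (\<Prod>j\<in>{..<n} - {i}. perp (a j)) * (\<Prod>j\<in>{..<d + 1 - n}. perp b)"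
  have "f \<in> forms (card ({..<n} - {i}) + card {..<d + 1 - n})"
    unfolding f_def by (intro forms_mult forms_prod perp_in_forms) auto
  moreover have "card ({..<n} - {i}) + card {..<d + 1 - n} = d" using assms by simp
  ultimately have f: "f \<in> forms d" by simp
  have fi: "eval_at f (a i) \<noteq> 0"
    using assms b by (auto simp: f_def eval_at_mult eval_at_prod eval_at_power distinct_points_def)
  have fj: "eval_at f (a j) = 0" if "j < n" "j \<noteq> i" for j
    using that by (auto simp: f_def eval_at_mult eval_at_prod intro!: bexI[of _ j])
  show ?thesis
    using f fi fj by (intro bexI[of _ "cscale (1 / eval_at f (a i)) f"]) (auto simp: eval_at_cscale forms_cscale)
qed

text \<open>A polynomial of degree at most \<open>d\<close> differs from its interpolant at the
  points by a multiple of \<open>P\<close>, which the functional of \<open>H\<close> kills. That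
  functional is therefore a combination of evaluations, and these belong to powers of linear
  forms.\<close>

lemma apolarity:
  assumes a: "distinct_points n a" and n: "n \<le> d" and H: "H \<in> forms d"
    and P: "points_form n a = homog n P" "P \<in> apolar_polys (dual_fun d H) d n"
  shows "H \<in> CV.span ((\<lambda>i. linear_form (a i) ^ d) ` {..<n})"
proof -
  have "\<exists>l. degree l \<le> d \<and> (\<forall>j<n. eval_at (homog d l) (a j) = (if j = i then 1 else 0))" if "i < n" for i
    using exists_interpolation_form[OF a n that] by (auto elim!: forms_homogE)
  then obtain l where l: "\<And>i. i < n \<Longrightarrow> degree (l i) \<le> d"
    "\<And>i j. i < n \<Longrightarrow> j < n \<Longrightarrow> eval_at (homog d (l i)) (a j) = (if j = i then 1 else 0)" by metis
  have expand: "dual_fun d H p = (\<Sum>i<n. eval_at (homog d p) (a i) * dual_fun d H (l i))" if p: "degree p \<le> d" for p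
  proof -
    define e where "e = (\<lambda>i. eval_at (homog d p) (a i))"
    define u where "u = p - (\<Sum>i<n. smult (e i) (l i))"
    have du: "degree u \<le> d" unfolding u_def
      by (intro degree_diff_le p degree_sum_le) (auto intro: order.trans[OF degree_smult_le] l(1))
    have "eval_at (homog d u) (a j) = 0" if "j < n" for j
    proof -
      have "(\<Sum>i<n. e i * eval_at (homog d (l i)) (a j)) = (\<Sum>i<n. if i = j then e j else 0)"
        using l(2) that by (intro sum.cong) auto
      then show ?thesis using that
        by (simp add: u_def homog_diff homog_sum homog_smult eval_at_diff eval_at_sum eval_at_cscale e_def)
    qed
    then obtain q where q: "q \<in> forms (d - n)" "homog d u = points_form n a * q"
      using points_form_dvd[OF a homog_in_forms[of d u]] by blast
    from q(1) obtain Q where Q: "degree Q \<le> d - n" "q = homog (d - n) Q" by (rule forms_homogE)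
    have dP: "degree P \<le> n" using P(2) by (simp add: apolar_polys_def)
    have "homog d u = homog d (P * Q)" using q Q P(1) homog_mult[OF dP Q(1)] n by simp
    moreover have "degree (P * Q) \<le> d" using degree_mult_le[of P Q] dP Q n by linarith
    ultimately have "u = Q * P" using du by (simp add: homog_inject mult.commute)
    then have "dual_fun d H u = 0" using P(2) n Q by (simp add: apolar_polys_def)
    moreover have "p = u + (\<Sum>i<n. smult (e i) (l i))" by (simp add: u_def)
    then have "dual_fun d H p = dual_fun d H (u + (\<Sum>i<n. smult (e i) (l i)))" by (rule arg_cong)
    then have "dual_fun d H p = dual_fun d H u + (\<Sum>i<n. e i * dual_fun d H (l i))"
      by (simp add: dual_fun_add dual.sum dual_fun_smult)
    ultimately show ?thesis by (simp add: e_def)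
  qed
  have "H = (\<Sum>i<n. cscale (dual_fun d H (l i) / fact d) (linear_form (a i) ^ d))"
  proof (rule form_eq_dual_funI[OF H])
    show "(\<Sum>i<n. cscale (dual_fun d H (l i) / fact d) (linear_form (a i) ^ d)) \<in> forms d"
      by (intro CV.subspace_sum subspace_forms forms_cscale) simp
    show "dual_fun d H p = dual_fun d (\<Sum>i<n. cscale (dual_fun d H (l i) / fact d) (linear_form (a i) ^ d)) p"
      if "degree p \<le> d" for p
      by (simp add: expand[OF that] dual_fun_form_sum dual_fun_cscale dual_fun_linear_form_power mult.commute)
  qed
  also have "\<dots> \<in> CV.span ((\<lambda>i. linear_form (a i) ^ d) ` {..<n})"
    by (intro CV.span_sum CV.span_scale CV.span_base) auto
  finally show ?thesis .
qed

section \<open>Secant varieties and apolar forms\<close>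

lemma points_proj_forms: "points (proj_forms d) = {CV.span {F} | F. F \<in> forms d \<and> F \<noteq> 0}"
proof (intro equalityI subsetI)
  fix L assume "L \<in> points (proj_forms d)"
  then have L: "CV.subspace L" "L \<subseteq> forms d" "CV.dim L = 1" by (auto simp: proj_forms_def)
  obtain B where B: "B \<subseteq> L" "CV.independent B" "L \<subseteq> CV.span B" "card B = CV.dim L"
    by (rule CV.basis_exists)
  then obtain F where F: "B = {F}" using L by (auto simp: card_Suc_eq)
  then have "F \<noteq> 0" using B(2) by auto
  moreover have "L = CV.span B" using B L CV.span_minimal by blast
  ultimately show "L \<in> {CV.span {F} | F. F \<in> forms d \<and> F \<noteq> 0}" using F B L by auto
next
  fix L assume "L \<in> {CV.span {F} | F. F \<in> forms d \<and> F \<noteq> 0}"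
  then obtain F where F: "F \<in> forms d" "F \<noteq> 0" "L = CV.span {F}" by auto
  then have "CV.dim L = 1" using CV.dim_span_eq_card_independent[of "{F}"] by simp
  moreover have "L \<subseteq> forms d" using F CV.span_minimal[OF _ subspace_forms] by auto
  ultimately show "L \<in> points (proj_forms d)" using F by (simp add: proj_forms_def CV.subspace_span)
qed

lemma dual_fun_poly_fun: "(\<lambda>F. dual_fun d F p) \<in> poly_funs (coords (proj_forms d))"
proof -
  have "(\<lambda>F. bicoeff F i j) \<in> poly_funs (coords (proj_forms d))" for i j
    by (rule poly_funs.coord) (auto simp: proj_forms_def)
  then show ?thesis unfolding dual_fun_def dweight_def
    by (intro poly_funs_sum poly_funs.mult poly_funs.const)
qed

text \<open>The product of the \<open>perp (b i)\<close> vanishes on every line involved and so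
  kills all the powers; coincidences among the lines do no harm.\<close>

lemma apolar_to_powers:
  assumes "s \<le> d" "\<And>i. i < s \<Longrightarrow> b i \<noteq> 0" "H \<in> CV.span (\<Union>i<s. (\<lambda>a. linear_form a ^ d) ` line_of (b i))"
  shows "\<exists>P\<in>apolar_polys (dual_fun d H) d s. P \<noteq> 0"
proof -
  obtain P where P: "degree P \<le> s" "points_form s b = homog s P"
    using points_form_in_forms by (rule forms_homogE)
  have "points_form s b \<noteq> 0" using assms(2) by (simp add: points_form_def perp_eq_0_iff)
  then have "P \<noteq> 0" using P by auto
  have "CV.span (\<Union>i<s. (\<lambda>a. linear_form a ^ d) ` line_of (b i)) \<subseteq>
    {H. \<forall>q. degree q \<le> d - s \<longrightarrow> dual_fun d H (q * P) = 0}"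
  proof (rule CV.span_minimal, rule subsetI)
    show "CV.subspace {H. \<forall>q. degree q \<le> d - s \<longrightarrow> dual_fun d H (q * P) = 0}"
      by (rule CV.subspaceI) (auto simp: dual_fun_plus dual_fun_cscale)
    fix G assume "G \<in> (\<Union>i<s. (\<lambda>a. linear_form a ^ d) ` line_of (b i))"
    then obtain i c where i: "i < s" "G = linear_form (c *s b i) ^ d" by (auto simp: line_of_def)
    have "dual_fun d G (q * P) = 0" if "degree q \<le> d - s" for q
    proof -
      have "homog d (q * P) = homog (d - s) q * points_form s b"
        using homog_mult[OF that P(1)] assms(1) by (simp add: P(2))
      then show ?thesis unfolding i dual_fun_linear_form_power
        by (simp add: eval_at_mult eval_at_form_scale[OF points_form_in_forms] eval_at_points_form[OF i(1)])
    qed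
    then show "G \<in> {H. \<forall>q. degree q \<le> d - s \<longrightarrow> dual_fun d H (q * P) = 0}" by blast
  qed
  then show ?thesis using P \<open>P \<noteq> 0\<close> assms(3) by (intro bexI[of _ P]) (auto simp: apolar_polys_def)
qed

text \<open>Having no nonzero apolar polynomial of degree \<open>s\<close> means independence of
  catalecticant rows, an open condition. If it held at \<open>F\<close>, it would hold for some
  combination of \<open>s\<close> powers, all of which violate it.\<close>

lemma secant_variety_apolar:
  assumes F: "F \<in> forms d" "F \<noteq> 0" and sec: "CV.span {F} \<in> secant_variety d s"
  shows "\<exists>p\<in>apolar_polys (dual_fun d F) d s. p \<noteq> 0"
proof (rule ccontr)
  assume nF: "\<not> ?thesis"
  have s: "s \<le> d"
  proof (rule ccontr)
    assume "\<not> s \<le> d"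
    then have "1 \<in> apolar_polys (dual_fun d F) d s" by (simp add: apolar_polys_def)
    with nF show False by auto
  qed
  define good where "good = (\<lambda>H. \<not> (\<exists>p\<in>apolar_polys (dual_fun d H) d s. p \<noteq> 0))"
  define C where "C = coords (proj_forms d)"
  define U where "U = {L \<in> points (proj_forms d). \<forall>H\<in>L - {0}. good H}"
  \<comment> \<open>Taking every polynomial function that vanishes on the bad forms avoids a list of
    minors; the certificates show that some member is nonzero at any given good form.\<close>
  define E where "E = {p \<in> poly_funs C. \<forall>H. \<not> good H \<longrightarrow> p H = 0}"
  have good_scale: "good (cscale c H) \<longleftrightarrow> good H" if "c \<noteq> 0" for c H
    using that by (simp add: good_def apolar_polys_def dual_fun_cscale)
  have good_span: "good H'" if H: "good H" "H' \<in> CV.span {H} - {0}" for H H'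
  proof -
    obtain c where c: "H' = cscale c H" using H(2) by (auto simp: CV.span_singleton)
    with H have "c \<noteq> 0" by auto
    then show ?thesis using H(1) by (simp add: c good_scale)
  qed
  have cert: "\<exists>p\<in>E. p H \<noteq> 0" if "good H" for H
  proof -
    let ?m = "\<lambda>i j H. dual_fun d H (monom 1 j * monom 1 i)"
    have bad_iff: "good H \<longleftrightarrow> \<not> (\<exists>v. (\<exists>i<Suc s. v i \<noteq> 0) \<and> (\<forall>j\<in>{..d - s}. (\<Sum>i<Suc s. v i * ?m i j H) = 0))" for H
    proof -
      have "(\<exists>p\<in>apolar_polys (dual_fun d H) d s. p \<noteq> 0) \<longleftrightarrow>
        (\<exists>v. (\<exists>i<Suc s. v i \<noteq> 0) \<and> (\<forall>j\<in>{..d - s}. (\<Sum>i<Suc s. v i * ?m i j H) = 0))" (is "?A \<longleftrightarrow> ?B")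
      proof
        assume ?A
        then obtain p where p: "p \<in> apolar_polys (dual_fun d H) d s" "p \<noteq> 0" by blast
        then have dp: "degree p \<le> s" by (simp add: apolar_polys_def)
        have "\<exists>i<Suc s. coeff p i \<noteq> 0" using p(2) dp by (intro exI[of _ "degree p"]) auto
        moreover have "\<forall>j\<in>{..d - s}. (\<Sum>i<Suc s. coeff p i * ?m i j H) = 0"
          using p(1) s by (simp only: dual.apolar_polys_monom dual.functional_expand[OF dp] lessThan_Suc_atMost) simp
        ultimately show ?B by blast
      next
        assume ?B
        then obtain v where v: "\<exists>i<Suc s. v i \<noteq> 0" "\<forall>j\<in>{..d - s}. (\<Sum>i\<le>s. v i * ?m i j H) = 0"
          unfolding lessThan_Suc_atMost by blast
        define p where "p = (\<Sum>i\<le>s. monom (v i) i)"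
        have c: "coeff p i = (if i \<le> s then v i else 0)" for i by (simp add: p_def coeff_sum)
        have dp: "degree p \<le> s" by (rule degree_le) (simp add: c)
        have "p \<noteq> 0" using v(1) by (metis c coeff_0 less_Suc_eq_le)
        moreover have "p \<in> apolar_polys (dual_fun d H) d s"
          using v(2) dp by (simp add: dual.apolar_polys_monom dual.functional_expand[OF dp] c)
        ultimately show ?A by blast
      qed
      then show ?thesis unfolding good_def by (simp only:)
    qed
    from rank_certificate[of ?m C "Suc s" "{..d - s}" H] bad_iff[of H] that
    obtain p where p: "p \<in> poly_funs C" "p H \<noteq> 0"
      "\<forall>x. (\<exists>v. (\<exists>i<Suc s. v i \<noteq> 0) \<and> (\<forall>j\<in>{..d - s}. (\<Sum>i<Suc s. v i * ?m i j x) = 0)) \<longrightarrow> p x = 0"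
      by (auto simp: C_def dual_fun_poly_fun)
    have "p x = 0" if "\<not> good x" for x
      by (rule mp[OF spec[OF p(3)] that[unfolded bad_iff not_not]])
    with p(1,2) show ?thesis by (intro bexI[of _ p]) (auto simp: E_def)
  qed
  have "zariski_open (proj_forms d) U"
  proof (rule zariski_openI)
    show "U \<subseteq> points (proj_forms d)" "E \<subseteq> poly_funs (coords (proj_forms d))"
      by (auto simp: U_def E_def C_def)
    fix L b assume L: "L \<in> points (proj_forms d)" "b \<in> reps (proj_forms d) L"
    then have b: "b \<in> L" "b \<noteq> 0" by (auto simp: proj_forms_def)
    from L(1) obtain H where H: "L = CV.span {H}" "H \<in> forms d" "H \<noteq> 0" by (auto simp: points_proj_forms)
    obtain c where c: "b = cscale c H" using b(1) H(1) by (auto simp: CV.span_singleton)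
    with b have "c \<noteq> 0" by auto
    then have gb: "good b \<longleftrightarrow> good H" by (simp add: c good_scale)
    have "L \<in> U \<longleftrightarrow> good b"
    proof
      assume "L \<in> U" then show "good b" using b by (auto simp: U_def)
    next
      assume "good b"
      then show "L \<in> U" using L(1) good_span[of H] gb H(1) by (auto simp: U_def)
    qed
    also have "\<dots> \<longleftrightarrow> (\<exists>p\<in>E. p b \<noteq> 0)" using cert by (auto simp: E_def)
    finally show "L \<in> U \<longleftrightarrow> (\<exists>p\<in>E. p b \<noteq> 0)" .
  qed
  moreover have "CV.span {F} \<in> U"
  proof -
    have "good F" using nF by (simp add: good_def)
    then show ?thesis using good_span[of F] F by (auto simp: U_def points_proj_forms)
  qed
  ultimately obtain L \<Gamma> where L: "L \<in> U" "\<Gamma> \<subseteq> points P1" "finite \<Gamma>" "card \<Gamma> = s"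
    "L \<subseteq> CV.span (\<Union>(veronese d ` \<Gamma>))"
  proof -
    assume *: "zariski_open (proj_forms d) U" "CV.span {F} \<in> U"
    from sec have "\<forall>T. CV.span {F} \<in> T \<and> zariski_open (proj_forms d) T \<longrightarrow>
        (\<exists>L. L \<in> {L \<in> points (proj_forms d). \<exists>\<Gamma>\<subseteq>points P1. finite \<Gamma> \<and> card \<Gamma> = s \<and> L \<subseteq> CV.span (\<Union>(veronese d ` \<Gamma>))} \<and> L \<in> T)"
      unfolding secant_variety_def in_closure_of openin_zariski by (rule conjunct2)
    with * show ?thesis using that by (elim allE[of _ U]) auto
  qed
  obtain H where H: "H \<in> L" "H \<noteq> 0"
  proof -
    from L(1) obtain H where "L = CV.span {H}" "H \<noteq> 0" by (auto simp: U_def points_proj_forms)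
    then show ?thesis using CV.span_base[of H "{H}"] that by auto
  qed
  obtain h where h: "bij_betw h {0..<s} \<Gamma>" using ex_bij_betw_nat_finite L(3,4) by metis
  have "h i \<in> points P1" if "i < s" for i using bij_betwE[OF h] that L(2) by auto
  then have "\<forall>i<s. \<exists>b. b \<noteq> 0 \<and> h i = line_of b"
    unfolding points_P1_line_of by blast
  then obtain b where b: "\<And>i. i < s \<Longrightarrow> b i \<noteq> 0" "\<And>i. i < s \<Longrightarrow> h i = line_of (b i)" by metis
  let ?W = "\<Union>i<s. (\<lambda>a. linear_form a ^ d) ` line_of (b i)"
  have "\<Gamma> = h ` {..<s}" using h by (simp add: bij_betw_def atLeast0LessThan)
  then have "\<Union>(veronese d ` \<Gamma>) \<subseteq> CV.span ?W"
  proof (intro Union_least, safe elim!: imageE del: subsetI)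
    fix i assume "i < s"
    then have "(\<lambda>a. linear_form a ^ d) ` h i \<subseteq> ?W" using b(2) by auto
    then show "veronese d (h i) \<subseteq> CV.span ?W" unfolding veronese_def by (rule CV.span_mono)
  qed
  then have "CV.span (\<Union>(veronese d ` \<Gamma>)) \<subseteq> CV.span ?W"
    by (intro CV.span_minimal CV.subspace_span)
  then have "H \<in> CV.span ?W" using H L(5) by auto
  from apolar_to_powers[OF s b(1) this] have "\<not> good H" by (simp add: good_def)
  moreover have "good H" using L(1) H by (auto simp: U_def)
  ultimately show False by simp
qed

text \<open>Moving the points alone would in general destroy the apolarity of \<open>F\<close>, so
  \<open>F\<close> moves too, inside the kernel of the equations given by \<open>P t\<close>. For
  distinct points the apolarity lemma then expresses it by \<open>r\<close> powers.\<close>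

lemma apolar_secant_variety:
  assumes F: "F \<in> forms d" "F \<noteq> 0" and r: "r \<le> d" and p: "p \<in> apolar_polys (dual_fun d F) d r" "p \<noteq> 0"
  shows "CV.span {F} \<in> secant_variety d r"
proof -
  have dp: "degree p \<le> r" using p by (simp add: apolar_polys_def)
  have f: "homog r p \<in> forms r" "homog r p \<noteq> 0" using p dp by (auto simp: homog_eq_0_iff)
  obtain a where a: "pideal (homog r p) = pideal (points_form r a)" "points_form r a \<noteq> 0"
    using f by (rule pideal_points_formE)
  have "points_form r a \<in> Ann F"
    using homog_in_Ann_iff[OF F(1) dp] p pideal_subset_Ann_iff[OF F(1) f(1)] a(1)
      pideal_subset_Ann_iff[OF F(1) points_form_in_forms[of r a]] by simp
  define c where "c = (\<lambda>t j. if j \<le> r then bicoeff (points_form r (perturb a t)) (r - j) j else 0)"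
  define P where "P = (\<lambda>t. \<Sum>j\<le>r. monom (c t j) j)"
  have cP: "coeff (P t) j = c t j" for t j by (simp add: P_def coeff_sum c_def)
  have dP: "degree (P t) \<le> r" for t by (rule degree_le) (simp add: cP c_def)
  have hP: "homog r (P t) = points_form r (perturb a t)" for t
    by (rule bipoly_eqI) (use points_form_in_forms[of r "perturb a t"] in \<open>auto simp: bicoeff_homog cP c_def forms_def\<close>)
  have P0: "P 0 \<in> apolar_polys (dual_fun d F) d r"
    using \<open>points_form r a \<in> Ann F\<close> homog_in_Ann_iff[OF F(1) dP[of 0]] by (simp add: hP perturb_0)
  have P0n: "P 0 \<noteq> 0" using a(2) hP[of 0] by (auto simp: perturb_0)
  define m where "m = (\<lambda>l j t. coeff (monom 1 l * P t) j)"
  have is_poly_m: "is_poly (m l j)" for l j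
  proof -
    have "is_poly (\<lambda>t. c t k)" for k
      using poly_curve_perturb[of r a] by (cases "k \<le> r") (auto simp: c_def poly_curve_def is_poly_const)
    then show ?thesis by (cases "j < l") (simp_all add: m_def coeff_monom_mult cP is_poly_const)
  qed
  \<comment> \<open>A dependency among the shifts of \<open>P 0\<close> would be a nonzero
    polynomial \<open>V\<close> with \<open>V * P 0 = 0\<close>.\<close>
  have indep: "\<not> (\<exists>v. (\<exists>l<Suc (d - r). v l \<noteq> 0) \<and> (\<forall>j\<in>{..d}. (\<Sum>l<Suc (d - r). v l * m l j 0) = 0))"
  proof safe
    fix v l assume v: "\<forall>j\<in>{..d}. (\<Sum>l<Suc (d - r). v l * m l j 0) = 0" and l: "l < Suc (d - r)" "v l \<noteq> 0"
    define V where "V = (\<Sum>l<Suc (d - r). monom (v l) l)"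
    have cV: "coeff V l = (if l < Suc (d - r) then v l else 0)" for l by (simp add: V_def coeff_sum)
    have dV: "degree V \<le> d - r" by (rule degree_le) (simp add: cV)
    have "V \<noteq> 0" using cV[of l] l by auto
    have eq: "V * P 0 = (\<Sum>l<Suc (d - r). smult (v l) (monom 1 l * P 0))"
      unfolding V_def sum_distrib_right by (intro sum.cong) (auto simp: smult_monom simp flip: mult_smult_left)
    have "coeff (V * P 0) j = 0" for j
    proof (cases "j \<le> d")
      case True
      then show ?thesis using v by (simp add: eq coeff_sum m_def)
    next
      case False
      have "degree (V * P 0) \<le> d" using degree_mult_le[of V "P 0"] dV dP[of 0] r by linarith
      then show ?thesis using False by (simp add: coeff_eq_0)
    qed
    then have "V * P 0 = 0" by (intro poly_eqI) simp
    then show False using \<open>V \<noteq> 0\<close> P0n by simp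
  qed
  have x0: "(\<Sum>j\<in>{..d}. m l j 0 * dweight F (d - j) j) = 0" if "l < Suc (d - r)" for l
    using P0 r that by (auto simp: dual.apolar_polys_monom dual_fun_def m_def)
  obtain x k where x: "k \<noteq> 0" "\<And>j. is_poly (x j)" "\<And>j. x j 0 = k * dweight F (d - j) j"
    "\<And>l t. l < Suc (d - r) \<Longrightarrow> (\<Sum>j\<in>{..d}. m l j t * x j t) = 0"
    using solution_curve[of "{..d}" m "Suc (d - r)" "\<lambda>j. dweight F (d - j) j"] is_poly_m indep x0 by blast
  \<comment> \<open>Dividing by the factorials inverts \<open>dweight\<close>: the solution curve
    becomes the family of weights of \<open>G t\<close>, which at 0 are \<open>k\<close> times those
    of \<open>F\<close>.\<close>
  define G where "G = (\<lambda>t. homog d (\<Sum>j\<le>d. monom (x j t * (1 / (fact (d - j) * fact j))) j))"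
  have bG: "bicoeff (G t) i j = (if i + j = d then x j t * (1 / (fact i * fact j)) else 0)" for t i j
    by (auto simp: G_def bicoeff_homog coeff_sum)
  have wG: "dweight (G t) (d - n) n = x n t" if "n \<le> d" for t n
    using that by (simp add: dweight_def bG)
  have G: "G t \<in> forms d" for t by (simp add: G_def)
  have G0: "G 0 = cscale k F"
    by (rule bipoly_eqI) (use F(1) in \<open>auto simp: bG x(3) dweight_def forms_def\<close>)
  have G0n: "G 0 \<noteq> 0" using F(2) x(1) by (simp add: G0)
  have PG: "P t \<in> apolar_polys (dual_fun d (G t)) d r" for t
  proof -
    have "dual_fun d (G t) (monom 1 l * P t) = 0" if "l \<le> d - r" for l
    proof -
      have "dual_fun d (G t) (monom 1 l * P t) = (\<Sum>j\<in>{..d}. m l j t * x j t)"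
        unfolding dual_fun_def m_def by (intro sum.cong) (auto simp: wG)
      then show ?thesis using x(4) that by simp
    qed
    then show ?thesis using dP by (simp add: dual.apolar_polys_monom)
  qed
  have polyG: "is_poly (\<lambda>t. bicoeff (G t) i j)" for i j
    by (cases "i + j = d") (simp_all add: bG is_poly_const is_poly_mult[OF x(2) is_poly_const] del: mult_1_right times_divide_eq_right)
  obtain B where B: "finite B" "\<And>t. t \<notin> B \<Longrightarrow> distinct_points r (perturb a t)"
    using perturb_distinct by blast
  obtain i j where "bicoeff (G 0) i j \<noteq> 0" using G0n bipoly_eqI[of "G 0" 0] by auto
  then have "finite {t. bicoeff (G t) i j = 0}" using polyG is_poly_zeros by blast
  moreover have "{t. G t = 0} \<subseteq> {t. bicoeff (G t) i j = 0}" by auto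
  ultimately have fin: "finite {t. G t = 0}" by (rule finite_subset[rotated])
  show ?thesis
    unfolding secant_variety_def
  proof (rule in_closure_of_curve[where \<Lambda> = G and X = "\<lambda>t. CV.span {G t}" and B = "B \<union> {t. G t = 0}"])
    show "CV.span {F} \<in> points (proj_forms d)" using F by (auto simp: points_proj_forms)
    show "G 0 \<in> reps (proj_forms d) (CV.span {F})"
      using G0n by (auto simp: G0 proj_forms_def CV.span_singleton)
    show "is_poly (\<lambda>t. c (G t))" if "c \<in> coords (proj_forms d)" for c
      using that polyG by (auto simp: proj_forms_def)
    show "finite (B \<union> {t. G t = 0})" using B fin by simp
    fix t assume "t \<notin> B \<union> {t. G t = 0}"
    then have t: "distinct_points r (perturb a t)" "G t \<noteq> 0" using B by auto
    let ?\<Gamma> = "line_of ` perturb a t ` {..<r}"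
    have pt: "CV.span {G t} \<in> points (proj_forms d)" using G t by (auto simp: points_proj_forms)
    have "G t \<in> CV.span ((\<lambda>i. linear_form (perturb a t i) ^ d) ` {..<r})"
      using apolarity[OF t(1) r G hP[symmetric] PG] .
    also have "\<dots> \<subseteq> CV.span (\<Union>(veronese d ` ?\<Gamma>))"
      using self_in_line_of by (intro CV.span_mono) (auto simp: veronese_def intro!: CV.span_base)
    finally have "CV.span {G t} \<subseteq> CV.span (\<Union>(veronese d ` ?\<Gamma>))"
      by (intro CV.span_minimal CV.subspace_span) simp
    moreover have "G t \<in> reps (proj_forms d) (CV.span {G t})"
      using t(2) by (simp add: proj_forms_def CV.span_base)
    ultimately show "CV.span {G t} \<in> {L \<in> points (proj_forms d). \<exists>\<Gamma>\<subseteq>points P1. finite \<Gamma> \<and> card \<Gamma> = r \<and> L \<subseteq> CV.span (\<Union>(veronese d ` \<Gamma>))} \<and>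
        CV.span {G t} \<in> points (proj_forms d) \<and> G t \<in> reps (proj_forms d) (CV.span {G t})"
      by (intro conjI CollectI exI[of _ ?\<Gamma>] pt line_of_image[OF t(1)])
  qed
qed

section \<open>Square factors in a pencil\<close>

definition has_square_factor :: "nat \<Rightarrow> bipoly \<Rightarrow> bool" where
  "has_square_factor r f \<longleftrightarrow> 2 \<le> r \<and> (\<exists>a. a \<noteq> 0 \<and> (\<exists>q\<in>forms (r - 2). f = perp a * perp a * q))"

text \<open>If f = l^2 q, then l q has its square in the ideal and would itself be a multiple of
  \<open>f\<close>. Cancelling exhibits l as a unit, although it vanishes at
  \<open>a\<close>.\<close>

lemma reduced_imp_no_square_factor:
  assumes f: "f \<in> forms r" "f \<noteq> 0" and red: "pideal f \<in> reduced_locus r"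
  shows "\<not> has_square_factor r f"
proof
  assume "has_square_factor r f"
  then obtain a q where a: "a \<noteq> 0" "f = perp a * perp a * q" by (auto simp: has_square_factor_def)
  have "(perp a * q) ^ 2 = f * q" by (simp add: a power2_eq_square mult_ac)
  then have "(perp a * q) ^ 2 \<in> pideal f" by (auto simp: pideal_def)
  with red have "perp a * q \<in> pideal f" by (auto simp: reduced_locus_def radical_ideal_def)
  then obtain u where "perp a * q = f * u" by (auto simp: pideal_def)
  then have "(perp a * q) * 1 = (perp a * q) * (perp a * u)" by (simp add: a mult_ac)
  moreover have "perp a * q \<noteq> 0" using f a by auto
  ultimately have "1 = perp a * u" unfolding mult_left_cancel[OF \<open>perp a * q \<noteq> 0\<close>] by simp
  then have "eval_at 1 a = eval_at (perp a * u) a" by (rule arg_cong)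
  then show False by (simp add: eval_at_mult)
qed

lemma perp_proportional:
  assumes "a \<noteq> 0" "eval_at (perp a) b = 0"
  shows "\<exists>c. perp b = cscale c (perp a)"
proof -
  have eq: "a $ 1 * b $ 2 = a $ 2 * b $ 1" using assms(2) by (simp add: eval_at_perp)
  show ?thesis
  proof (cases "a $ 1 = 0")
    case True
    then have "a $ 2 \<noteq> 0" using assms(1) by (auto simp: vec_eq_iff forall_2)
    then show ?thesis using eq True
      by (intro exI[of _ "b $ 2 / a $ 2"]) (simp add: perp_def cscale_def)
  next
    case False
    then show ?thesis using eq
      by (intro exI[of _ "b $ 1 / a $ 1"]) (simp add: perp_def cscale_def field_simps)
  qed
qed

text \<open>Two proportional factors in the splitting of \<open>f\<close> would form a square
  factor, so its zeros are distinct points.\<close>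

lemma no_square_factor_imp_reduced:
  assumes f: "f \<in> forms r" "f \<noteq> 0" and nsq: "\<not> has_square_factor r f"
  shows "pideal f \<in> reduced_locus r"
proof -
  obtain a c where a: "\<And>i. i < r \<Longrightarrow> a i \<noteq> 0" "c \<noteq> 0" "f = cscale c (\<Prod>i<r. perp (a i))"
    using form_splits[OF f] by blast
  have "eval_at (perp (a i)) (a j) \<noteq> 0" if ij: "i < r" "j < r" "i \<noteq> j" for i j
  proof
    assume "eval_at (perp (a i)) (a j) = 0"
    then obtain k where k: "perp (a j) = cscale k (perp (a i))" using perp_proportional a(1) ij(1) by blast
    define R where "R = (\<Prod>l\<in>{..<r} - {i} - {j}. perp (a l))"
    have "(\<Prod>l<r. perp (a l)) = perp (a i) * (\<Prod>l\<in>{..<r} - {i}. perp (a l))"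
      using ij by (intro prod.remove) auto
    also have "(\<Prod>l\<in>{..<r} - {i}. perp (a l)) = perp (a j) * R"
      unfolding R_def using ij by (intro prod.remove) auto
    finally have "f = perp (a i) * perp (a i) * cscale (c * k) R"
      by (simp add: a(3) k cscale_mult)
    moreover have "R \<in> forms (card ({..<r} - {i} - {j}))"
      unfolding R_def by (intro forms_prod perp_in_forms) auto
    then have "cscale (c * k) R \<in> forms (r - 2)" using ij by (intro forms_cscale) (simp add: numeral_2_eq_2)
    moreover have "2 \<le> r" using ij by auto
    ultimately show False using nsq a(1)[OF ij(1)] by (auto simp: has_square_factor_def)
  qed
  then have "distinct_points r a" using a(1) by (simp add: distinct_points_def)
  from pideal_in_reduced_locus[OF this] show ?thesis
    using a by (simp add: points_form_def pideal_cscale)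
qed

section \<open>Wronskians and double zeros\<close>

lemma linear_factors_dvd:
  fixes q :: "complex poly"
  assumes "finite A" "\<And>z. z \<in> A \<Longrightarrow> poly q z = 0"
  shows "(\<Prod>z\<in>A. [:- z, 1:]) dvd q"
  using assms
proof (induction A rule: finite_induct)
  case (insert z A)
  then obtain u where u: "q = (\<Prod>z\<in>A. [:- z, 1:]) * u" by (auto elim: dvdE)
  have "poly (\<Prod>z\<in>A. [:- z, 1:]) z \<noteq> 0" using insert.hyps by (auto simp: poly_prod)
  with insert.prems[of z] u have "poly u z = 0" by simp
  then have "[:- z, 1:] dvd u" by (simp add: poly_eq_0_iff_dvd)
  then show ?case unfolding prod.insert[OF insert.hyps] u mult.commute[of "[:- z, 1:]"] by (rule mult_dvd_mono[OF dvd_refl])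
qed simp

text \<open>If the Wronskian were zero, \<open>q\<close> would vanish at the simple roots of
  \<open>p\<close>, so q = p u. The Wronskian is then - p^2 u', whence u is constant.\<close>

lemma wronskian_nonzero:
  fixes p q :: "complex poly"
  assumes "rsquarefree p" "\<And>c. q \<noteq> smult c p"
  shows "pderiv p * q - p * pderiv q \<noteq> 0"
proof
  assume W: "pderiv p * q - p * pderiv q = 0"
  have p0: "p \<noteq> 0" using assms(1) by (simp add: rsquarefree_def)
  have "poly q z = 0" if "poly p z = 0" for z
  proof -
    have "poly (pderiv p) z \<noteq> 0" using assms(1) that by (auto simp: rsquarefree_roots)
    moreover have "poly (pderiv p * q - p * pderiv q) z = 0" using W by simp
    ultimately show ?thesis using that by simp
  qed
  then have "(\<Prod>z | poly p z = 0. [:- z, 1:]) dvd q"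
    by (intro linear_factors_dvd poly_roots_finite p0) auto
  then have "smult (lead_coeff p) (\<Prod>z | poly p z = 0. [:- z, 1:]) dvd q"
    using p0 by (intro smult_dvd) auto
  then have "p dvd q" using complex_poly_decompose_rsquarefree[OF assms(1)] by simp
  then obtain u where u: "q = p * u" by (auto elim: dvdE)
  have "pderiv p * q - p * pderiv q = - (p * p * pderiv u)"
    by (simp add: u pderiv_mult algebra_simps)
  with W p0 have "pderiv u = 0" by simp
  then have "degree u = 0" by (simp add: pderiv_eq_0_iff)
  then obtain c where "u = [:c:]" by (auto elim: degree_eq_zeroE)
  with u assms(2)[of c] show False by simp
qed

lemma finite_common_zero:
  fixes a b c d :: complex
  assumes "a \<noteq> 0 \<or> b \<noteq> 0"
  shows "finite {t. c + t * a = 0 \<and> d + t * b = 0}"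
  using assms
proof
  assume "a \<noteq> 0"
  then have "{t. c + t * a = 0 \<and> d + t * b = 0} \<subseteq> {- c / a}" by (auto simp: field_simps add_eq_0_iff2)
  then show ?thesis using finite_subset by blast
next
  assume "b \<noteq> 0"
  then have "{t. c + t * a = 0 \<and> d + t * b = 0} \<subseteq> {- d / b}" by (auto simp: field_simps add_eq_0_iff2)
  then show ?thesis using finite_subset by blast
qed

text \<open>The second alternative is a double zero at (0,1), which the dehomogenized polynomial
  shows only by the loss of its two top coefficients.\<close>

lemma square_factor_dehomogenized:
  assumes p: "degree p \<le> r" "p \<noteq> 0"
  shows "has_square_factor r (homog r p) \<longleftrightarrow>
    (\<exists>x. poly p x = 0 \<and> poly (pderiv p) x = 0) \<or> (2 \<le> r \<and> coeff p r = 0 \<and> coeff p (r - 1) = 0)"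
proof
  assume "has_square_factor r (homog r p)"
  then obtain a q where a: "2 \<le> r" "a \<noteq> 0" "q \<in> forms (r - 2)" "homog r p = perp a * perp a * q"
    by (auto simp: has_square_factor_def)
  obtain u where u: "degree u \<le> r - 2" "q = homog (r - 2) u" using a(3) by (rule forms_homogE)
  define l where "l = [:- (a $ 2), a $ 1:]"
  have dl: "degree l \<le> 1" by (simp add: l_def)
  have du: "degree (l * u) \<le> r - 1" "degree (l * (l * u)) \<le> r"
    using degree_mult_le[of l u] degree_mult_le[of l "l * u"] dl u(1) a(1) by linarith+
  have "homog r p = homog 1 l * (homog 1 l * homog (r - 2) u)"
    by (simp add: a(4) perp_homog l_def u(2) mult.assoc)
  also have "homog 1 l * homog (r - 2) u = homog (r - 1) (l * u)"
    using homog_mult[OF dl u(1)] a(1) by (simp add: numeral_2_eq_2 Suc_diff_Suc)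
  also have "homog 1 l * \<dots> = homog r (l * (l * u))" using homog_mult[OF dl du(1)] a(1) by simp
  finally have pl: "p = l * (l * u)" using p(1) du(2) by (simp add: homog_inject)
  show "(\<exists>x. poly p x = 0 \<and> poly (pderiv p) x = 0) \<or> (2 \<le> r \<and> coeff p r = 0 \<and> coeff p (r - 1) = 0)"
  proof (cases "a $ 1 = 0")
    case True
    then have "p = smult (a $ 2) (smult (a $ 2) u)" by (simp add: pl l_def)
    moreover have "coeff u r = 0" "coeff u (r - 1) = 0" using u(1) a(1) by (simp_all add: coeff_eq_0)
    ultimately show ?thesis using a(1) by simp
  next
    case False
    then have "poly l (a $ 2 / a $ 1) = 0" by (simp add: l_def)
    then have "poly p (a $ 2 / a $ 1) = 0 \<and> poly (pderiv p) (a $ 2 / a $ 1) = 0" by (simp add: pl pderiv_mult)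
    then show ?thesis by blast
  qed
next
  assume "(\<exists>x. poly p x = 0 \<and> poly (pderiv p) x = 0) \<or> (2 \<le> r \<and> coeff p r = 0 \<and> coeff p (r - 1) = 0)"
  then show "has_square_factor r (homog r p)"
  proof
    assume "\<exists>x. poly p x = 0 \<and> poly (pderiv p) x = 0"
    then obtain x where x: "poly p x = 0" "poly (pderiv p) x = 0" by blast
    define l where "l = [:- x, 1:]"
    obtain v where v: "p = l * v" using x(1) unfolding poly_eq_0_iff_dvd l_def by (auto elim: dvdE)
    have "poly (pderiv p) x = poly v x" unfolding v pderiv_mult by (simp add: l_def pderiv_pCons)
    with x(2) have "poly v x = 0" by simp
    then obtain u where u: "v = l * u" unfolding poly_eq_0_iff_dvd l_def by (auto elim: dvdE)
    have l: "degree l = 1" "l \<noteq> 0" "u \<noteq> 0" using p(2) u v by (auto simp: l_def)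
    then have "degree p = 2 + degree u" by (simp add: u v degree_mult_eq)
    with p(1) have d: "2 \<le> r" "degree u \<le> r - 2" by auto
    have lp: "perp (vector [1, x]) = homog 1 l" by (simp add: perp_homog l_def)
    have "homog 1 l * homog (r - 2) u = homog (r - 1) v"
      using homog_mult[of l 1 u "r - 2"] l d by (simp add: u numeral_2_eq_2 Suc_diff_Suc)
    moreover have "homog 1 l * homog (r - 1) v = homog r p"
      using homog_mult[of l 1 v "r - 1"] l d by (simp add: u v degree_mult_eq)
    ultimately have "homog r p = perp (vector [1, x]) * perp (vector [1, x]) * homog (r - 2) u"
      by (simp add: lp mult.assoc)
    moreover have "(vector [1, x] :: complex ^ 2) \<noteq> 0" by (auto simp: vec_eq_iff forall_2)
    ultimately show ?thesis using d(1) unfolding has_square_factor_def by (intro conjI exI[of _ "vector [1, x]"] bexI) auto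
  next
    assume *: "2 \<le> r \<and> coeff p r = 0 \<and> coeff p (r - 1) = 0"
    have "coeff p i = 0" if "r - 2 < i" for i
    proof -
      have "i = r \<or> i = r - 1 \<or> i > r" using that by auto
      then show ?thesis using * p(1) by (auto simp: coeff_eq_0)
    qed
    then have d: "degree p \<le> r - 2" by (intro degree_le) auto
    let ?a = "vector [0, 1] :: complex ^ 2"
    have "perp ?a = homog 1 (- 1)" by (simp add: perp_homog one_pCons)
    then have "perp ?a * perp ?a * homog (r - 2) p = homog r p"
      using homog_mult[of "- 1" 1 p "r - 2"] homog_mult[of "- 1" 1 "- p" "r - 1"] d *
      by (simp add: mult.assoc numeral_2_eq_2 Suc_diff_Suc)
    moreover have "?a \<noteq> 0" by (auto simp: vec_eq_iff forall_2)
    ultimately show ?thesis using * unfolding has_square_factor_def by (metis homog_in_forms)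
  qed
qed

text \<open>A double root x of q + t p is a zero of the Wronskian, which leaves finitely many x;
  each of them allows at most one t, because \<open>p\<close> has no double root. At (0,1) the two
  top coefficients play the role of value and derivative.\<close>

lemma finite_square_factor_pencil:
  assumes f: "f \<in> forms r" "f \<noteq> 0" "\<not> has_square_factor r f" and g: "g \<in> forms r" "\<And>c. g \<noteq> cscale c f"
  shows "finite {t. has_square_factor r (g + cscale t f)}"
proof -
  obtain p where p: "degree p \<le> r" "f = homog r p" using f(1) by (rule forms_homogE)
  obtain q where q: "degree q \<le> r" "g = homog r q" using g(1) by (rule forms_homogE)
  have p0: "p \<noteq> 0" using f(2) p by auto
  have np: "\<not> (\<exists>x. poly p x = 0 \<and> poly (pderiv p) x = 0)" "\<not> (2 \<le> r \<and> coeff p r = 0 \<and> coeff p (r - 1) = 0)"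
    using f(3) square_factor_dehomogenized[OF p(1) p0] p(2) by auto
  have q_ne: "q \<noteq> smult c p" for c using g(2)[of c] by (auto simp: p q homog_smult)
  have "rsquarefree p" using np(1) by (simp add: rsquarefree_roots)
  define W where "W = pderiv p * q - p * pderiv q"
  have "W \<noteq> 0" unfolding W_def using \<open>rsquarefree p\<close> q_ne by (rule wronskian_nonzero)
  define B where "B = (\<Union>x\<in>{x. poly W x = 0}. {t. poly q x + t * poly p x = 0 \<and> poly (pderiv q) x + t * poly (pderiv p) x = 0}) \<union>
    (if 2 \<le> r then {t. coeff q r + t * coeff p r = 0 \<and> coeff q (r - 1) + t * coeff p (r - 1) = 0} else {})"
  have "finite B" unfolding B_def
    using np \<open>W \<noteq> 0\<close> by (auto intro!: finite_common_zero poly_roots_finite)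
  moreover have "{t. has_square_factor r (g + cscale t f)} \<subseteq> B"
  proof
    fix t assume "t \<in> {t. has_square_factor r (g + cscale t f)}"
    moreover define h where "h = q + smult t p"
    have h: "g + cscale t f = homog r h" by (simp add: h_def p q homog_add homog_smult)
    moreover have "degree h \<le> r" unfolding h_def
      by (intro degree_add_le q order.trans[OF degree_smult_le] p)
    moreover have "h \<noteq> 0"
    proof
      assume "h = 0"
      then have "q = smult (- t) p" by (simp add: h_def eq_neg_iff_add_eq_0)
      then show False using q_ne by blast
    qed
    ultimately consider x where "poly h x = 0" "poly (pderiv h) x = 0" |
        "2 \<le> r" "coeff h r = 0" "coeff h (r - 1) = 0"
      using square_factor_dehomogenized[of h r] by auto
    then show "t \<in> B"
    proof cases
      case 1
      then have *: "poly q x + t * poly p x = 0" "poly (pderiv q) x + t * poly (pderiv p) x = 0"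
        by (simp_all add: h_def pderiv_add pderiv_smult)
      then have "poly q x = - t * poly p x" "poly (pderiv q) x = - t * poly (pderiv p) x"
        by (simp_all add: add_eq_0_iff2)
      then have "poly W x = 0" by (simp add: W_def)
      with * show ?thesis by (auto simp: B_def)
    next
      case 2
      then show ?thesis by (simp add: B_def h_def)
    qed
  qed
  ultimately show ?thesis by (rule finite_subset[rotated])
qed


section \<open>The varieties of apolar subschemes\<close>

lemma coords_reps_Hilb: "coords (Hilb r) = frame_coords" "reps (Hilb r) = graded_frames {r..}"
  by (simp_all add: Hilb_def)

lemma coords_reps_VPS: "coords (VPS F r) = frame_coords" "reps (VPS F r) = graded_frames {r..}"
  by (simp_all add: VPS_def subvariety_def Hilb_def)

lemma points_VPS:
  assumes "F \<in> forms d"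
  shows "points (VPS F r) = {pideal f | f. f \<in> forms r \<and> f \<noteq> 0 \<and> f \<in> Ann F}"
  using pideal_subset_Ann_iff[OF assms, of _ r]
  by (auto simp: VPS_def subvariety_def points_Hilb)

lemma ex_apolar_scheme_iff:
  assumes F: "F \<in> forms d"
  shows "(\<exists>Z\<in>points (Hilb k). Z \<subseteq> Ann F) \<longleftrightarrow> (\<exists>p\<in>apolar_polys (dual_fun d F) d k. p \<noteq> 0)"
proof
  assume "\<exists>Z\<in>points (Hilb k). Z \<subseteq> Ann F"
  then obtain f where f: "f \<in> forms k" "f \<noteq> 0" "f \<in> Ann F"
    using pideal_subset_Ann_iff[OF F] by (auto simp: points_Hilb)
  from f(1) obtain p where "degree p \<le> k" "f = homog k p" by (rule forms_homogE)
  then show "\<exists>p\<in>apolar_polys (dual_fun d F) d k. p \<noteq> 0"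
    using f homog_in_Ann_iff[OF F] by (intro bexI[of _ p]) auto
next
  assume "\<exists>p\<in>apolar_polys (dual_fun d F) d k. p \<noteq> 0"
  then obtain p where p: "p \<in> apolar_polys (dual_fun d F) d k" "p \<noteq> 0" by blast
  then have "degree p \<le> k" by (simp add: apolar_polys_def)
  then show "\<exists>Z\<in>points (Hilb k). Z \<subseteq> Ann F"
    using p homog_in_Ann_iff[OF F] pideal_subset_Ann_iff[OF F homog_in_forms[of k p]]
    by (intro bexI[of _ "pideal (homog k p)"] pideal_in_Hilb) (auto simp: homog_eq_0_iff)
qed

text \<open>Both sides have the same points and \<open>saturation\<close> fixes them; only the index
  sets of the frames differ. Below degree \<open>r\<close> the graded pieces vanish, so a frame from
  degree \<open>r\<close> on, padded with zeros, is already a full frame.\<close>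

lemma border_VSP_isomorphism:
  "isomorphism (border_VSP F r) (VPS F r) slip_to_hilb"
proof -
  have points: "points (border_VSP F r) = points (VPS F r)"
    using points_Slip[of r] by (simp add: border_VSP_def VPS_def subvariety_def)
  have reps: "reps (border_VSP F r) = graded_frames UNIV" "coords (border_VSP F r) = frame_coords"
    by (simp_all add: border_VSP_def subvariety_def Slip_def MHilb_def)
  have idV: "slip_to_hilb Z = Z" if "Z \<in> points (VPS F r)" for Z
    using that by (simp add: slip_to_hilb_def VPS_def subvariety_def Hilb_def saturated_def)
  have pf: "\<exists>f\<in>forms r. f \<noteq> 0 \<and> Z = pideal f" if "Z \<in> points (VPS F r)" for Z
    using that Hilb_eq_pideal by (simp add: VPS_def subvariety_def)
  let ?\<Lambda> = "\<lambda>b k :: nat. if r \<le> k then b k else (\<lambda>_. 0 :: bipoly)"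
  show ?thesis
  proof (rule isomorphism_lift[where \<psi> = "\<lambda>Z. Z" and \<Lambda> = ?\<Lambda> and M = "\<lambda>b. b"])
    show "?\<Lambda> b \<in> reps (VPS F r) (slip_to_hilb Z)" if "Z \<in> points (border_VSP F r)" "b \<in> reps (border_VSP F r) Z" for Z b
      using that by (auto simp: points reps idV coords_reps_VPS graded_frames_def)
    show "b \<in> reps (border_VSP F r) Z" if Z: "Z \<in> points (VPS F r)" "b \<in> reps (VPS F r) Z" for Z b
    proof -
      obtain f where f: "f \<in> forms r" "f \<noteq> 0" "Z = pideal f" using pf Z(1) by blast
      have "CV.span (b k ` {..<CV.dim (Z \<inter> forms k)}) = Z \<inter> forms k" for k
      proof (cases "r \<le> k")
        case True
        then show ?thesis using Z(2) by (simp add: coords_reps_VPS graded_frames_def)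
      next
        case False
        then have "Z \<inter> forms k = {0}" by (simp add: f(3) pideal_inter_forms[OF f(1)])
        then show ?thesis by (simp add: dim_zero)
      qed
      then show ?thesis using Z(2) by (auto simp: reps coords_reps_VPS graded_frames_def)
    qed
    show "(\<lambda>b. c (?\<Lambda> b)) \<in> poly_funs (coords (border_VSP F r))" if cV: "c \<in> coords (VPS F r)" for c
    proof -
      obtain k m i j where c: "c = (\<lambda>b. bicoeff (b k m) i j)"
        using cV by (auto simp: coords_reps_VPS frame_coords_def)
      show ?thesis
      proof (cases "r \<le> k")
        case True
        moreover have "(\<lambda>b. bicoeff (b k m) i j) \<in> frame_coords" by (auto simp: frame_coords_def)
        ultimately show ?thesis by (simp add: c reps poly_funs.coord)
      qed (simp add: c poly_funs.const)
    qed
    show "(\<lambda>b. c b) \<in> poly_funs (coords (VPS F r))" if "c \<in> coords (border_VSP F r)" for c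
      using that by (auto simp: reps coords_reps_VPS intro: poly_funs.coord)
  qed (simp_all add: points idV)
qed

text \<open>The generator is linear in the coordinates of the point of P^1. Conversely these are
  read off from \<open>b r 0\<close> by Cramer's rule, which is polynomial because the determinant
  \<open>D\<close> is a constant.\<close>

lemma pencil_isomorphic_P1:
  assumes f: "f \<in> forms r" "g \<in> forms r"
    and indep: "\<And>a b. cscale a f + cscale b g = 0 \<Longrightarrow> a = 0 \<and> b = 0"
    and V: "points V = {pideal (cscale a f + cscale b g) | a b. a \<noteq> 0 \<or> b \<noteq> 0}"
      "reps V = graded_frames {r..}" "coords V = frame_coords"
  shows "isomorphic V P1"
proof -
  define comb where "comb = (\<lambda>a :: complex ^ 2. cscale (a $ 1) f + cscale (a $ 2) g)"
  have comb_forms: "comb a \<in> forms r" for a by (simp add: comb_def f forms_add forms_cscale)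
  have comb_scale: "comb (s *s a) = cscale s (comb a)" for s a
    by (simp add: comb_def CV.scale_right_distrib)
  have comb_diff: "comb (a - b) = comb a - comb b" for a b
    by (simp add: comb_def CV.scale_left_diff_distrib)
  have comb_0: "comb a = 0 \<longleftrightarrow> a = 0" for a
    using indep[of "a $ 1" "a $ 2"] by (auto simp: comb_def vec_eq_iff forall_2)
  have comb_inj: "comb a = comb b \<longleftrightarrow> a = b" for a b
    using comb_0[of "a - b"] by (simp add: comb_diff)
  have ptsV: "points V = {pideal (comb a) | a. a \<noteq> 0}"
  proof -
    have "\<exists>v. pideal (cscale a f + cscale b g) = pideal (comb v) \<and> v \<noteq> 0" if "a \<noteq> 0 \<or> b \<noteq> 0" for a b
      using that by (intro exI[of _ "vector [a, b]"]) (auto simp: comb_def vec_eq_iff forall_2)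
    moreover have "\<exists>a b. pideal (comb v) = pideal (cscale a f + cscale b g) \<and> (a \<noteq> 0 \<or> b \<noteq> 0)" if "v \<noteq> 0" for v
      using that by (intro exI[of _ "v $ 1"] exI[of _ "v $ 2"]) (auto simp: comb_def vec_eq_iff forall_2)
    ultimately show ?thesis unfolding V(1) by blast
  qed
  define \<phi> where "\<phi> = (\<lambda>Z. {a. comb a \<in> Z})"
  define \<psi> where "\<psi> = (\<lambda>L. \<Union>a\<in>L. pideal (comb a))"
  have \<phi>: "\<phi> (pideal (comb a)) = line_of a" for a
  proof -
    have "comb b \<in> pideal (comb a) \<longleftrightarrow> b \<in> line_of a" for b
      unfolding mem_pideal_iff[OF comb_forms comb_forms] comb_scale[symmetric] comb_inj
      by (auto simp: line_of_def)
    then show ?thesis by (auto simp: \<phi>_def)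
  qed
  have \<psi>: "\<psi> (line_of a) = pideal (comb a)" for a
  proof
    have "pideal (comb (s *s a)) \<subseteq> pideal (comb a)" for s
      unfolding comb_scale using mem_pideal_iff[OF forms_cscale[OF comb_forms] comb_forms]
        pideal_subset_iff[OF hom_ideal_pideal[OF comb_forms]] by blast
    then show "\<psi> (line_of a) \<subseteq> pideal (comb a)" by (auto simp: \<psi>_def line_of_def)
    show "pideal (comb a) \<subseteq> \<psi> (line_of a)" using self_in_line_of by (auto simp: \<psi>_def)
  qed
  obtain p where p: "degree p \<le> r" "f = homog r p" using f(1) by (rule forms_homogE)
  obtain q where q: "degree q \<le> r" "g = homog r q" using f(2) by (rule forms_homogE)
  \<comment> \<open>A nonzero 2x2 minor of the two coefficient vectors, available because
    \<open>f\<close> and \<open>g\<close> are independent.\<close>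
  obtain i j where ij: "i \<le> r" "j \<le> r" "coeff p i * coeff q j - coeff p j * coeff q i \<noteq> 0"
  proof -
    have "f \<noteq> 0" using indep[of 1 0] by auto
    then have "p \<noteq> 0" using p by auto
    define i where "i = degree p"
    have pi: "coeff p i \<noteq> 0" "i \<le> r" using \<open>p \<noteq> 0\<close> p by (auto simp: i_def)
    have "\<exists>j\<le>r. coeff p i * coeff q j - coeff p j * coeff q i \<noteq> 0"
    proof (rule ccontr)
      assume *: "\<not> ?thesis"
      have "smult (- coeff q i) p + smult (coeff p i) q = 0"
      proof (rule poly_eqI)
        fix j show "coeff (smult (- coeff q i) p + smult (coeff p i) q) j = coeff 0 j"
          using * p q by (cases "j \<le> r") (auto simp: coeff_eq_0 mult.commute)
      qed
      then have "homog r (smult (- coeff q i) p + smult (coeff p i) q) = 0" by simp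
      then have "cscale (- coeff q i) f + cscale (coeff p i) g = 0" by (simp only: p q homog_add homog_smult)
      from indep[OF this] pi show False by simp
    qed
    with pi that show ?thesis by blast
  qed
  define D where "D = coeff p i * coeff q j - coeff p j * coeff q i"
  define X where "X = (\<lambda>h. bicoeff h (r - i) i)"
  define Y where "Y = (\<lambda>h. bicoeff h (r - j) j)"
  define \<Lambda> where "\<Lambda> = (\<lambda>b :: nat \<Rightarrow> nat \<Rightarrow> bipoly. vector
    [(coeff q j / D) * X (b r 0) + (- coeff q i / D) * Y (b r 0),
     (- coeff p j / D) * X (b r 0) + (coeff p i / D) * Y (b r 0)] :: complex ^ 2)"
  have \<Lambda>: "\<Lambda> b = a" if "b r 0 = comb a" for a b
  proof -
    have XY: "X (b r 0) = a $ 1 * coeff p i + a $ 2 * coeff q i" "Y (b r 0) = a $ 1 * coeff p j + a $ 2 * coeff q j"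
      using ij by (simp_all add: that X_def Y_def comb_def p q bicoeff_homog)
    have D0: "D \<noteq> 0" using ij by (simp add: D_def)
    have "(coeff q j / D) * X (b r 0) + (- coeff q i / D) * Y (b r 0) = a $ 1 * D / D"
      unfolding XY by (simp add: D_def diff_divide_distrib add_divide_distrib algebra_simps)
    moreover have "(- coeff p j / D) * X (b r 0) + (coeff p i / D) * Y (b r 0) = a $ 2 * D / D"
      unfolding XY by (simp add: D_def diff_divide_distrib add_divide_distrib algebra_simps)
    ultimately show ?thesis using D0 by (simp add: \<Lambda>_def vec_eq_iff forall_2)
  qed
  have "isomorphism V P1 \<phi>"
  proof (rule isomorphism_lift[where \<psi> = \<psi> and \<Lambda> = \<Lambda> and M = "\<lambda>a. pframe {r..} r (comb a)"])
    show "\<phi> Z \<in> points P1" "\<psi> (\<phi> Z) = Z" if "Z \<in> points V" for Z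
      using that by (auto simp: ptsV points_P1_line_of \<phi> \<psi>)
    show "\<psi> L \<in> points V" "\<phi> (\<psi> L) = L" if "L \<in> points P1" for L
      using that by (auto simp: ptsV points_P1_line_of \<phi> \<psi>)
    show "\<Lambda> b \<in> reps P1 (\<phi> Z)" if Z: "Z \<in> points V" "b \<in> reps V Z" for Z b
    proof -
      obtain a where a: "a \<noteq> 0" "Z = pideal (comb a)" using Z(1) by (auto simp: ptsV)
      have b: "b r 0 \<in> forms r" "b r 0 \<noteq> 0" "pideal (b r 0) = pideal (comb a)"
        using pideal_frame_generator[OF comb_forms, of a b "{r..}"] Z(2) a by (auto simp: V comb_0)
      then have "b r 0 \<in> pideal (comb a)" using pideal_self by blast
      then obtain c where "b r 0 = comb (c *s a)"
        unfolding mem_pideal_iff[OF b(1) comb_forms] comb_scale by blast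
      then have "\<Lambda> b = c *s a" "c *s a \<noteq> 0" using \<Lambda> b(2) comb_0 by auto
      then show ?thesis by (auto simp: P1_def a \<phi> line_of_def)
    qed
    show "pframe {r..} r (comb a) \<in> reps V (\<psi> L)" if L: "L \<in> points P1" "a \<in> reps P1 L" for L a
    proof -
      obtain b where b: "L = line_of b" "b \<noteq> 0" using L(1) by (auto simp: points_P1_line_of)
      then obtain s where s: "a = s *s b" "a \<noteq> 0" using L(2) by (auto simp: P1_def line_of_def)
      then have "s \<noteq> 0" by auto
      then have "\<psi> L = pideal (comb a)" by (simp add: b \<psi> s comb_scale pideal_cscale)
      then show ?thesis unfolding V(2) using s by (simp add: pframe_in_graded_frames comb_forms comb_0)
    qed
    show "(\<lambda>b. c (\<Lambda> b)) \<in> poly_funs (coords V)" if cP: "c \<in> coords P1" for c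
    proof -
      have bc: "(\<lambda>b. bicoeff (b k m) i j) \<in> poly_funs (coords V)" for k m i j
        by (rule poly_funs.coord) (auto simp: V frame_coords_def)
      obtain n where n: "c = (\<lambda>a. a $ n)" using cP by (auto simp: P1_def)
      have "n = 1 \<or> n = 2" by (rule exhaust_2)
      then show ?thesis
      proof
        assume "n = 1"
        have "(\<lambda>b. (coeff q j / D) * X (b r 0) + (- coeff q i / D) * Y (b r 0)) \<in> poly_funs (coords V)"
          unfolding X_def Y_def by (intro poly_funs.add poly_funs.mult poly_funs.const bc)
        then show ?thesis by (simp add: n \<open>n = 1\<close> \<Lambda>_def)
      next
        assume "n = 2"
        have "(\<lambda>b. (- coeff p j / D) * X (b r 0) + (coeff p i / D) * Y (b r 0)) \<in> poly_funs (coords V)"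
          unfolding X_def Y_def by (intro poly_funs.add poly_funs.mult poly_funs.const bc)
        then show ?thesis by (simp add: n \<open>n = 2\<close> \<Lambda>_def)
      qed
    qed
    show "(\<lambda>a. c (pframe {r..} r (comb a))) \<in> poly_funs (coords P1)" if cV: "c \<in> coords V" for c
    proof -
      obtain k m u v where c: "c = (\<lambda>b. bicoeff (b k m) u v)" using cV by (auto simp: V frame_coords_def)
      have co: "(\<lambda>a. a $ n) \<in> poly_funs (coords P1)" for n
        by (rule poly_funs.coord) (auto simp: P1_def)
      show ?thesis
      proof (cases "k \<in> {r..} \<and> m < k + 1 - r")
        case True
        define h where "h = homog (k - r) (monom 1 m)"
        have "c (pframe {r..} r (comb a)) = a $ 1 * bicoeff (f * h) u v + a $ 2 * bicoeff (g * h) u v" for a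
          using True by (simp add: c pframe_def h_def comb_def distrib_right cscale_mult)
        then show ?thesis by (simp only:) (intro poly_funs.add poly_funs.mult poly_funs.const co)
      next
        case False
        then have "c (pframe {r..} r (comb a)) = 0" for a by (auto simp: c pframe_def)
        then show ?thesis by (simp add: poly_funs.const)
      qed
    qed
  qed
  then show ?thesis by (auto simp: isomorphic_def)
qed

text \<open>Containment in \<open>Ann F\<close> is decided by the generator, and the equations of
  \<open>Ann F\<close> are linear in the frame entry \<open>b r 0\<close>.\<close>

lemma closedin_VPS:
  assumes F: "F \<in> forms d"
  shows "closedin (zariski (Hilb r)) (points (VPS F r))"
proof -
  define c where "c = (\<lambda>k j (b :: nat \<Rightarrow> nat \<Rightarrow> bipoly). \<Sum>n\<le>k. bicoeff (b r 0) (k - n) n * dweight F (d - (j + n)) (j + n))"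
  have "zariski_open (Hilb r) (points (Hilb r) - points (VPS F r))"
  proof (rule zariski_openI)
    show "{c k j | k j. k + j \<le> d} \<subseteq> poly_funs (coords (Hilb r))"
    proof safe
      fix k j
      have "(\<lambda>b. bicoeff (b k m) i j) \<in> poly_funs (coords (Hilb r))" for k m i j
        by (rule poly_funs.coord) (auto simp: coords_reps_Hilb frame_coords_def)
      then show "c k j \<in> poly_funs (coords (Hilb r))"
        unfolding c_def by (intro poly_funs_sum poly_funs.mult poly_funs.const)
    qed
    fix Z b assume Z: "Z \<in> points (Hilb r)" "b \<in> reps (Hilb r) Z"
    then obtain f where f: "f \<in> forms r" "f \<noteq> 0" "Z = pideal f" by (auto simp: points_Hilb)
    have b: "b r 0 \<in> forms r" "pideal (b r 0) = Z"
      using pideal_frame_generator[OF f(1,2), of b "{r..}"] Z(2) f(3) by (auto simp: coords_reps_Hilb)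
    have "Z \<in> points (VPS F r) \<longleftrightarrow> b r 0 \<in> Ann F"
      using Z(1) b pideal_subset_Ann_iff[OF F b(1)] by (simp add: VPS_def subvariety_def)
    also have "\<dots> \<longleftrightarrow> (\<forall>k j. k + j \<le> d \<longrightarrow> c k j b = 0)" by (simp add: Ann_iff[OF F] c_def)
    finally show "Z \<in> points (Hilb r) - points (VPS F r) \<longleftrightarrow> (\<exists>p\<in>{c k j | k j. k + j \<le> d}. p b \<noteq> 0)"
      using Z(1) by auto
  qed auto
  then show ?thesis by (simp add: closedin_def) (auto simp: VPS_def subvariety_def)
qed

text \<open>A reduced apolar scheme has a generator \<open>f\<close> without square factors. An
  apolar \<open>h\<close> not proportional to it is the member at t = 0 of the pencil h + t f, whose
  members are all apolar and almost all reduced; closedness of \<open>VPS F r\<close> gives the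
  other inclusion.\<close>

lemma VSP_eq_VPS:
  assumes F: "F \<in> forms d" and ex: "\<exists>Z\<in>reduced_locus r. Z \<subseteq> Ann F"
  shows "VSP F r = VPS F r"
proof -
  define S where "S = points (VPS F r) \<inter> reduced_locus r"
  from ex obtain Z where Z: "Z \<in> reduced_locus r" "Z \<subseteq> Ann F" by blast
  then have "Z \<in> points (Hilb r)" by (simp add: reduced_locus_def)
  then obtain f where f: "f \<in> forms r" "f \<noteq> 0" "Z = pideal f" by (auto simp: points_Hilb)
  have fA: "f \<in> Ann F" using Z f pideal_subset_Ann_iff[OF F f(1)] by simp
  have nsq: "\<not> has_square_factor r f" using reduced_imp_no_square_factor f Z by blast
  have closure: "pideal h \<in> zariski (Hilb r) closure_of S" if h: "h \<in> forms r" "h \<noteq> 0" "h \<in> Ann F" for h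
  proof (cases "\<exists>c. h = cscale c f")
    case True
    then have "pideal h = Z" using pideal_eq_iff[OF h(1) f(1,2) h(2)] f(3) by simp
    moreover have "Z \<in> S" using Z \<open>Z \<in> points (Hilb r)\<close> by (simp add: S_def VPS_def subvariety_def)
    moreover have "S \<subseteq> topspace (zariski (Hilb r))" by (auto simp: S_def VPS_def subvariety_def)
    ultimately show ?thesis using closure_of_subset by blast
  next
    case False
    define B where "B = {t. has_square_factor r (h + cscale t f)}"
    have "finite B" unfolding B_def using False by (intro finite_square_factor_pencil f nsq h) auto
    show ?thesis
    proof (rule in_closure_of_curve[where B = B and X = "\<lambda>t. pideal (h + cscale t f)"
          and \<Lambda> = "\<lambda>t. pframe {r..} r (h + cscale t f)"])
      show "pideal h \<in> points (Hilb r)" using h by (simp add: pideal_in_Hilb)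
      show "pframe {r..} r (h + cscale 0 f) \<in> reps (Hilb r) (pideal h)"
        using h by (simp add: coords_reps_Hilb pframe_in_graded_frames)
      show "is_poly (\<lambda>t. c (pframe {r..} r (h + cscale t f)))" if "c \<in> coords (Hilb r)" for c
        using that by (intro is_poly_pframe poly_curve_line) (simp add: coords_reps_Hilb)
      fix t assume t: "t \<notin> B"
      have forms: "h + cscale t f \<in> forms r" by (intro forms_add forms_cscale h f)
      have nz: "h + cscale t f \<noteq> 0"
      proof
        assume "h + cscale t f = 0"
        then have "h = cscale (- t) f" by (simp add: eq_neg_iff_add_eq_0)
        then show False using False by blast
      qed
      have "h + cscale t f \<in> Ann F"
        using h(3) fA unfolding Ann_iff[OF F]
        by (simp add: distrib_right sum.distrib mult.assoc flip: sum_distrib_left)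
      then have "pideal (h + cscale t f) \<in> points (VPS F r)"
        using forms nz by (auto simp: points_VPS[OF F])
      moreover have "pideal (h + cscale t f) \<in> reduced_locus r"
        using t by (intro no_square_factor_imp_reduced forms nz) (simp add: B_def)
      ultimately show "pideal (h + cscale t f) \<in> S \<and> pideal (h + cscale t f) \<in> points (Hilb r) \<and>
          pframe {r..} r (h + cscale t f) \<in> reps (Hilb r) (pideal (h + cscale t f))"
        using forms nz by (simp add: S_def pideal_in_Hilb coords_reps_Hilb pframe_in_graded_frames)
    qed fact
  qed
  have "zariski (Hilb r) closure_of S = points (VPS F r)"
  proof
    show "zariski (Hilb r) closure_of S \<subseteq> points (VPS F r)"
      by (rule closure_of_minimal) (auto simp: S_def closedin_VPS[OF F])
    show "points (VPS F r) \<subseteq> zariski (Hilb r) closure_of S"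
      using closure by (auto simp: points_VPS[OF F])
  qed
  then show ?thesis by (auto simp: VSP_def S_def[symmetric]) (simp add: VPS_def subvariety_def Int_left_absorb)
qed

lemma two_points_P1: "\<not> (\<exists>L. points P1 = {L})"
proof
  assume "\<exists>L. points P1 = {L}"
  moreover have "line_of (vector [1, 0]) \<in> points P1" "line_of (vector [0, 1]) \<in> points P1"
    unfolding points_P1_line_of by (auto simp: vec_eq_iff forall_2)
  ultimately have "line_of (vector [1, 0]) = line_of (vector [0, 1])" by auto
  then have "(vector [1, 0] :: complex ^ 2) \<in> line_of (vector [0, 1])" using self_in_line_of by metis
  then show False by (auto simp: line_of_def vec_eq_iff forall_2)
qed

text \<open>Forms of degree \<open>d + 1\<close> are all apolar, so \<open>d + 1\<close> distinct
  points provide a reduced scheme; the least number in \<open>rk\<close> is therefore taken over a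
  nonempty set.\<close>

lemma rk_attained:
  assumes F: "F \<in> forms d"
  shows "\<exists>Z\<in>reduced_locus (rk F). Z \<subseteq> Ann F"
proof -
  obtain B where B: "finite B" "\<And>t. t \<notin> B \<Longrightarrow> distinct_points (d + 1) (perturb (\<lambda>_. 0) t)"
    using perturb_distinct by blast
  obtain t where "t \<notin> B" using B(1) ex_new_if_finite infinite_UNIV_char_0 by blast
  define a where "a = perturb (\<lambda>_. 0) t"
  have a: "distinct_points (d + 1) a" unfolding a_def by (rule B) fact
  obtain p where p: "degree p \<le> d + 1" "points_form (d + 1) a = homog (d + 1) p"
    using points_form_in_forms by (rule forms_homogE)
  have "points_form (d + 1) a \<in> Ann F"
    unfolding p(2) homog_in_Ann_iff[OF F p(1)] using p(1) by (simp add: apolar_polys_def)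
  then have "pideal (points_form (d + 1) a) \<subseteq> Ann F"
    using pideal_subset_Ann_iff[OF F points_form_in_forms] by blast
  with pideal_in_reduced_locus[OF a] have "\<exists>k. \<exists>Z\<in>reduced_locus k. Z \<subseteq> Ann F" by blast
  then show ?thesis unfolding rk_def by (rule LeastI_ex)
qed

theorem proposition8p1:
  fixes F :: "complex poly poly" and d r :: nat
  assumes "d \<ge> 1" and "F \<in> forms d" and "F \<noteq> 0"
    and "r = crk F"
  shows "crk F = srk F \<and> srk F = border_rk d F \<and>
    isomorphism (border_VSP F r) (VPS F r) slip_to_hilb \<and>
    (isomorphic (VPS F r) P1 \<or> (\<exists>Z. points (VPS F r) = {Z})) \<and>
    (isomorphic (VPS F r) P1 \<longrightarrow> even d) \<and>
    (rk F = r \<longrightarrow> isomorphic (VSP F r) (VPS F r))"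
proof -
  note F = assms(2)
  define A where "A = apolar_polys (dual_fun d F) d"
  have crk: "crk F = (LEAST k. \<exists>p\<in>A k. p \<noteq> 0)"
    by (simp add: crk_def ex_apolar_scheme_iff[OF F] A_def)
  have srk: "srk F = crk F" by (simp add: srk_def crk_def smoothable_locus_eq)
  have ex: "\<exists>p\<in>A (d div 2 + 1). p \<noteq> 0" unfolding A_def by (rule dual.apolar_polys_exists) auto
  have exr: "\<exists>p\<in>A r. p \<noteq> 0" unfolding assms(4) crk using ex by (rule LeastI)
  have r_le: "r \<le> k" if "\<exists>p\<in>A k. p \<noteq> 0" for k unfolding assms(4) crk using that by (rule Least_le)
  \<comment> \<open>In degree 0, apolarity of a nonzero constant says that the functional of
    \<open>F\<close> is zero. Hence \<open>r\<close> is positive and \<open>r - 1\<close> is a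
    genuinely smaller degree.\<close>
  have A0: "p = 0" if "p \<in> A 0" for p
  proof (rule ccontr)
    assume "p \<noteq> 0"
    from that obtain c where c: "p = [:c:]" by (auto simp: A_def apolar_polys_def elim: degree_eq_zeroE)
    with \<open>p \<noteq> 0\<close> have "c \<noteq> 0" by simp
    have "dual_fun d F q = 0" if "degree q \<le> d" for q
      using \<open>p \<in> A 0\<close> that \<open>c \<noteq> 0\<close> by (auto simp: A_def apolar_polys_def c dual_fun_smult)
    then have "F = 0" using F by (intro form_eq_dual_funI) auto
    with assms(3) show False by simp
  qed
  have r1: "1 \<le> r" using exr A0 by (cases r) auto
  have r2: "2 * r \<le> d + 2" using r_le[OF ex] by auto
  \<comment> \<open>Here \<open>d \<ge> 1\<close> enters: for d = 1 the bound 2 r \<le> 3 leaves r =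
    1.\<close>
  have rd: "r \<le> d" using r2 r1 assms(1) by auto
  have min: "A (r - 1) \<subseteq> {0}"
  proof (rule ccontr)
    assume "\<not> A (r - 1) \<subseteq> {0}"
    then have "r \<le> r - 1" by (intro r_le) auto
    with r1 show False by simp
  qed
  have border: "border_rk d F = crk F"
    unfolding border_rk_def assms(4)[symmetric]
  proof (rule Least_equality)
    show "CV.span {F} \<in> secant_variety d r"
      using exr apolar_secant_variety[OF F assms(3) rd] by (auto simp: A_def)
    show "r \<le> s" if "CV.span {F} \<in> secant_variety d s" for s
      using secant_variety_apolar[OF F assms(3) that] r_le by (simp add: A_def)
  qed
  have ptsV: "points (VPS F r) = {pideal (homog r p) | p. p \<in> A r \<and> p \<noteq> 0}"
  proof -
    have "\<exists>p. f = homog r p \<and> p \<in> A r \<and> p \<noteq> 0" if f: "f \<in> forms r" "f \<noteq> 0" "f \<in> Ann F" for f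
    proof -
      obtain p where "degree p \<le> r" "f = homog r p" using f(1) by (rule forms_homogE)
      then show ?thesis using f homog_in_Ann_iff[OF F] by (intro exI[of _ p]) (auto simp: A_def)
    qed
    moreover have "homog r p \<in> forms r \<and> homog r p \<noteq> 0 \<and> homog r p \<in> Ann F" if "p \<in> A r" "p \<noteq> 0" for p
    proof -
      have "degree p \<le> r" using that by (simp add: A_def apolar_polys_def)
      then show ?thesis using that homog_in_Ann_iff[OF F] by (simp add: A_def homog_eq_0_iff)
    qed
    ultimately show ?thesis
      unfolding points_VPS[OF F] by (intro Collect_cong) metis
  qed
  \<comment> \<open>All nonzero solutions are proportional and so generate the same ideal.\<close>
  have single: "\<exists>Z. points (VPS F r) = {Z}" if small: "2 * r \<le> d + 1"
  proof -
    obtain p where p: "p \<in> A r" "p \<noteq> 0" using exr by blast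
    have "pideal (homog r p') = pideal (homog r p)" if p': "p' \<in> A r" "p' \<noteq> 0" for p'
    proof -
      obtain c where "p' = smult c p"
        using dual.apolar_polys_unique[OF min[unfolded A_def] r1 small] p p' unfolding A_def by metis
      with p'(2) show ?thesis by (auto simp: homog_smult pideal_cscale)
    qed
    then have "points (VPS F r) = {pideal (homog r p)}" unfolding ptsV using p by blast
    then show ?thesis ..
  qed
  have pencil: "isomorphic (VPS F r) P1" if large: "2 * r = d + 2"
  proof -
    have "2 \<le> r" using large assms(1) by auto
    from dual.apolar_polys_pencil[OF min[unfolded A_def] this large, folded A_def]
    obtain f g where fg: "f \<in> A r" "g \<in> A r" "\<And>a b. smult a f + smult b g = 0 \<Longrightarrow> a = 0 \<and> b = 0"
      "\<And>h. h \<in> A r \<Longrightarrow> \<exists>a b. h = smult a f + smult b g" by blast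
    have comb: "smult a f + smult b g \<in> A r" for a b
      unfolding A_def by (intro dual.apolar_polys_add dual.apolar_polys_smult fg[unfolded A_def])
    have hcomb: "homog r (smult a f + smult b g) = cscale a (homog r f) + cscale b (homog r g)" for a b
      by (simp add: homog_add homog_smult)
    show ?thesis
    proof (rule pencil_isomorphic_P1)
      show "homog r f \<in> forms r" "homog r g \<in> forms r" by simp_all
      show "a = 0 \<and> b = 0" if "cscale a (homog r f) + cscale b (homog r g) = 0" for a b
      proof (rule fg(3))
        have "degree (smult a f + smult b g) \<le> r" using comb by (simp add: A_def apolar_polys_def)
        with that show "smult a f + smult b g = 0" by (simp add: homog_eq_0_iff flip: hcomb)
      qed
      show "points (VPS F r) = {pideal (cscale a (homog r f) + cscale b (homog r g)) | a b. a \<noteq> 0 \<or> b \<noteq> 0}"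
        unfolding ptsV hcomb[symmetric]
      proof (intro equalityI subsetI)
        fix Z assume "Z \<in> {pideal (homog r p) | p. p \<in> A r \<and> p \<noteq> 0}"
        then obtain p where p: "Z = pideal (homog r p)" "p \<in> A r" "p \<noteq> 0" by blast
        obtain a b where ab: "p = smult a f + smult b g" using fg(4) p(2) by blast
        then have "a \<noteq> 0 \<or> b \<noteq> 0" using p(3) by auto
        with p(1) ab show "Z \<in> {pideal (homog r (smult a f + smult b g)) | a b. a \<noteq> 0 \<or> b \<noteq> 0}" by auto
      next
        fix Z assume "Z \<in> {pideal (homog r (smult a f + smult b g)) | a b. a \<noteq> 0 \<or> b \<noteq> 0}"
        then obtain a b where ab: "Z = pideal (homog r (smult a f + smult b g))" "a \<noteq> 0 \<or> b \<noteq> 0" by blast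
        then have "smult a f + smult b g \<noteq> 0" using fg(3) by blast
        with ab(1) comb show "Z \<in> {pideal (homog r p) | p. p \<in> A r \<and> p \<noteq> 0}" by blast
      qed
    qed (rule coords_reps_VPS)+
  qed
  have cases: "2 * r \<le> d + 1 \<or> 2 * r = d + 2" using r2 by auto
  \<comment> \<open>An isomorphism is a bijection of points, so P^1 excludes the one-point case and
    leaves 2 r = d + 2.\<close>
  have "even d" if "isomorphic (VPS F r) P1"
  proof -
    have "\<not> (2 * r \<le> d + 1)"
    proof
      assume "2 * r \<le> d + 1"
      then obtain Z where Z: "points (VPS F r) = {Z}" using single by blast
      from that obtain \<phi> where "bij_betw \<phi> (points (VPS F r)) (points P1)"
        by (auto simp: isomorphic_def isomorphism_def)
      then have "points P1 = {\<phi> Z}" by (simp add: bij_betw_def Z)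
      with two_points_P1 show False by blast
    qed
    with cases have "2 * r = d + 2" by blast
    then have "d = 2 * (r - 1)" by simp
    then show ?thesis by simp
  qed
  moreover have "isomorphic (VSP F r) (VPS F r)" if "rk F = r"
    using VSP_eq_VPS[OF F] rk_attained[OF F] that isomorphic_refl by simp
  ultimately show ?thesis using srk border border_VSP_isomorphism cases single pencil by auto
qed

end
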